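(* Let $\lambda>0$. (1) Let $k=\begin{pmatrix}P&Q\\\bar Q&\bar P\end{pmatrix}\in S$, let $A_k$ be a unitary operator on $\mathcal F_\lambda$ with $\rho(k\cdot h)A_k=A_k\rho(h)$ for every $h\in H_n$, and write its integral kernel as $c_k\exp\left(\frac\lambda4z^t\bar QP^{-1}z+\frac\lambda2(P^{-1}z)^t\bar w-\frac\lambda4\bar w^tP^{-1}Q\bar w\right)$ with $c_k\in\mathbb C$. Then $c_k=(\det P)^{-1/2}$ up to multiplication by a complex number of modulus $1$. (2) For each $k=\begin{pmatrix}P&Q\\\bar Q&\bar P\end{pmatrix}\in S$, let $\sigma(k)$ be the operator on $\mathcal F_\lambda$ with integral kernel $$b_k(z,w)=(\det P)^{-1/2}\exp\left(\frac\lambda4z^t\bar QP^{-1}z+\frac\lambda2(P^{-1}z)^t\bar w-\frac\lambda4\bar w^tP^{-1}Q\bar w\right).$$ Then for each $k\in S$ the operator $\sigma(k)$ is unitary, and for all $k,k'\in S$ one has $\sigma(kk')=\pm\sigma(k)\sigma(k')$.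
   Context: Let $n\ge1$. Elements of $\mathbb C^n$ are column vectors and $u^tz=\sum_ju_jz_j$ (no conjugation). $z^{1/2}$ denotes the principal square root (branch cut along the negative real axis), $z^{-1/2}=1/z^{1/2}$. Let $\omega((z,w),(z',w'))=\frac i2(z^tw'-z'^tw)$. The Heisenberg group is $H_n=\{((z,\bar z),c): z\in\mathbb C^n,c\in\mathbb R\}$ with product $((z,\bar z),c)\cdot((z',\bar z'),c')=((z+z',\bar z+\bar z'),c+c'+\frac12\omega((z,\bar z),(z',\bar z')))$. $S$ is the group of complex $2n\times2n$ matrices of the form $\begin{pmatrix}P&Q\\\bar Q&\bar P\end{pmatrix}$ ($P,Q$ of size $n\times n$) which satisfy $M^tJM=J$ with $J=\begin{pmatrix}0&I_n\\-I_n&0\end{pmatrix}$ (for such matrices $P$ is invertible). It acts on $H_n$ by $\begin{pmatrix}P&Q\\\bar Q&\bar P\end{pmatrix}\cdot((z,\bar z),c)=((Pz+Q\bar z,\bar Qz+\bar P\bar z),c)$. $\mathcal F_\lambda$ is the Hilbert space of holomorphic $f$ on $\mathbb C^n$ with $\|f\|^2=\int|f(z)|^2e^{-\lambda|z|^2/2}\,d\mu_\lambda(z)<\infty$, $d\mu_\lambda(z)=(2\pi)^{-n}\lambda^n\,dm(z)$, $dm$ Lebesgue measure. The unitary irreducible representation $\rho=\rho_\lambda$ of $H_n$ on $\mathcal F_\lambda$ is $(\rho(h)f)(z)=\exp(i\lambda c_0+\frac\lambda2\bar z_0^tz-\frac\lambda4|z_0|^2)f(z-z_0)$ for $h=((z_0,\bar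 z_0),c_0)$. An operator $A_k$ as in (1) exists and is unique up to a unit complex number (Stone–von Neumann), and its kernel has the form displayed in (1) for some constant $c_k$. With $e_z(w)=\exp(\lambda\bar z^tw/2)$, the integral kernel of an operator $A$ on $\mathcal F_\lambda$ is $k_A(z,w)=\langle Ae_w,e_z\rangle_{\mathcal F_\lambda}$, so that $(Af)(z)=\int k_A(z,w)f(w)e^{-\lambda|w|^2/2}\,d\mu_\lambda(w)$. *)

theory Defs
  imports "HOL-Analysis.Analysis"
begin

section \<open>The group S of complex block matrices\<close>

definition vcnj :: "complex ^ 'n \<Rightarrow> complex ^ 'n" where
  "vcnj z = (\<chi> i. cnj (z $ i))"

definition block_mat ::
  "complex ^ 'n ^ 'n \<Rightarrow> complex ^ 'n ^ 'n \<Rightarrow> complex ^ 'n ^ 'n \<Rightarrow> complex ^ 'n ^ 'n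
    \<Rightarrow> complex ^ ('n + 'n) ^ ('n + 'n)" where
  "block_mat A B C D = (\<chi> i j.
     case i of
       Inl a \<Rightarrow> (case j of Inl b \<Rightarrow> A $ a $ b | Inr b \<Rightarrow> B $ a $ b)
     | Inr a \<Rightarrow> (case j of Inl b \<Rightarrow> C $ a $ b | Inr b \<Rightarrow> D $ a $ b))"

definition block_ul :: "complex ^ ('n + 'n) ^ ('n + 'n) \<Rightarrow> complex ^ 'n ^ 'n" where
  "block_ul M = (\<chi> i j. M $ Inl i $ Inl j)"

definition block_ur :: "complex ^ ('n + 'n) ^ ('n + 'n) \<Rightarrow> complex ^ 'n ^ 'n" where
  "block_ur M = (\<chi> i j. M $ Inl i $ Inr j)"

definition block_ll :: "complex ^ ('n + 'n) ^ ('n + 'n) \<Rightarrow> complex ^ 'n ^ 'n" where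
  "block_ll M = (\<chi> i j. M $ Inr i $ Inl j)"

definition block_lr :: "complex ^ ('n + 'n) ^ ('n + 'n) \<Rightarrow> complex ^ 'n ^ 'n" where
  "block_lr M = (\<chi> i j. M $ Inr i $ Inr j)"

definition symp_J :: "complex ^ ('n::finite + 'n) ^ ('n + 'n)" where
  "symp_J = block_mat 0 (mat 1) (- mat 1) 0"

definition symp_S :: "(complex ^ ('n::finite + 'n) ^ ('n + 'n)) set" where
  "symp_S = {M. (\<exists>P Q. M = block_mat P Q (map_matrix cnj Q) (map_matrix cnj P)) \<and>
                transpose M ** symp_J ** M = symp_J}"


section \<open>The Heisenberg group and the action of S\<close>

type_synonym 'n heis = "((complex ^ 'n) \<times> (complex ^ 'n)) \<times> real"

definition heisenberg :: "'n::finite heis set" where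
  "heisenberg = {((z, vcnj z), c) | z c. True}"

definition heis_omega ::
  "(complex ^ 'n) \<times> (complex ^ 'n) \<Rightarrow> (complex ^ 'n::finite) \<times> (complex ^ 'n) \<Rightarrow> complex" where
  "heis_omega v v' =
     \<i> / 2 * (scalar_product (fst v) (snd v') - scalar_product (fst v') (snd v))"

text \<open>On \<^const>\<open>heisenberg\<close> the form \<^const>\<open>heis_omega\<close> is real-valued, so that taking the
  real part loses nothing.\<close>

definition heis_mult :: "'n::finite heis \<Rightarrow> 'n heis \<Rightarrow> 'n heis" where
  "heis_mult h h' = (fst h + fst h', snd h + snd h' + Re (heis_omega (fst h) (fst h')) / 2)"

definition symp_act :: "complex ^ ('n::finite + 'n) ^ ('n + 'n) \<Rightarrow> 'n heis \<Rightarrow> 'n heis" where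
  "symp_act k = (\<lambda>((u, v), c).
     ((block_ul k *v u + block_ur k *v v, block_ll k *v u + block_lr k *v v), c))"


section \<open>The Fock space\<close>

definition holomorphic_cn :: "(complex ^ 'n::finite \<Rightarrow> complex) \<Rightarrow> bool" where
  "holomorphic_cn f \<longleftrightarrow>
     (\<forall>z. \<exists>L. (f has_derivative L) (at z) \<and> (\<forall>c v. L (c *s v) = c * L v))"

definition fock_mu :: "real \<Rightarrow> (complex ^ 'n::finite) measure" where
  "fock_mu l = density lborel (\<lambda>_. ennreal (l ^ CARD('n) / (2 * pi) ^ CARD('n)))"

definition fock_weight :: "real \<Rightarrow> complex ^ 'n::finite \<Rightarrow> real" where
  "fock_weight l z = exp (- l * (norm z)\<^sup>2 / 2)"

definition fock :: "real \<Rightarrow> (complex ^ 'n::finite \<Rightarrow> complex) set" where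
  "fock l = {f. holomorphic_cn f \<and>
                integrable (fock_mu l) (\<lambda>z. (cmod (f z))\<^sup>2 * fock_weight l z)}"

definition fock_inner ::
  "real \<Rightarrow> (complex ^ 'n::finite \<Rightarrow> complex) \<Rightarrow> (complex ^ 'n \<Rightarrow> complex) \<Rightarrow> complex" where
  "fock_inner l f g = (LINT z|fock_mu l. f z * cnj (g z) * of_real (fock_weight l z))"

text \<open>Operators on the Fock space are maps on all functions, of which only the restriction
  to \<^term>\<open>fock l\<close> is relevant.\<close>

type_synonym 'n fun_op = "(complex ^ 'n \<Rightarrow> complex) \<Rightarrow> (complex ^ 'n \<Rightarrow> complex)"

definition fock_unitary :: "real \<Rightarrow> 'n::finite fun_op \<Rightarrow> bool" where
  "fock_unitary l A \<longleftrightarrow>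
     (\<forall>f\<in>fock l. \<forall>g\<in>fock l. A (\<lambda>z. f z + g z) = (\<lambda>z. A f z + A g z)) \<and>
     (\<forall>c. \<forall>f\<in>fock l. A (\<lambda>z. c * f z) = (\<lambda>z. c * A f z)) \<and>
     A ` fock l = fock l \<and>
     (\<forall>f\<in>fock l. \<forall>g\<in>fock l. fock_inner l (A f) (A g) = fock_inner l f g)"

definition fock_rep :: "real \<Rightarrow> 'n::finite heis \<Rightarrow> 'n fun_op" where
  "fock_rep l = (\<lambda>((z0, z0'), c0) f z.
     exp (\<i> * of_real l * of_real c0 + of_real l / 2 * scalar_product z0' z
            - of_real l / 4 * of_real ((norm z0)\<^sup>2))
     * f (z - z0))"


section \<open>Integral kernels\<close>

definition coherent :: "real \<Rightarrow> complex ^ 'n::finite \<Rightarrow> complex ^ 'n \<Rightarrow> complex" where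
  "coherent l z w = exp (of_real l * scalar_product (vcnj z) w / 2)"

definition op_kernel ::
  "real \<Rightarrow> 'n::finite fun_op \<Rightarrow> complex ^ 'n \<Rightarrow> complex ^ 'n \<Rightarrow> complex" where
  "op_kernel l A z w = fock_inner l (A (coherent l w)) (coherent l z)"

definition op_of_kernel ::
  "real \<Rightarrow> (complex ^ 'n \<Rightarrow> complex ^ 'n \<Rightarrow> complex) \<Rightarrow> 'n::finite fun_op" where
  "op_of_kernel l b f z = (LINT w|fock_mu l. b z w * f w * of_real (fock_weight l w))"

definition gauss_kernel ::
  "real \<Rightarrow> complex ^ ('n::finite + 'n) ^ ('n + 'n) \<Rightarrow> complex ^ 'n \<Rightarrow> complex ^ 'n \<Rightarrow> complex" where
  "gauss_kernel l k z w =
     (let P = block_ul k; Q = block_ur k; Pinv = matrix_inv P in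
      exp (of_real l / 4 * scalar_product z ((map_matrix cnj Q ** Pinv) *v z)
         + of_real l / 2 * scalar_product (Pinv *v z) (vcnj w)
         - of_real l / 4 * scalar_product (vcnj w) ((Pinv ** Q) *v vcnj w)))"

text \<open>\<^const>\<open>csqrt\<close> is the principal square root, with \<open>csqrt (- x) = \<i> * sqrt x\<close>
  for \<open>x > 0\<close> on the branch cut.\<close>

definition det_factor :: "complex ^ ('n::finite + 'n) ^ ('n + 'n) \<Rightarrow> complex" where
  "det_factor k = 1 / csqrt (det (block_ul k))"

definition sigma_op :: "real \<Rightarrow> complex ^ ('n::finite + 'n) ^ ('n + 'n) \<Rightarrow> 'n fun_op" where
  "sigma_op l k = op_of_kernel l (\<lambda>z w. det_factor k * gauss_kernel l k z w)"

end

(* The exponent of b_k is the generating function of the symplectic map k, evaluated at z and the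
   conjugate of w. Hence |b_k(z,w)| times the square roots of both weights is a Gaussian in z - k.w,
   so Schur's test bounds sigma(k) on L^2. In the integral over u of b_k(z,u) b_k'(u,w) the stationary
   point of the exponent is where the two generating functions compose, so up to the constant
   J = int exp(l/4 (u^t A u + ubar^t B ubar)), with A = Qbar' P'^-1 and B = -P^-1 Q, the result is the
   Gaussian of kk'. Moving A along tA, integration by parts gives (J^2 det(1 - tAB))' = 0, hence
   J^2 det(1 - AB) = 1, which is the multiplicativity of sigma up to sign. With the adjoint of
   sigma(k) being sigma(k^-1) up to a unit factor and sigma(1) = 1 (reproducing property), sigma(k) is
   unitary. The constant c_k in (1) is then read off from the norm of the image of the function 1. *)

theory Submission
  imports Defs "HOL-Probability.Distributions" "HOL-Complex_Analysis.Complex_Analysis"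
begin

text \<open>The critical point of the exponent in the composition integral is a pair (u0, v0) in
  which v0 need not be the conjugate of u0. It then lies outside the domain of integration, and no
  translation completes the square. So the linear terms are switched off by a real parameter, just
  as A is afterwards; in both cases integration by parts turns the derivative of the integral into a
  multiple of the integral. The integrals converge along both paths because |Pv|^2 = |v|^2 + |Qbar
  v|^2 for k in S, which makes Qbar P^-1 and P^-1 Q strict contractions. Working with J^2 avoids
  following a branch of the square root of det (1 - tAB); the sign in the statement absorbs the
  choice. Holomorphic functions are integrated against the weight without power series: averaging
  over circles gives the value at 0. This yields the reproducing property, the value J = 1 at t = 0,
  and sigma(k) applied to the function 1.\<close>

section \<open>Lebesgue measure: Gaussian integrals and invariance under isometries\<close>

lemma nn_integral_lborel_translate:
  fixes c :: "'a::euclidean_space"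
  assumes [measurable]: "f \<in> borel_measurable borel"
  shows "(\<integral>\<^sup>+x. f (c + x) \<partial>lborel) = (\<integral>\<^sup>+x. f x \<partial>lborel)"
proof -
  have "(\<integral>\<^sup>+x. f x \<partial>lborel) = (\<integral>\<^sup>+x. f x \<partial>distr lborel borel ((+) c))"
    by (simp only: lborel_distr_plus)
  also have "\<dots> = (\<integral>\<^sup>+x. f (c + x) \<partial>lborel)"
    by (subst nn_integral_distr) auto
  finally show ?thesis by simp
qed

lemma nn_integral_gaussian:
  assumes "0 < a"
  shows "(\<integral>\<^sup>+x. ennreal (exp (- a * (norm x)\<^sup>2)) \<partial>(lborel :: 'a::euclidean_space measure))
    = ennreal (sqrt (pi / a) ^ DIM('a))"
proof -
  have one: "(\<integral>\<^sup>+x. ennreal (exp (- a * x\<^sup>2)) \<partial>(lborel :: real measure)) = ennreal (sqrt (pi / a))"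
  proof -
    \<comment> \<open>exp (- a x^2) is a multiple of the centred normal density of variance 1/(2a),
      whose moment of order 0 is 1.\<close>
    define s where "s = sqrt (1 / (2 * a))"
    have s: "s > 0" "2 * s\<^sup>2 = 1 / a" "2 * pi * s\<^sup>2 = pi / a" using assms by (auto simp: s_def)
    have hb: "has_bochner_integral lborel (\<lambda>x. normal_density 0 s x * x ^ (2 * 0)) 1"
      using normal_moment_even[OF s(1), of 0 0] by simp
    have "exp (- a * x\<^sup>2) = sqrt (pi / a) * normal_density 0 s x" for x
      using s assms by (simp add: normal_density_def)
    moreover have "has_bochner_integral lborel (\<lambda>x. sqrt (pi / a) * normal_density 0 s x) (sqrt (pi / a) * 1)"
      using hb by (intro has_bochner_integral_mult_right) auto
    ultimately have "has_bochner_integral lborel (\<lambda>x::real. exp (- a * x\<^sup>2)) (sqrt (pi / a))"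
      by simp
    then show ?thesis
      by (subst nn_integral_eq_integral) (auto simp: has_bochner_integral_iff)
  qed
  have "(\<integral>\<^sup>+x. ennreal (exp (- a * (norm x)\<^sup>2)) \<partial>(lborel :: 'a measure))
      = (\<integral>\<^sup>+x. (\<Prod>b\<in>Basis. ennreal (exp (- a * (x \<bullet> b)\<^sup>2))) \<partial>(lborel :: 'a measure))"
  proof (rule nn_integral_cong)
    fix x :: 'a
    have "(norm x)\<^sup>2 = (\<Sum>b\<in>Basis. (x \<bullet> b)\<^sup>2)"
      by (simp add: norm_eq_sqrt_inner euclidean_inner[of x x] power2_eq_square sum_nonneg)
    then show "ennreal (exp (- a * (norm x)\<^sup>2)) = (\<Prod>b\<in>Basis. ennreal (exp (- a * (x \<bullet> b)\<^sup>2)))"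
      by (subst prod_ennreal) (auto simp: exp_sum sum_distrib_left sum_negf[symmetric])
  qed
  also have "\<dots> = (\<Prod>b\<in>(Basis :: 'a set). ennreal (sqrt (pi / a)))"
    using nn_integral_lborel_prod[where f = "\<lambda>b x. ennreal (exp (- a * x\<^sup>2))"] one by simp
  also have "\<dots> = ennreal (sqrt (pi / a) ^ DIM('a))"
    using assms by (subst prod_ennreal) auto
  finally show ?thesis .
qed

text \<open>A translation-invariant measure is determined up to a factor by its value on one function
  (here a Gaussian, which an isometry preserves), by Fubini's theorem.\<close>

lemma nn_integral_lborel_isometry:
  fixes T :: "'a::euclidean_space \<Rightarrow> 'a"
  assumes T: "linear T" "\<And>x. norm (T x) = norm x"
    and S: "\<And>x. T (S x) = x"
    and [measurable]: "f \<in> borel_measurable borel"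
  shows "(\<integral>\<^sup>+x. f (T x) \<partial>lborel) = (\<integral>\<^sup>+x. f x \<partial>lborel)"
proof -
  have TM[measurable]: "T \<in> borel_measurable borel"
    using T(1) by (intro borel_measurable_continuous_onI linear_continuous_on)
      (simp add: linear_conv_bounded_linear)
  define g where "g x = ennreal (exp (- 1 * (norm (x::'a))\<^sup>2))" for x
  have [measurable]: "g \<in> borel_measurable borel" unfolding g_def by measurable
  have gT: "g (T x) = g x" and gm: "g (- x) = g x" for x
    by (auto simp: g_def T(2))
  define G where "G = (\<integral>\<^sup>+x. g x \<partial>lborel)"
  have G: "G \<noteq> 0" "G \<noteq> \<infinity>"
    unfolding G_def g_def by (subst nn_integral_gaussian; simp)+
  have "(\<integral>\<^sup>+x. f (T x) \<partial>lborel) * G = (\<integral>\<^sup>+x. f (T x) * G \<partial>lborel)"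
    by (rule nn_integral_multc[symmetric]) measurable
  also have "\<dots> = (\<integral>\<^sup>+x. (\<integral>\<^sup>+y. f (T x) * g (y - T x) \<partial>lborel) \<partial>lborel)"
  proof (rule nn_integral_cong)
    fix x
    have "G = (\<integral>\<^sup>+y. g (- T x + y) \<partial>lborel)"
      unfolding G_def by (rule nn_integral_lborel_translate[symmetric]) measurable
    then show "f (T x) * G = (\<integral>\<^sup>+y. f (T x) * g (y - T x) \<partial>lborel)"
      by (subst nn_integral_cmult) (auto simp: algebra_simps)
  qed
  also have "\<dots> = (\<integral>\<^sup>+y. (\<integral>\<^sup>+x. f (T x) * g (y - T x) \<partial>lborel) \<partial>lborel)"
    by (rule lborel_pair.Fubini') measurable
  \<comment> \<open>Translating x by S y turns f (T x) into f (y + T x) and y - T x into - T x. As g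
    is even and invariant under T, the map T is left only inside f, where a translation of y removes
    it.\<close>
  also have "\<dots> = (\<integral>\<^sup>+y. (\<integral>\<^sup>+x. f (y + T x) * g x \<partial>lborel) \<partial>lborel)"
  proof (rule nn_integral_cong)
    fix y
    have "(\<integral>\<^sup>+x. f (T x) * g (y - T x) \<partial>lborel) = (\<integral>\<^sup>+x. f (T (S y + x)) * g (y - T (S y + x)) \<partial>lborel)"
      by (rule nn_integral_lborel_translate[symmetric]) measurable
    also have "\<dots> = (\<integral>\<^sup>+x. f (y + T x) * g x \<partial>lborel)"
      by (simp add: linear_add[OF T(1)] S gm gT)
    finally show "(\<integral>\<^sup>+x. f (T x) * g (y - T x) \<partial>lborel) = (\<integral>\<^sup>+x. f (y + T x) * g x \<partial>lborel)" .
  qed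
  also have "\<dots> = (\<integral>\<^sup>+x. (\<integral>\<^sup>+y. f (y + T x) * g x \<partial>lborel) \<partial>lborel)"
    by (rule lborel_pair.Fubini') measurable
  also have "\<dots> = (\<integral>\<^sup>+x. (\<integral>\<^sup>+y. f y \<partial>lborel) * g x \<partial>lborel)"
  proof (rule nn_integral_cong)
    fix x
    show "(\<integral>\<^sup>+y. f (y + T x) * g x \<partial>lborel) = (\<integral>\<^sup>+y. f y \<partial>lborel) * g x"
      using nn_integral_lborel_translate[of f "T x"]
      by (subst nn_integral_multc) (auto simp: add.commute)
  qed
  also have "\<dots> = (\<integral>\<^sup>+y. f y \<partial>lborel) * G"
    unfolding G_def by (rule nn_integral_cmult) measurable
  finally show ?thesis
    using G by (auto simp: mult.commute ennreal_mult_cancel_left)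
qed

lemma distr_lborel_isometry:
  fixes T :: "'a::euclidean_space \<Rightarrow> 'a"
  assumes T: "linear T" "\<And>x. norm (T x) = norm x" and S: "\<And>x. T (S x) = x"
  shows "distr lborel borel T = lborel"
proof (rule measure_eqI)
  have TM[measurable]: "T \<in> borel_measurable borel"
    using T(1) by (intro borel_measurable_continuous_onI linear_continuous_on)
      (simp add: linear_conv_bounded_linear)
  fix A assume "A \<in> sets (distr lborel borel T)"
  then have [measurable]: "A \<in> sets borel" by simp
  have "emeasure (distr lborel borel T) A = (\<integral>\<^sup>+x. indicator A x \<partial>distr lborel borel T)"
    by simp
  also have "\<dots> = (\<integral>\<^sup>+x. indicator A (T x) \<partial>lborel)"
    by (rule nn_integral_distr) auto
  also have "\<dots> = (\<integral>\<^sup>+x. indicator A x \<partial>lborel)"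
    by (rule nn_integral_lborel_isometry[OF T S]) measurable
  finally show "emeasure (distr lborel borel T) A = emeasure lborel A" by simp
qed simp

section \<open>Gaussian measure on complex n-space\<close>

abbreviation sp :: "complex ^ 'n::finite \<Rightarrow> complex ^ 'n \<Rightarrow> complex" where
  "sp \<equiv> scalar_product"

lemma sets_fock_mu[measurable_cong, simp]: "sets (fock_mu l) = sets borel"
  and space_fock_mu[simp]: "space (fock_mu l) = UNIV"
  by (simp_all add: fock_mu_def)

lemma borel_measurable_fock_mu: "borel_measurable (fock_mu l) = borel_measurable borel"
  by (rule measurable_cong_sets) simp_all

lemma nn_integral_fock_mu:
  assumes [measurable]: "f \<in> borel_measurable borel"
  shows "(\<integral>\<^sup>+z. f z \<partial>(fock_mu l :: (complex ^ 'n::finite) measure))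
    = ennreal (l ^ CARD('n) / (2 * pi) ^ CARD('n)) * (\<integral>\<^sup>+z. f z \<partial>lborel)"
  unfolding fock_mu_def by (simp add: nn_integral_density nn_integral_cmult)

lemma sigma_finite_fock_mu:
  "sigma_finite_measure (fock_mu l :: (complex ^ 'n::finite) measure)"
  unfolding fock_mu_def
  by (subst sigma_finite_measure.sigma_finite_iff_density_finite[OF sigma_finite_lborel]) auto

lemma distr_fock_mu:
  fixes T :: "complex ^ 'n::finite \<Rightarrow> complex ^ 'n"
  assumes "distr lborel borel T = lborel"
    and [measurable]: "T \<in> borel_measurable borel"
  shows "distr (fock_mu l) borel T = fock_mu l"
proof (rule measure_eqI)
  fix A assume "A \<in> sets (distr (fock_mu l) borel T)"
  then have [measurable]: "A \<in> sets borel" by simp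
  have "emeasure (distr (fock_mu l) borel T) A = emeasure (fock_mu l) (T -` A \<inter> space borel)"
    by (subst emeasure_distr) auto
  also have "\<dots> = ennreal (l ^ CARD('n) / (2 * pi) ^ CARD('n)) * emeasure (distr lborel borel T) A"
    using measurable_sets_borel[OF assms(2), of A]
    unfolding fock_mu_def by (simp add: emeasure_distr emeasure_density_const)
  also have "\<dots> = emeasure (fock_mu l) A"
    unfolding assms(1) fock_mu_def by (simp add: emeasure_density_const)
  finally show "emeasure (distr (fock_mu l) borel T) A = emeasure (fock_mu l) A" .
qed simp

lemma fock_mu_translate_integral:
  fixes f :: "complex ^ 'n::finite \<Rightarrow> 'b::{banach, second_countable_topology}"
  assumes [measurable]: "f \<in> borel_measurable borel"
  shows "integrable (fock_mu l) (\<lambda>z. f (z + c)) \<longleftrightarrow> integrable (fock_mu l) f"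
    and "(LINT z|fock_mu l. f (z + c)) = (LINT z|fock_mu l. f z)"
proof -
  have d: "distr (fock_mu l) borel ((+) c) = fock_mu l"
    by (rule distr_fock_mu[OF lborel_distr_plus]) measurable
  show "integrable (fock_mu l) (\<lambda>z. f (z + c)) \<longleftrightarrow> integrable (fock_mu l) f"
    using integrable_distr_eq[of "(+) c" "fock_mu l" borel f] by (simp add: d add.commute)
  show "(LINT z|fock_mu l. f (z + c)) = (LINT z|fock_mu l. f z)"
    using integral_distr[of "(+) c" "fock_mu l" borel f] by (simp add: d add.commute)
qed

text \<open>Unit scalars act by isometries. This circle action is the one that the mean value
  property averages over.\<close>

lemma fock_mu_rotate:
  fixes f :: "complex ^ 'n::finite \<Rightarrow> 'b::{banach, second_countable_topology}"
  assumes [measurable]: "f \<in> borel_measurable borel" and c: "cmod c = 1"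
  shows "integrable (fock_mu l) (\<lambda>z. f (c *s z)) \<longleftrightarrow> integrable (fock_mu l) f"
    and "(LINT z|fock_mu l. f (c *s z)) = (LINT z|fock_mu l. f z)"
proof -
  have lin: "linear (\<lambda>z. c *s z :: complex ^ 'n)"
    by (rule linearI) (auto simp: vec_eq_iff algebra_simps)
  have nrm: "norm (c *s z) = norm z" for z :: "complex ^ 'n"
    using c by (simp add: norm_vec_def norm_mult)
  have M[measurable]: "(\<lambda>z. c *s z :: complex ^ 'n) \<in> borel_measurable borel"
    using lin by (intro borel_measurable_continuous_onI linear_continuous_on)
      (simp add: linear_conv_bounded_linear)
  have "c \<noteq> 0" using c by auto
  then have inv: "c *s (inverse c *s z) = z" for z :: "complex ^ 'n"
    by (auto simp: vec_eq_iff)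
  have d: "distr (fock_mu l) borel (\<lambda>z. c *s z :: complex ^ 'n) = fock_mu l"
    by (intro distr_fock_mu distr_lborel_isometry[OF lin nrm inv] M)
  show "integrable (fock_mu l) (\<lambda>z. f (c *s z)) \<longleftrightarrow> integrable (fock_mu l) f"
    using integrable_distr_eq[of "\<lambda>z. c *s z" "fock_mu l" borel f] by (simp add: d)
  show "(LINT z|fock_mu l. f (c *s z)) = (LINT z|fock_mu l. f z)"
    using integral_distr[of "\<lambda>z. c *s z" "fock_mu l" borel f] by (simp add: d)
qed

text \<open>The real dimension is 2n, so sqrt (pi / a) ^ (2n) meets the density (l / (2 pi))^n. For
  a = l/2 the mass is 1, which is the normalisation built into \<open>fock_mu\<close>.\<close>

lemma fock_mu_gaussian:
  assumes "0 < l" "0 < a"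
  shows "has_bochner_integral (fock_mu l)
    (\<lambda>z :: complex ^ 'n::finite. exp (- a * (norm z)\<^sup>2)) ((l / (2 * a)) ^ CARD('n))"
proof (rule has_bochner_integral_nn_integral)
  have "(\<integral>\<^sup>+z. ennreal (exp (- a * (norm z)\<^sup>2)) \<partial>(fock_mu l :: (complex ^ 'n) measure))
      = ennreal (l ^ CARD('n) / (2 * pi) ^ CARD('n)) * ennreal (sqrt (pi / a) ^ (CARD('n) * 2))"
    using nn_integral_gaussian[OF assms(2), where 'a = "complex ^ 'n"]
    by (subst nn_integral_fock_mu) (auto simp: DIM_cart)
  also have "sqrt (pi / a) ^ (CARD('n) * 2) = (pi / a) ^ CARD('n)"
    using assms by (simp add: mult.commute[of _ 2] power_mult)
  also have "ennreal (l ^ CARD('n) / (2 * pi) ^ CARD('n)) * ennreal ((pi / a) ^ CARD('n))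
      = ennreal (((l / (2 * pi)) * (pi / a)) ^ CARD('n))"
    using assms by (subst ennreal_mult[symmetric]) (auto simp: power_mult_distrib power_divide)
  also have "(l / (2 * pi)) * (pi / a) = l / (2 * a)" by simp
  finally show "(\<integral>\<^sup>+z. ennreal (exp (- a * (norm z)\<^sup>2)) \<partial>(fock_mu l :: (complex ^ 'n) measure))
      = ennreal ((l / (2 * a)) ^ CARD('n))" .
qed (use assms in auto)

lemma has_bochner_integral_fock_weight:
  "0 < l \<Longrightarrow> has_bochner_integral (fock_mu l) (fock_weight l :: complex ^ 'n::finite \<Rightarrow> real) 1"
  using fock_mu_gaussian[of l "l / 2", where 'n = 'n] by (simp add: fock_weight_def[abs_def])

section \<open>The bilinear pairing\<close>

lemma sp_add_left: "sp (x + y) z = sp x z + sp y z"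
  and sp_add_right: "sp z (x + y) = sp z x + sp z y"
  and sp_diff_left: "sp (x - y) z = sp x z - sp y z"
  and sp_diff_right: "sp z (x - y) = sp z x - sp z y"
  and sp_minus_left: "sp (- x) z = - sp x z"
  and sp_minus_right: "sp z (- x) = - sp z x"
  and sp_smult_left: "sp (c *s x) z = c * sp x z"
  and sp_smult_right: "sp z (c *s x) = c * sp z x"
  and sp_scaleR_left: "sp (r *\<^sub>R x) z = of_real r * sp x z"
  and sp_scaleR_right: "sp z (r *\<^sub>R x) = of_real r * sp z x"
  and sp_zero_left: "sp 0 z = 0"
  and sp_zero_right: "sp z 0 = 0"
  by (simp_all add: scalar_product_def algebra_simps sum.distrib sum_subtractf sum_negf
      sum_distrib_left scaleR_conv_of_real[where 'a = complex])

lemmas sp_simps = sp_add_left sp_add_right sp_diff_left sp_diff_right sp_minus_left sp_minus_right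
  sp_smult_left sp_smult_right sp_scaleR_left sp_scaleR_right sp_zero_left sp_zero_right

lemma sp_commute: "sp x y = sp y x"
  by (simp add: scalar_product_def mult.commute)

lemma sp_axis_left: "sp (axis i 1) x = x $ i"
  by (simp add: scalar_product_def axis_def if_distrib[where f = "\<lambda>a. a * _"] cong: if_cong)

lemma matrix_vec_axis:
  fixes C :: "complex ^ 'n::finite ^ 'm::finite"
  shows "(C *v axis i 1) $ j = C $ j $ i"
proof -
  have "(C *v axis i 1) $ j = sp (C $ j) (axis i 1)"
    by (simp add: matrix_vector_mult_def scalar_product_def)
  also have "\<dots> = C $ j $ i"
    by (simp only: sp_commute[of "C $ j"] sp_axis_left)
  finally show ?thesis .
qed

lemma sp_matrix_left: "sp (A *v x) y = sp x (transpose A *v y)"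
proof -
  have "sp (A *v x) y = (\<Sum>i\<in>UNIV. \<Sum>j\<in>UNIV. A $ i $ j * x $ j * y $ i)"
    by (simp add: scalar_product_def matrix_vector_mult_def sum_distrib_right)
  also have "\<dots> = (\<Sum>j\<in>UNIV. \<Sum>i\<in>UNIV. A $ i $ j * x $ j * y $ i)"
    by (rule sum.swap)
  also have "\<dots> = sp x (transpose A *v y)"
    by (simp add: scalar_product_def matrix_vector_mult_def transpose_def sum_distrib_left mult_ac)
  finally show ?thesis .
qed

lemma vcnj_simps:
  "vcnj (x + y) = vcnj x + vcnj y" "vcnj (x - y) = vcnj x - vcnj y" "vcnj (- x) = - vcnj x"
  "vcnj (c *s x) = cnj c *s vcnj x" "vcnj (r *\<^sub>R x) = r *\<^sub>R vcnj x" "vcnj 0 = 0"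
  "vcnj (vcnj x) = x"
  by (simp_all add: vcnj_def vec_eq_iff)

lemma norm_vcnj: "norm (vcnj x) = norm x"
  by (simp add: norm_vec_def vcnj_def)

lemma vcnj_matrix: "vcnj (A *v x) = map_matrix cnj A *v vcnj x"
  by (simp add: vcnj_def vec_eq_iff matrix_vector_mult_def map_matrix_def)

lemma cnj_sp: "cnj (sp x y) = sp (vcnj x) (vcnj y)"
  by (simp add: scalar_product_def vcnj_def)

lemma sp_vcnj_self: "sp (vcnj x) x = of_real ((norm x)\<^sup>2)" "sp x (vcnj x) = of_real ((norm x)\<^sup>2)"
proof -
  show *: "sp x (vcnj x) = of_real ((norm x)\<^sup>2)"
    by (simp add: scalar_product_def vcnj_def norm_vec_def L2_set_def sum_nonneg flip: complex_norm_square)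
  then show "sp (vcnj x) x = of_real ((norm x)\<^sup>2)"
    by (simp add: sp_commute)
qed

lemma norm_sp_le: "cmod (sp x y) \<le> norm x * norm y"
proof -
  have "cmod (sp x y) \<le> (\<Sum>i\<in>UNIV. \<bar>cmod (x $ i)\<bar> * \<bar>cmod (y $ i)\<bar>)"
    unfolding scalar_product_def by (rule order_trans[OF norm_sum]) (simp add: norm_mult)
  also have "\<dots> \<le> norm x * norm y"
    unfolding norm_vec_def by (rule L2_set_mult_ineq)
  finally show ?thesis .
qed

lemma norm_smult_vec: "norm (c *s x) = cmod c * norm (x :: complex ^ 'n::finite)"
proof -
  have "norm (c *s x) = L2_set (\<lambda>i. cmod c * cmod (x $ i)) UNIV"
    by (simp add: norm_vec_def norm_mult)
  also have "\<dots> = cmod c * norm x"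
    by (simp add: norm_vec_def L2_set_right_distrib)
  finally show ?thesis .
qed

lemma sp_eqI:
  assumes "\<And>z. sp z x = sp z y"
  shows "x = y"
  using assms[of "axis _ 1"] by (simp add: vec_eq_iff sp_axis_left)

lemma continuous_on_vcnj[continuous_intros]:
  "continuous_on S f \<Longrightarrow> continuous_on S (\<lambda>x. vcnj (f x))"
  unfolding vcnj_def by (intro continuous_intros)

lemma continuous_on_sp[continuous_intros]:
  "continuous_on S f \<Longrightarrow> continuous_on S g \<Longrightarrow> continuous_on S (\<lambda>x. sp (f x) (g x))"
  unfolding scalar_product_def by (intro continuous_intros)

lemma continuous_on_matrix_vec[continuous_intros]:
  fixes A :: "complex ^ 'n::finite ^ 'm::finite"
  shows "continuous_on S f \<Longrightarrow> continuous_on S (\<lambda>x. A *v f x)"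
  unfolding matrix_vector_mult_def by (intro continuous_intros)

lemma continuous_on_smult_vec[continuous_intros]:
  fixes f :: "'a::topological_space \<Rightarrow> complex"
  shows "continuous_on S f \<Longrightarrow> continuous_on S g \<Longrightarrow> continuous_on S (\<lambda>x. f x *s (g x :: complex ^ 'n::finite))"
  unfolding vector_scalar_mult_def by (intro continuous_intros)

lemma bounded_linear_matrix_vec:
  fixes A :: "complex ^ 'n::finite ^ 'm::finite"
  shows "bounded_linear ((*v) A)"
  by (rule linear_conv_bounded_linear[THEN iffD1], rule linearI)
    (auto simp: vec_eq_iff matrix_vector_mult_def algebra_simps sum.distrib scaleR_sum_right)

lemma norm_matrix_le:
  fixes A :: "complex ^ 'n::finite ^ 'm::finite"
  obtains K where "K > 0" "\<And>x. norm (A *v x) \<le> K * norm x"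
  using bounded_linear.pos_bounded[OF bounded_linear_matrix_vec[of A]]
  by (auto simp: mult.commute)

section \<open>Holomorphic functions and the reproducing property\<close>

lemma holomorphic_cnI:
  assumes "\<And>z. (f has_derivative L z) (at z)" "\<And>z c v. L z (c *s v) = c * L z v"
  shows "holomorphic_cn f"
  using assms unfolding holomorphic_cn_def by blast

lemma holomorphic_cnE:
  assumes "holomorphic_cn f"
  obtains L where "\<And>z. (f has_derivative L z) (at z)" "\<And>z c v. L z (c *s v) = c * L z v"
  using assms unfolding holomorphic_cn_def by metis

lemma holomorphic_cn_const: "holomorphic_cn (\<lambda>z. c)"
  by (rule holomorphic_cnI[where L = "\<lambda>z v. 0"]) auto

lemma holomorphic_cn_add:
  assumes "holomorphic_cn f" "holomorphic_cn g"
  shows "holomorphic_cn (\<lambda>z. f z + g z)"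
proof -
  obtain F where F: "\<And>z. (f has_derivative F z) (at z)" "\<And>z c v. F z (c *s v) = c * F z v"
    by (rule holomorphic_cnE[OF assms(1)]) auto
  obtain G where G: "\<And>z. (g has_derivative G z) (at z)" "\<And>z c v. G z (c *s v) = c * G z v"
    by (rule holomorphic_cnE[OF assms(2)]) auto
  show ?thesis
    by (rule holomorphic_cnI[OF has_derivative_add[OF F(1) G(1)]]) (simp add: F G algebra_simps)
qed

lemma holomorphic_cn_mult:
  assumes "holomorphic_cn f" "holomorphic_cn g"
  shows "holomorphic_cn (\<lambda>z. f z * g z)"
proof -
  obtain F where F: "\<And>z. (f has_derivative F z) (at z)" "\<And>z c v. F z (c *s v) = c * F z v"
    by (rule holomorphic_cnE[OF assms(1)]) auto
  obtain G where G: "\<And>z. (g has_derivative G z) (at z)" "\<And>z c v. G z (c *s v) = c * G z v"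
    by (rule holomorphic_cnE[OF assms(2)]) auto
  show ?thesis
    by (rule holomorphic_cnI[OF has_derivative_mult[OF F(1) G(1)]]) (simp add: F G algebra_simps)
qed

lemma holomorphic_cn_exp:
  assumes "holomorphic_cn f"
  shows "holomorphic_cn (\<lambda>z. exp (f z))"
proof -
  obtain F where F: "\<And>z. (f has_derivative F z) (at z)" "\<And>z c v. F z (c *s v) = c * F z v"
    by (rule holomorphic_cnE[OF assms(1)]) auto
  have "((\<lambda>z. exp (f z)) has_derivative (\<lambda>v. exp (f z) * F z v)) (at z)" for z
    by (rule has_derivative_compose[OF F(1), of exp, OF DERIV_exp[unfolded has_field_derivative_def]])
  then show ?thesis
    by (rule holomorphic_cnI) (simp add: F algebra_simps)
qed

lemma bounded_linear_sp: "bounded_linear (sp a)"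
  by (rule bounded_linear_intro[where K = "norm a"])
    (auto simp: sp_simps scaleR_conv_of_real[where 'a = complex] mult.commute[of _ "norm a"] norm_sp_le)

lemma holomorphic_cn_sp: "holomorphic_cn (sp a)"
  by (rule holomorphic_cnI[where L = "\<lambda>z. sp a"])
    (auto simp: sp_simps bounded_linear_imp_has_derivative bounded_linear_sp)

lemma matrix_vec_scaleR:
  fixes C :: "complex ^ 'n::finite ^ 'm::finite"
  shows "C *v (t *\<^sub>R x) = t *\<^sub>R (C *v x)"
  by (rule linear_cmul[OF bounded_linear.linear[OF bounded_linear_matrix_vec]])

lemma scaleR_matrix_vec:
  fixes C :: "complex ^ 'n::finite ^ 'm::finite"
  shows "(t *\<^sub>R C) *v x = t *\<^sub>R (C *v x)"
  by (auto simp: vec_eq_iff matrix_vector_mult_def scaleR_conv_of_real[where 'a = complex] sum_distrib_left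
      intro!: sum.cong)

lemma matrix_vec_smult: "A *v (c *s x) = c *s (A *v (x :: complex ^ 'n::finite))"
  by (simp add: vec_eq_iff matrix_vector_mult_def sum_distrib_left mult_ac)

lemma holomorphic_cn_compose_matrix:
  assumes "holomorphic_cn f"
  shows "holomorphic_cn (\<lambda>z. f (A *v z + b))"
proof -
  obtain F where F: "\<And>z. (f has_derivative F z) (at z)" "\<And>z c v. F z (c *s v) = c * F z v"
    by (rule holomorphic_cnE[OF assms(1)]) auto
  have "((\<lambda>z. A *v z + b) has_derivative (\<lambda>v. A *v v + 0)) (at z)" for z
    by (intro has_derivative_add has_derivative_const bounded_linear_imp_has_derivative
        bounded_linear_matrix_vec)
  from has_derivative_compose[OF this F(1)] show ?thesis
    by (rule holomorphic_cnI) (simp add: F matrix_vec_smult)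
qed

lemma holomorphic_cn_sp_matrix:
  fixes A :: "complex ^ 'n::finite ^ 'n"
  shows "holomorphic_cn (\<lambda>z. sp z (A *v z))"
proof (rule holomorphic_cnI)
  show "((\<lambda>z. sp z (A *v z)) has_derivative (\<lambda>v. sp z (A *v v) + sp v (A *v z))) (at z)" for z
  proof -
    have "bounded_bilinear (\<lambda>x y. sp x (y :: complex ^ 'n))"
      by (rule bounded_bilinear.intro)
        (auto simp: sp_simps scaleR_conv_of_real[where 'a = complex] intro!: exI[of _ 1] norm_sp_le)
    from bounded_bilinear.FDERIV[OF this has_derivative_ident
        bounded_linear_imp_has_derivative[OF bounded_linear_matrix_vec]]
    show ?thesis .
  qed
qed (simp add: sp_simps matrix_vec_smult algebra_simps)

lemma holomorphic_cn_continuous: "holomorphic_cn f \<Longrightarrow> continuous_on S f"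
  unfolding holomorphic_cn_def
  by (meson continuous_at_imp_continuous_on has_derivative_continuous)

lemma holomorphic_cn_measurable: "holomorphic_cn f \<Longrightarrow> f \<in> borel_measurable borel"
  by (intro borel_measurable_continuous_onI holomorphic_cn_continuous)

text \<open>Cauchy's theorem in one variable is applied on complex lines through 0.\<close>

lemma holomorphic_cn_ray:
  assumes "holomorphic_cn f"
  shows "(\<lambda>t. f (t *s v)) holomorphic_on UNIV"
proof -
  obtain F where F: "\<And>z. (f has_derivative F z) (at z)" "\<And>z c v. F z (c *s v) = c * F z v"
    by (rule holomorphic_cnE[OF assms(1)]) auto
  have "((\<lambda>t. f (t *s v)) has_field_derivative F (t *s v) v) (at t)" for t
  proof -
    have "bounded_linear (\<lambda>t. t *s v)"
      by (rule bounded_linear_intro[where K = "norm v"])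
        (auto simp: norm_smult_vec vec_eq_iff algebra_simps)
    from has_derivative_compose[OF bounded_linear_imp_has_derivative[OF this] F(1)]
    show ?thesis by (simp add: F has_field_derivative_def mult_commute_abs)
  qed
  then show ?thesis by (auto simp: holomorphic_on_open)
qed

text \<open>Cauchy's formula at the centre of the unit circle: the denominator cancels against the
  derivative of the parametrisation up to the factor 2 pi i.\<close>

lemma holomorphic_circle_mean:
  assumes "g holomorphic_on UNIV"
  shows "(LBINT x:{0..1}. g (cis (2 * pi * x))) = g 0"
proof -
  have "((\<lambda>u. g u / (u - 0)) has_contour_integral (2 * of_real pi * \<i> * g 0)) (circlepath 0 1)"
    by (rule Cauchy_integral_circlepath_simple) (auto intro: holomorphic_on_subset[OF assms])
  then have "((\<lambda>x. g (circlepath 0 1 x) / circlepath 0 1 x *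
      vector_derivative (circlepath 0 1) (at x within {0..1})) has_integral (2 * of_real pi * \<i> * g 0)) {0..1}"
    by (simp add: has_contour_integral_def)
  then have "((\<lambda>x. 2 * of_real pi * \<i> * g (cis (2 * pi * x))) has_integral (2 * of_real pi * \<i> * g 0)) {0..1}"
  proof (rule has_integral_eq[rotated])
    fix x :: real assume x: "x \<in> {0..1}"
    have c: "circlepath 0 1 x = cis (2 * pi * x)" "exp (2 * of_real pi * \<i> * of_real x) = cis (2 * pi * x)"
      by (simp_all add: circlepath cis_conv_exp mult_ac)
    have d: "vector_derivative (circlepath 0 1) (at x within {0..1}) = 2 * of_real pi * \<i> * cis (2 * pi * x)"
      using x by (simp add: vector_derivative_circlepath01 c)
    show "g (circlepath 0 1 x) / circlepath 0 1 x * vector_derivative (circlepath 0 1) (at x within {0..1})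
        = 2 * of_real pi * \<i> * g (cis (2 * pi * x))"
      unfolding c d by simp
  qed
  then have hi: "((\<lambda>x. g (cis (2 * pi * x))) has_integral g 0) {0..1}"
    using has_integral_mult_right[of _ "2 * of_real pi * \<i> * g 0" "{0..1}" "1 / (2 * of_real pi * \<i>)"]
    by fastforce
  have "continuous_on {0..1} (\<lambda>x. g (cis (2 * pi * x)))"
    by (intro continuous_on_compose2[OF holomorphic_on_imp_continuous_on[OF assms]] continuous_intros) auto
  then have "set_integrable lborel {0..1} (\<lambda>x. g (cis (2 * pi * x)))"
    by (rule borel_integrable_atLeastAtMost')
  from set_borel_integral_eq_integral(2)[OF this] hi show ?thesis
    by (simp add: integral_unique)
qed

lemma fock_weight_cong_norm: "norm z = norm z' \<Longrightarrow> fock_weight l z = fock_weight l z'"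
  by (simp add: fock_weight_def)

lemma fock_weight_pos[simp]: "fock_weight l z > 0" "fock_weight l z \<ge> 0"
  by (simp_all add: fock_weight_def)

lemma continuous_on_fock_weight[continuous_intros]:
  "continuous_on S f \<Longrightarrow> continuous_on S (\<lambda>x. fock_weight l (f x))"
  unfolding fock_weight_def by (intro continuous_intros) auto

lemma measurable_fock_weight[measurable]: "fock_weight l \<in> borel_measurable borel"
  by (intro borel_measurable_continuous_onI continuous_intros)

text \<open>Measure and weight are invariant under the circle action, so the integrand may be
  replaced by its average over each circle. There f averages to f 0, and the weight has mass 1.
  Integrability of f against the weight is all that is assumed, so f may lie outside the Fock
  space.\<close>

lemma fock_mean_value:
  fixes f :: "complex ^ 'n::finite \<Rightarrow> complex"
  assumes l: "0 < l" and f: "holomorphic_cn f"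
    and int: "integrable (fock_mu l) (\<lambda>z. f z * of_real (fock_weight l z))"
  shows "(LINT z|fock_mu l. f z * of_real (fock_weight l z)) = f 0"
proof -
  define h where "h = (\<lambda>z. f z * of_real (fock_weight l z))"
  define U :: "real measure" where "U = restrict_space lborel {0..1}"
  define R where "R = (\<lambda>(x::real) (z :: complex ^ 'n). cis (2 * pi * x) *s z)"
  interpret F: sigma_finite_measure "fock_mu l :: (complex ^ 'n) measure"
    by (rule sigma_finite_fock_mu)
  interpret U: prob_space U
    by (rule prob_spaceI) (simp add: U_def emeasure_restrict_space space_restrict_space)
  interpret P: pair_sigma_finite U "fock_mu l :: (complex ^ 'n) measure" ..
  have hc: "continuous_on UNIV h"
    unfolding h_def by (intro continuous_intros holomorphic_cn_continuous f)
  have hm[measurable]: "h \<in> borel_measurable borel"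
    by (intro borel_measurable_continuous_onI hc)
  have "(\<lambda>p. h (R (fst p) (snd p))) \<in> borel_measurable borel"
    unfolding R_def
    by (intro borel_measurable_continuous_onI continuous_on_compose2[OF hc] continuous_intros) auto
  then have m1: "(\<lambda>p. h (R (fst p) (snd p))) \<in> borel_measurable (borel \<Otimes>\<^sub>M borel)"
    by (simp add: borel_prod)
  have Ub: "(\<lambda>x. x) \<in> measurable U borel"
    unfolding U_def by (intro measurable_restrict_space1) auto
  have m[measurable]: "(\<lambda>(x, z). h (R x z)) \<in> borel_measurable (U \<Otimes>\<^sub>M fock_mu l)"
  proof -
    have "(\<lambda>p. (fst p, snd p)) \<in> measurable (U \<Otimes>\<^sub>M fock_mu l) (borel \<Otimes>\<^sub>M (borel :: (complex ^ 'n) measure))"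
      by (intro measurable_Pair measurable_compose[OF measurable_fst Ub]) simp
    from measurable_compose[OF this m1] show ?thesis by (simp add: case_prod_beta')
  qed
  have rotint: "integrable (fock_mu l) (\<lambda>z. h (R x z))"
    and rot: "(LINT z|fock_mu l. h (R x z)) = (LINT z|fock_mu l. h z)"
    and rotn: "(LINT z|fock_mu l. norm (h (R x z))) = (LINT z|fock_mu l. norm (h z))" for x
    using fock_mu_rotate[of h "cis (2 * pi * x)" l] fock_mu_rotate[of "\<lambda>z. norm (h z)" "cis (2 * pi * x)" l]
      int unfolding R_def h_def[symmetric] by auto
  \<comment> \<open>The norm of the rotated integrand has the same integral for every angle, and the
    angles carry a probability measure.\<close>
  have I: "integrable (U \<Otimes>\<^sub>M fock_mu l) (\<lambda>(x, z). h (R x z))"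
    by (rule P.Fubini_integrable) (use rotint in \<open>auto simp: rotn\<close>)
  have "(LINT z|fock_mu l. h z) = (LINT x|U. (LINT z|fock_mu l. h (R x z)))"
    by (simp add: rot U.prob_space)
  also have "\<dots> = (LINT z|fock_mu l. (LINT x|U. h (R x z)))"
    by (rule P.Fubini_integral[OF I, symmetric])
  also have "\<dots> = (LINT (z :: complex ^ 'n)|fock_mu l. f 0 * of_real (fock_weight l z))"
  proof (rule Bochner_Integration.integral_cong[OF refl])
    fix z :: "complex ^ 'n"
    have w: "fock_weight l (R x z) = fock_weight l z" for x
      by (rule fock_weight_cong_norm) (simp add: R_def norm_smult_vec)
    have "(LINT x|U. h (R x z)) = (LINT x|U. f (R x z)) * of_real (fock_weight l z)"
      by (simp add: h_def w)
    also have "(LINT x|U. f (R x z)) = (LBINT x:{0..1}. f (R x z))"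
      unfolding U_def set_lebesgue_integral_def by (subst integral_restrict_space) auto
    also have "\<dots> = f 0"
      using holomorphic_circle_mean[OF holomorphic_cn_ray[OF f, of z]] by (simp add: R_def)
    finally show "(LINT x|U. h (R x z)) = f 0 * of_real (fock_weight l z)" .
  qed
  also have "\<dots> = f 0"
    using has_bochner_integral_fock_weight[OF l, where 'n = 'n] by (simp add: has_bochner_integral_iff)
  finally show ?thesis by (simp add: h_def)
qed


lemma fock_weight_shift:
  "complex_of_real (fock_weight l (v + z))
    = exp (- of_real l / 2 * (sp v (vcnj v) + sp (vcnj z) v + sp z (vcnj v) + sp z (vcnj z)))"
proof -
  have "complex_of_real (fock_weight l (v + z)) = exp (- of_real l / 2 * of_real ((norm (v + z))\<^sup>2))"
    by (simp add: fock_weight_def flip: exp_of_real)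
  also have "complex_of_real ((norm (v + z))\<^sup>2) = sp (v + z) (vcnj (v + z))"
    by (rule sp_vcnj_self(2)[symmetric])
  also have "\<dots> = sp v (vcnj v) + sp (vcnj z) v + sp z (vcnj v) + sp z (vcnj z)"
    by (simp add: vcnj_simps sp_simps sp_commute[of v "vcnj z"])
  finally show ?thesis .
qed

lemma fock_weight_exp: "complex_of_real (fock_weight l v) = exp (- of_real l / 2 * sp v (vcnj v))"
  using fock_weight_shift[of l v 0] by (simp add: sp_simps vcnj_simps)

text \<open>Translating the integrand by \<open>z\<close> turns it into a holomorphic function times the weight, so
  the mean value property applies at the origin.\<close>

lemma fock_reproducing:
  fixes f :: "complex ^ 'n::finite \<Rightarrow> complex"
  assumes l: "0 < l" and f: "holomorphic_cn f"
    and int: "integrable (fock_mu l) (\<lambda>w. exp (of_real l / 2 * sp z (vcnj w)) * f w * of_real (fock_weight l w))"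
  shows "(LINT w|fock_mu l. exp (of_real l / 2 * sp z (vcnj w)) * f w * of_real (fock_weight l w)) = f z"
proof -
  define F where "F = (\<lambda>w. exp (of_real l / 2 * sp z (vcnj w)) * f w * of_real (fock_weight l w))"
  \<comment> \<open>Of the exponent of the shifted weight, the terms |z|^2 and z^t vbar cancel
    against the reproducing kernel at v + z. The cross term left over, - l/2 zbar^t v, is
    holomorphic in v.\<close>
  define g where "g = (\<lambda>v. f (v + z) * exp (sp (- (of_real l / 2) *s vcnj z) v))"
  have Fm: "F \<in> borel_measurable borel"
    unfolding F_def by (intro borel_measurable_continuous_onI continuous_intros holomorphic_cn_continuous f)
  have g: "holomorphic_cn g"
    unfolding g_def using holomorphic_cn_compose_matrix[OF f, of "mat 1" z]
    by (intro holomorphic_cn_mult holomorphic_cn_exp holomorphic_cn_sp) (simp add: matrix_vector_mul_lid)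
  have eq: "F (v + z) = g v * of_real (fock_weight l v)" for v
    unfolding F_def g_def fock_weight_exp
    by (simp add: vcnj_simps sp_simps sp_commute[of v "vcnj z"] algebra_simps flip: exp_add)
  note tr = fock_mu_translate_integral[OF Fm, of l z, unfolded eq]
  have "(LINT w|fock_mu l. F w) = (LINT v|fock_mu l. g v * of_real (fock_weight l v))"
    by (rule tr(2)[symmetric])
  also have "\<dots> = g 0"
    using int tr(1) by (intro fock_mean_value[OF l g]) (simp add: F_def)
  also have "g 0 = f z"
    by (simp add: g_def sp_simps)
  finally show ?thesis by (simp add: F_def)
qed

section \<open>The symplectic group\<close>

lemma block_simps[simp]:
  "block_ul (block_mat A B C D) = A" "block_ur (block_mat A B C D) = B"
  "block_ll (block_mat A B C D) = C" "block_lr (block_mat A B C D) = D"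
  by (simp_all add: block_ul_def block_ur_def block_ll_def block_lr_def block_mat_def vec_eq_iff)

lemma block_mat_eq_iff:
  "block_mat A B C D = block_mat A' B' C' D' \<longleftrightarrow> A = A' \<and> B = B' \<and> C = C' \<and> D = D'"
  by (metis block_simps)

lemma sum_UNIV_Plus:
  "(\<Sum>i\<in>(UNIV :: ('a::finite + 'b::finite) set). f i) = (\<Sum>i\<in>UNIV. f (Inl i)) + (\<Sum>i\<in>UNIV. f (Inr i))"
  using sum.Plus[of "UNIV :: 'a set" "UNIV :: 'b set" f] by (simp add: comp_def)

lemma block_mat_mult:
  fixes A :: "complex ^ 'n::finite ^ 'n"
  shows "block_mat A B C D ** block_mat A' B' C' D' =
    block_mat (A ** A' + B ** C') (A ** B' + B ** D') (C ** A' + D ** C') (C ** B' + D ** D')"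
  by (auto simp: vec_eq_iff matrix_matrix_mult_def block_mat_def sum_UNIV_Plus split: sum.split)

lemma block_mat_one: "mat 1 = block_mat (mat 1) 0 0 (mat 1)"
  by (auto simp: vec_eq_iff mat_def block_mat_def split: sum.split)

lemma transpose_block_mat:
  "transpose (block_mat A B C D) = block_mat (transpose A) (transpose C) (transpose B) (transpose D)"
  by (auto simp: vec_eq_iff transpose_def block_mat_def split: sum.split)

abbreviation mcnj :: "complex ^ 'n ^ 'm \<Rightarrow> complex ^ 'n ^ 'm" where
  "mcnj \<equiv> map_matrix cnj"

lemma mcnj_simps:
  fixes A :: "complex ^ 'n::finite ^ 'n"
  shows "mcnj (A ** B) = mcnj A ** mcnj B" "mcnj (A + B) = mcnj A + mcnj B" "mcnj (- A) = - mcnj A"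
    "mcnj (mcnj A) = A" "mcnj (mat 1 :: complex ^ 'n ^ 'n) = mat 1" "mcnj (0 :: complex ^ 'n ^ 'n) = 0"
    "mcnj (transpose A) = transpose (mcnj A)"
  by (simp_all add: vec_eq_iff map_matrix_def matrix_matrix_mult_def mat_def transpose_def)

lemma matrix_mul_uminus:
  fixes A B :: "complex ^ 'n::finite ^ 'n"
  shows "A ** (- B) = - (A ** B)" "(- A) ** B = - (A ** B)"
  by (simp_all add: vec_eq_iff matrix_matrix_mult_def sum_negf)

lemma matrix_add_rdistrib:
  fixes A B C :: "complex ^ 'n::finite ^ 'n"
  shows "(B + C) ** A = B ** A + C ** A"
  by (simp add: vec_eq_iff matrix_matrix_mult_def algebra_simps sum.distrib)

lemma matrix_mul_diff:
  fixes A B C :: "complex ^ 'n::finite ^ 'n"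
  shows "A ** (B - C) = A ** B - A ** C" "(B - C) ** A = B ** A - C ** A"
  by (simp_all add: vec_eq_iff matrix_matrix_mult_def algebra_simps sum_subtractf)

lemma matrix_vec_minus:
  fixes A :: "complex ^ 'n::finite ^ 'n"
  shows "A *v (- x) = - (A *v x)" "(- A) *v x = - (A *v x)"
  by (simp_all add: vec_eq_iff matrix_vector_mult_def sum_negf)

text \<open>The four blocks of M^t J M = J. The last two relations are conjugates of the first two,
  stated separately to serve as rewrite rules.\<close>

lemma symp_SE:
  assumes "k \<in> symp_S"
  obtains P Q where "k = block_mat P Q (mcnj Q) (mcnj P)"
    "transpose P ** mcnj Q = transpose (mcnj Q) ** P"
    "transpose P ** mcnj P = mat 1 + transpose (mcnj Q) ** Q"
    "transpose (mcnj P) ** P = mat 1 + transpose Q ** mcnj Q"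
    "transpose (mcnj P) ** Q = transpose Q ** mcnj P"
proof -
  obtain P Q where k: "k = block_mat P Q (mcnj Q) (mcnj P)" and J: "transpose k ** symp_J ** k = symp_J"
    using assms by (auto simp: symp_S_def)
  show ?thesis
    using J unfolding k symp_J_def transpose_block_mat block_mat_mult block_mat_eq_iff
    by (intro that[OF k])
      (simp_all add: matrix_mul_uminus algebra_simps)
qed

lemma one_symp_S: "(mat 1 :: complex ^ ('n::finite + 'n) ^ ('n + 'n)) \<in> symp_S"
proof -
  have "\<exists>P Q. (mat 1 :: complex ^ ('n::finite + 'n) ^ ('n + 'n)) = block_mat P Q (mcnj Q) (mcnj P)"
    by (intro exI[of _ "mat 1"] exI[of _ 0]) (simp add: block_mat_one mcnj_simps)
  then show ?thesis
    by (simp add: symp_S_def transpose_mat)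
qed

lemma mult_symp_S:
  assumes "k \<in> symp_S" "k' \<in> symp_S"
  shows "k ** k' \<in> symp_S"
proof -
  obtain P Q P' Q' where "k = block_mat P Q (mcnj Q) (mcnj P)" "k' = block_mat P' Q' (mcnj Q') (mcnj P')"
    using assms by (auto simp: symp_S_def)
  then have "\<exists>P Q. k ** k' = block_mat P Q (mcnj Q) (mcnj P)"
    by (auto simp: block_mat_mult block_mat_eq_iff mcnj_simps)
  moreover have "transpose (k ** k') ** symp_J ** (k ** k') = transpose k' ** (transpose k ** symp_J ** k) ** k'"
    by (simp add: matrix_transpose_mul matrix_mul_assoc)
  ultimately show ?thesis
    using assms by (auto simp: symp_S_def)
qed

lemma inverse_symp_S:
  assumes "k \<in> symp_S"
  obtains k' where "k' \<in> symp_S" "k' ** k = mat 1" "k ** k' = mat 1"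
proof (rule symp_SE[OF assms])
  fix P Q assume k: "k = block_mat P Q (mcnj Q) (mcnj P)"
    and rel: "transpose P ** mcnj Q = transpose (mcnj Q) ** P"
    "transpose P ** mcnj P = mat 1 + transpose (mcnj Q) ** Q"
    "transpose (mcnj P) ** P = mat 1 + transpose Q ** mcnj Q"
    "transpose (mcnj P) ** Q = transpose Q ** mcnj P"
  \<comment> \<open>This is J^-1 k^t J, the usual inverse of a symplectic matrix, in block
    form.\<close>
  define k' where "k' = block_mat (transpose (mcnj P)) (- transpose Q) (- transpose (mcnj Q)) (transpose P)"
  have 1: "k' ** k = mat 1"
    unfolding k k'_def block_mat_mult block_mat_one block_mat_eq_iff
    by (simp add: matrix_mul_uminus rel)
  then have 2: "k ** k' = mat 1"
    by (simp add: matrix_left_right_inverse)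
  have "transpose k' ** symp_J ** k' = transpose k' ** (transpose k ** symp_J ** k) ** k'"
    using assms by (simp add: symp_S_def)
  also have "\<dots> = transpose (k ** k') ** symp_J ** (k ** k')"
    by (simp add: matrix_transpose_mul matrix_mul_assoc)
  also have "\<dots> = symp_J" by (simp add: 2 transpose_mat)
  finally have "k' \<in> symp_S"
    by (auto simp: symp_S_def k'_def block_mat_eq_iff mcnj_simps)
  then show thesis using 1 2 by (rule that)
qed

section \<open>The action on pairs of vectors and its invariant form\<close>

text \<open>The two components of k applied to a pair (x, y). The entries are independent variables:
  the Heisenberg slice y = \<open>vcnj x\<close> does not contain all the critical points met below.
  In \<open>act2\<close> the lower blocks are expressed through the upper ones, as membership in S
  allows.\<close>

definition act1 :: "complex ^ ('n::finite + 'n) ^ ('n + 'n) \<Rightarrow> complex ^ 'n \<Rightarrow> complex ^ 'n \<Rightarrow> complex ^ 'n" where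
  "act1 k x y = block_ul k *v x + block_ur k *v y"

definition act2 :: "complex ^ ('n::finite + 'n) ^ ('n + 'n) \<Rightarrow> complex ^ 'n \<Rightarrow> complex ^ 'n \<Rightarrow> complex ^ 'n" where
  "act2 k x y = mcnj (block_ur k) *v x + mcnj (block_ul k) *v y"

lemma act_mult:
  assumes "k \<in> symp_S" "k' \<in> symp_S"
  shows "act1 (k ** k') x y = act1 k (act1 k' x y) (act2 k' x y)"
    "act2 (k ** k') x y = act2 k (act1 k' x y) (act2 k' x y)"
  by (rule symp_SE[OF assms(1)], rule symp_SE[OF assms(2)],
      simp add: act1_def act2_def block_mat_mult mcnj_simps matrix_vector_mult_add_rdistrib
        matrix_vector_mul_assoc matrix_vector_right_distrib)+

lemma act_one: "act1 (mat 1) x y = x" "act2 (mat 1) x y = y"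
  by (simp_all add: act1_def act2_def block_mat_one mcnj_simps)

text \<open>The conjugate-linear involution (x, y) -> (ybar, xbar) commutes with k. Its fixed points
  are the pairs with y = \<open>vcnj x\<close>.\<close>

lemma vcnj_act:
  "vcnj (act1 k x y) = act2 k (vcnj y) (vcnj x)" "vcnj (act2 k x y) = act1 k (vcnj y) (vcnj x)"
  by (simp_all add: act1_def act2_def vcnj_simps vcnj_matrix mcnj_simps add.commute)

text \<open>The polarised form of M^t J M = J. Special choices of the four vectors give the norm
  identity, the symmetry of \<open>kerA\<close> and the gradient equation for z.\<close>

lemma act_form:
  assumes "k \<in> symp_S"
  shows "sp (act1 k x y) (act2 k x' y') - sp (act1 k x' y') (act2 k x y) = sp x y' - sp x' y"
proof (rule symp_SE[OF assms])
  fix P Q assume k: "k = block_mat P Q (mcnj Q) (mcnj P)"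
    and rel: "transpose P ** mcnj Q = transpose (mcnj Q) ** P"
    "transpose P ** mcnj P = mat 1 + transpose (mcnj Q) ** Q"
    "transpose (mcnj P) ** P = mat 1 + transpose Q ** mcnj Q"
    "transpose (mcnj P) ** Q = transpose Q ** mcnj P"
  have t: "sp (A *v x) (B *v y) = sp x ((transpose A ** B) *v y)" for A B :: "complex ^ 'a ^ 'a" and x y
    by (simp add: sp_matrix_left matrix_vector_mul_assoc)
  have t': "sp x ((transpose A ** B) *v y) = sp y ((transpose B ** A) *v x)" for A B :: "complex ^ 'a ^ 'a" and x y
    by (metis t sp_commute)
  have a: "sp x ((transpose P ** mcnj Q) *v x') = sp x' ((transpose P ** mcnj Q) *v x)"
    by (subst t') (simp add: rel)
  have b: "sp y ((transpose Q ** mcnj P) *v y') = sp y' ((transpose Q ** mcnj P) *v y)"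
    by (subst t') (simp add: rel)
  have c: "sp x ((transpose P ** mcnj P) *v y') = sp x y' + sp y' ((transpose Q ** mcnj Q) *v x)" for x y'
    unfolding rel(2) by (subst t') (simp add: matrix_vector_mult_add_rdistrib sp_simps)
  show ?thesis
    unfolding act1_def act2_def k
    by (simp add: sp_simps t a b c)
qed

text \<open>The invariant form evaluated on (x, 0) and (0, xbar). It yields both the injectivity of
  P and the strict contraction property of \<open>kerA\<close>.\<close>

lemma norm_block_ul:
  assumes "k \<in> symp_S"
  shows "(norm (block_ul k *v x))\<^sup>2 = (norm x)\<^sup>2 + (norm (mcnj (block_ur k) *v x))\<^sup>2"
proof -
  have "complex_of_real ((norm (block_ul k *v x))\<^sup>2 - (norm (mcnj (block_ur k) *v x))\<^sup>2) = of_real ((norm x)\<^sup>2)"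
    using act_form[OF assms, of x 0 0 "vcnj x"]
      sp_vcnj_self[of "block_ul k *v x"] sp_vcnj_self[of "mcnj (block_ur k) *v x"] sp_vcnj_self[of x]
    by (simp add: act1_def act2_def vcnj_matrix mcnj_simps sp_simps)
  then show ?thesis
    by (simp only: of_real_eq_iff)
qed

lemma invertible_block_ul:
  assumes "k \<in> symp_S"
  shows "invertible (block_ul k)"
proof -
  have "inj ((*v) (block_ul k))"
  proof (rule injI)
    fix x y assume "block_ul k *v x = block_ul k *v y"
    then have "block_ul k *v (x - y) = 0" by (simp add: matrix_vector_mult_diff_distrib)
    then have "(norm (x - y))\<^sup>2 \<le> 0"
      using norm_block_ul[OF assms, of "x - y"] by simp
    then show "x = y" by simp
  qed
  then show ?thesis
    by (simp add: matrix_left_invertible_injective[symmetric] invertible_left_inverse)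
qed

lemma invertible_matrix_inv:
  fixes A :: "complex ^ 'n::finite ^ 'n"
  assumes "invertible A"
  shows "A ** matrix_inv A = mat 1" "matrix_inv A ** A = mat 1"
    "A *v (matrix_inv A *v x) = x" "matrix_inv A *v (A *v x) = x"
proof -
  show "A ** matrix_inv A = mat 1" "matrix_inv A ** A = mat 1"
    using assms someI_ex[of "\<lambda>B. A ** B = mat 1 \<and> B ** A = mat 1"]
    unfolding invertible_def matrix_inv_def by auto
  then show "A *v (matrix_inv A *v x) = x" "matrix_inv A *v (A *v x) = x"
    by (simp_all add: matrix_vector_mul_assoc)
qed

text \<open>With \<open>(z, \<zeta>) = k (w, \<omega>)\<close> and \<open>z, \<omega>\<close> as independent variables,
  \<open>gauss_exp l k z \<omega>\<close> is the generating function of \<open>k\<close>: it equals \<open>l/4 (z\<^sup>t\<zeta> + \<omega>\<^sup>tw)\<close>, and its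
  gradient is \<open>l/2 (\<zeta>, w)\<close>. The kernel has \<open>\<omega>\<close> equal to the conjugate of its second argument.\<close>

definition kerA :: "complex ^ ('n::finite + 'n) ^ ('n + 'n) \<Rightarrow> complex ^ 'n ^ 'n" where
  "kerA k = mcnj (block_ur k) ** matrix_inv (block_ul k)"

definition kerB :: "complex ^ ('n::finite + 'n) ^ ('n + 'n) \<Rightarrow> complex ^ 'n ^ 'n" where
  "kerB k = - (matrix_inv (block_ul k) ** block_ur k)"

definition gauss_exp :: "real \<Rightarrow> complex ^ ('n::finite + 'n) ^ ('n + 'n) \<Rightarrow> complex ^ 'n \<Rightarrow> complex ^ 'n \<Rightarrow> complex" where
  "gauss_exp l k z \<omega> = of_real l / 4 * (sp z (kerA k *v z) + 2 * sp (matrix_inv (block_ul k) *v z) \<omega>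
     + sp \<omega> (kerB k *v \<omega>))"

lemma gauss_kernel_exp: "gauss_kernel l k z w = exp (gauss_exp l k z (vcnj w))"
  by (simp add: gauss_kernel_def gauss_exp_def kerA_def kerB_def Let_def matrix_vec_minus sp_simps
      algebra_simps)

lemma kerA_act:
  assumes "k \<in> symp_S"
  shows "kerA k *v (block_ul k *v x) = mcnj (block_ur k) *v x"
    "kerA k *v v = mcnj (block_ur k) *v (matrix_inv (block_ul k) *v v)"
  using invertible_matrix_inv[OF invertible_block_ul[OF assms]]
  by (simp_all add: kerA_def flip: matrix_vector_mul_assoc)

text \<open>k maps the isotropic subspace y = 0 onto the graph of \<open>kerA k\<close>, which is
  therefore isotropic as well.\<close>

lemma kerA_symmetric:
  assumes "k \<in> symp_S"
  shows "sp x (kerA k *v y) = sp y (kerA k *v x)"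
  using act_form[OF assms, of "matrix_inv (block_ul k) *v x" 0 "matrix_inv (block_ul k) *v y" 0]
    invertible_matrix_inv[OF invertible_block_ul[OF assms]]
  by (simp add: act1_def act2_def kerA_act[OF assms] sp_simps)

text \<open>The gradient equation in z, paired with a test vector v: the invariant form is evaluated
  on (P^-1 v, 0), whose image is (v, \<open>kerA k\<close> v), and on (x, \<omega>).\<close>

lemma kerA_generating:
  assumes "k \<in> symp_S"
  shows "sp v (kerA k *v act1 k x \<omega>) + sp (matrix_inv (block_ul k) *v v) \<omega> = sp v (act2 k x \<omega>)"
  using act_form[OF assms, of "matrix_inv (block_ul k) *v v" 0 x \<omega>]
    invertible_matrix_inv[OF invertible_block_ul[OF assms]]
    kerA_symmetric[OF assms, of v "act1 k x \<omega>"]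
  by (simp add: act1_def[of k _ 0] act2_def[of k _ 0] kerA_act[OF assms] sp_simps algebra_simps)

text \<open>The gradient equation in \<omega>: it solves z = P x + Q \<omega> for x.\<close>

lemma kerB_generating:
  assumes "k \<in> symp_S"
  shows "matrix_inv (block_ul k) *v act1 k x \<omega> + kerB k *v \<omega> = x"
  using invertible_matrix_inv[OF invertible_block_ul[OF assms]]
  by (simp add: act1_def kerB_def matrix_vector_right_distrib matrix_vec_minus
      flip: matrix_vector_mul_assoc)

text \<open>Euler's identity: a quadratic form is half the pairing of its variables with its
  gradient.\<close>

lemma gauss_exp_act:
  assumes "k \<in> symp_S"
  shows "gauss_exp l k (act1 k x \<omega>) \<omega> = of_real l / 4 * (sp (act1 k x \<omega>) (act2 k x \<omega>) + sp \<omega> x)"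
proof -
  have e1: "sp (matrix_inv (block_ul k) *v act1 k x \<omega>) \<omega> + sp \<omega> (kerB k *v \<omega>) = sp \<omega> x"
    using arg_cong[OF kerB_generating[OF assms, of x \<omega>], of "sp \<omega>"]
    by (simp add: sp_simps sp_commute[of _ \<omega>])
  note e2 = kerA_generating[OF assms, of "act1 k x \<omega>" x \<omega>]
  show ?thesis
    unfolding gauss_exp_def e1[symmetric] e2[symmetric] by (simp add: algebra_simps)
qed

text \<open>With v = P x, the norm identity reads |\<open>kerA k\<close> v|^2 = |v|^2 - |x|^2, and
  |x| is at least |v| divided by a bound for P.\<close>

lemma kerA_contraction:
  assumes "k \<in> symp_S"
  obtains r where "0 \<le> r" "r < 1" "\<And>x. norm (kerA k *v x) \<le> r * norm x"
proof -
  let ?P = "block_ul k"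
  note inv = invertible_matrix_inv[OF invertible_block_ul[OF assms]]
  obtain K where K: "K > 0" "\<And>x. norm (?P *v x) \<le> K * norm x"
    using norm_matrix_le[of ?P] by auto
  \<comment> \<open>Taking the maximum with 1 keeps the radicand of r nonnegative.\<close>
  define K' where "K' = max K 1"
  define r where "r = sqrt (1 - 1 / K'\<^sup>2)"
  have K': "K' \<ge> 1" "\<And>x. norm (?P *v x) \<le> K' * norm x"
    by (auto simp: K'_def intro!: order_trans[OF K(2)] mult_right_mono)
  have K2: "1 / K'\<^sup>2 > 0" "1 / K'\<^sup>2 \<le> 1" using K'(1) by (auto simp: field_simps)
  have "norm (kerA k *v v) \<le> r * norm v" for v
  proof -
    define x where "x = matrix_inv ?P *v v"
    have v: "v = ?P *v x" by (simp add: x_def inv)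
    have "(norm v)\<^sup>2 \<le> K'\<^sup>2 * (norm x)\<^sup>2"
      unfolding v power_mult_distrib[symmetric] by (intro power_mono K') auto
    then have "1 / K'\<^sup>2 * (norm v)\<^sup>2 \<le> (norm x)\<^sup>2"
      using K'(1) by (simp add: field_simps)
    then have "(norm (kerA k *v v))\<^sup>2 \<le> (1 - 1 / K'\<^sup>2) * (norm v)\<^sup>2"
      using norm_block_ul[OF assms, of x] kerA_act(1)[OF assms, of x]
      by (simp add: v[symmetric] algebra_simps add_divide_distrib)
    then have "norm (kerA k *v v) \<le> sqrt ((1 - 1 / K'\<^sup>2) * (norm v)\<^sup>2)"
      by (rule real_le_rsqrt)
    then show ?thesis by (simp add: r_def real_sqrt_mult)
  qed
  moreover have "0 \<le> r" "r < 1" using K2 by (auto simp: r_def)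
  ultimately show thesis by (rule that[rotated 2])
qed

text \<open>Apply k k' = 1 to (0, y): the first component gives P Q' y = - Q Pbar' y. Through this
  identity the contraction bound and the symmetry of \<open>kerB\<close> are inherited from
  \<open>kerA\<close> of the inverse.\<close>

lemma kerB_conv_kerA:
  assumes k: "k \<in> symp_S" and k': "k' \<in> symp_S" and inv: "k ** k' = mat 1"
  shows "kerB k *v x = vcnj (kerA k' *v vcnj x)"
proof -
  note P = invertible_matrix_inv[OF invertible_block_ul[OF k]]
  note P' = invertible_matrix_inv[OF invertible_block_ul[OF k']]
  define y where "y = vcnj (matrix_inv (block_ul k') *v vcnj x)"
  have x: "x = mcnj (block_ul k') *v y"
  proof -
    have "vcnj x = block_ul k' *v vcnj y" by (simp add: y_def vcnj_simps P')
    then have "vcnj (vcnj x) = vcnj (block_ul k' *v vcnj y)" by simp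
    then show ?thesis by (simp add: vcnj_simps vcnj_matrix)
  qed
  have "act1 k (act1 k' 0 y) (act2 k' 0 y) = 0"
    using act_mult(1)[OF k k', of 0 y] by (simp add: inv act_one)
  then have "block_ul k *v (block_ur k' *v y) + block_ur k *v x = 0"
    by (simp add: act1_def act2_def x)
  then have "block_ul k *v (block_ur k' *v y) = - (block_ur k *v x)"
    by (simp add: eq_neg_iff_add_eq_0)
  then have "matrix_inv (block_ul k) *v (block_ul k *v (block_ur k' *v y)) = kerB k *v x"
    by (simp add: kerB_def matrix_vec_minus flip: matrix_vector_mul_assoc)
  then have "kerB k *v x = block_ur k' *v y" by (simp add: P)
  also have "\<dots> = vcnj (kerA k' *v vcnj x)"
    by (simp add: kerA_act[OF k'] vcnj_matrix mcnj_simps y_def)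
  finally show ?thesis .
qed

lemma kerB_contraction:
  assumes "k \<in> symp_S"
  obtains r where "0 \<le> r" "r < 1" "\<And>x. norm (kerB k *v x) \<le> r * norm x"
proof -
  obtain k' where k': "k' \<in> symp_S" "k ** k' = mat 1" using inverse_symp_S[OF assms] by metis
  obtain r where "0 \<le> r" "r < 1" "\<And>x. norm (kerA k' *v x) \<le> r * norm x"
    using kerA_contraction[OF k'(1)] by metis
  then show thesis
    by (intro that[of r]) (simp_all add: kerB_conv_kerA[OF assms k'] norm_vcnj, metis norm_vcnj)
qed

lemma kerB_symmetric:
  assumes "k \<in> symp_S"
  shows "sp x (kerB k *v y) = sp y (kerB k *v x)"
proof -
  obtain k' where k': "k' \<in> symp_S" "k ** k' = mat 1" using inverse_symp_S[OF assms] by metis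
  have "sp x (kerB k *v y) = cnj (sp (vcnj x) (kerA k' *v vcnj y))" for x y
    by (simp add: kerB_conv_kerA[OF assms k'] cnj_sp vcnj_simps)
  then show ?thesis by (simp add: kerA_symmetric[OF k'(1), of "vcnj x"])
qed

text \<open>Writing \<open>\<star>\<close> for conjugation, \<open>(w, \<zeta>) = k (x, z\<^sup>\<star>)\<close> implies
  \<open>(\<zeta>\<^sup>\<star>, w\<^sup>\<star>) = k (z, x\<^sup>\<star>)\<close>, so the conjugate transpose of the kernel has the generating function of
  the inverse.\<close>

lemma gauss_kernel_inverse:
  assumes k: "k \<in> symp_S" and k': "k' \<in> symp_S" and inv: "k' ** k = mat 1"
  shows "cnj (gauss_kernel l k w z) = gauss_kernel l k' z w"
proof -
  note P = invertible_matrix_inv[OF invertible_block_ul[OF k]]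
  define x where "x = matrix_inv (block_ul k) *v (w - block_ur k *v vcnj z)"
  have w: "w = act1 k x (vcnj z)"
    by (simp add: x_def act1_def P)
  define \<zeta> where "\<zeta> = vcnj (act2 k x (vcnj z))"
  have \<zeta>: "\<zeta> = act1 k z (vcnj x)" "vcnj w = act2 k z (vcnj x)"
    by (simp_all add: \<zeta>_def w vcnj_act vcnj_simps)
  then have z: "act1 k' \<zeta> (vcnj w) = z" "act2 k' \<zeta> (vcnj w) = vcnj x"
    using act_mult[OF k' k, of z "vcnj x"] by (simp_all add: inv act_one)
  have "gauss_exp l k w (vcnj z) = of_real l / 4 * (sp w (act2 k x (vcnj z)) + sp (vcnj z) x)"
    using gauss_exp_act[OF k, of l x "vcnj z"] by (simp only: w[symmetric])
  then have "cnj (gauss_exp l k w (vcnj z)) = of_real l / 4 * (sp (vcnj w) \<zeta> + sp z (vcnj x))"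
    by (simp only: complex_cnj_mult complex_cnj_add complex_cnj_divide complex_cnj_complex_of_real
        complex_cnj_numeral cnj_sp vcnj_simps \<zeta>_def)
  also have "\<dots> = gauss_exp l k' z (vcnj w)"
    using gauss_exp_act[OF k', of l \<zeta> "vcnj w"] by (simp add: z add.commute sp_commute)
  finally show ?thesis
    by (simp add: gauss_kernel_exp exp_cnj)
qed

section \<open>Concentration of the kernel around the graph of k\<close>

text \<open>The exact Taylor expansion in z about \<open>act1 k x \<omega>\<close>: the value is
  \<open>gauss_exp_act\<close>, the gradient l/2 times \<open>act2 k x \<omega>\<close>, the Hessian
  l/2 times \<open>kerA k\<close>.\<close>

lemma gauss_exp_shift:
  assumes "k \<in> symp_S"
  shows "gauss_exp l k (act1 k x \<omega> + v) \<omega> = of_real l / 4 * (sp (act1 k x \<omega>) (act2 k x \<omega>) + sp \<omega> x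
     + 2 * sp v (act2 k x \<omega>) + sp v (kerA k *v v))"
  using gauss_exp_act[OF assms, of l x \<omega>] kerA_generating[OF assms, of v x \<omega>, symmetric]
    kerA_symmetric[OF assms, of "act1 k x \<omega>" v]
  by (simp add: gauss_exp_def sp_simps matrix_vector_right_distrib algebra_simps)

text \<open>Expand about y = \<open>act1 k w (vcnj w)\<close>, where \<open>act2\<close> takes the
  conjugate value. The real part of the constant and linear terms is l/4 (|y|^2 + |w|^2 + 2 Re v^t
  ybar), which the half-weights cancel up to - l/4 |v|^2.\<close>

lemma norm_gauss_kernel:
  assumes "k \<in> symp_S"
  shows "cmod (gauss_kernel l k z w) * fock_weight (l / 2) z * fock_weight (l / 2) w
    = exp (l / 4 * (Re (sp (z - act1 k w (vcnj w)) (kerA k *v (z - act1 k w (vcnj w))))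
        - (norm (z - act1 k w (vcnj w)))\<^sup>2))"
proof -
  define y where "y = act1 k w (vcnj w)"
  define v where "v = z - y"
  have z: "z = y + v" by (simp add: v_def)
  have y2: "act2 k w (vcnj w) = vcnj y" by (simp add: y_def vcnj_act vcnj_simps)
  have e: "gauss_exp l k z (vcnj w) = of_real l / 4 * (sp y (vcnj y) + sp (vcnj w) w
     + 2 * sp v (vcnj y) + sp v (kerA k *v v))"
    unfolding z y_def by (simp add: gauss_exp_shift[OF assms] vcnj_act vcnj_simps)
  have n: "complex_of_real ((norm z)\<^sup>2) = sp y (vcnj y) + sp v (vcnj v) + sp y (vcnj v) + sp v (vcnj y)"
    unfolding sp_vcnj_self(2)[symmetric] by (simp add: z vcnj_simps sp_simps)
  have c: "Re (sp y (vcnj v)) = Re (sp v (vcnj y))"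
  proof -
    have "cnj (sp v (vcnj y)) = sp y (vcnj v)"
      by (simp add: cnj_sp vcnj_simps sp_commute)
    then have "Re (cnj (sp v (vcnj y))) = Re (sp y (vcnj v))" by simp
    then show ?thesis by simp
  qed
  have "(norm z)\<^sup>2 = (norm y)\<^sup>2 + (norm v)\<^sup>2 + 2 * Re (sp v (vcnj y))"
    using arg_cong[OF n, of Re] c by (simp add: sp_vcnj_self)
  then have "Re (gauss_exp l k z (vcnj w)) - l / 4 * (norm z)\<^sup>2 - l / 4 * (norm w)\<^sup>2
    = l / 4 * (Re (sp v (kerA k *v v)) - (norm v)\<^sup>2)"
    by (simp add: e sp_vcnj_self algebra_simps)
  then show ?thesis
    unfolding gauss_kernel_exp norm_exp_eq_Re fock_weight_def v_def[symmetric] y_def[symmetric]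
    by (simp flip: exp_add)
qed

lemma gauss_kernel_bound_left:
  assumes "0 < l" "k \<in> symp_S"
  obtains d where "d > 0"
    "\<And>z w. cmod (gauss_kernel l k z w) * fock_weight (l / 2) z * fock_weight (l / 2) w
      \<le> exp (- d * (norm (z - act1 k w (vcnj w)))\<^sup>2)"
proof -
  obtain r where r: "0 \<le> r" "r < 1" "\<And>x. norm (kerA k *v x) \<le> r * norm x"
    using kerA_contraction[OF assms(2)] by metis
  have "Re (sp v (kerA k *v v)) \<le> r * (norm v)\<^sup>2" for v
  proof -
    have "Re (sp v (kerA k *v v)) \<le> norm v * norm (kerA k *v v)"
      by (rule order_trans[OF complex_Re_le_cmod norm_sp_le])
    also have "\<dots> \<le> norm v * (r * norm v)" by (intro mult_left_mono r) auto
    finally show ?thesis by (simp add: power2_eq_square mult_ac)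
  qed
  then have "l / 4 * (Re (sp v (kerA k *v v)) - (norm v)\<^sup>2) \<le> l / 4 * (r * (norm v)\<^sup>2 - (norm v)\<^sup>2)" for v
    using assms(1) by (intro mult_left_mono) auto
  note mono = this
  show thesis
  proof (rule that[of "l / 4 * (1 - r)"])
    show "cmod (gauss_kernel l k z w) * fock_weight (l / 2) z * fock_weight (l / 2) w
      \<le> exp (- (l / 4 * (1 - r)) * (norm (z - act1 k w (vcnj w)))\<^sup>2)" for z w
    proof -
      have "- (l / 4 * (1 - r)) * n = l / 4 * (r * n - n)" for n by (simp add: field_simps)
      then show ?thesis
        unfolding norm_gauss_kernel[OF assms(2)] using mono[of "z - act1 k w (vcnj w)"] by simp
    qed
  qed (use assms r in auto)
qed

text \<open>The same decay with the centre in the second variable: the modulus of the kernel equals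
  that of the inverse element with its arguments exchanged.\<close>

lemma gauss_kernel_bound_right:
  assumes "0 < l" "k \<in> symp_S" "k' \<in> symp_S" "k ** k' = mat 1"
  obtains d where "d > 0"
    "\<And>z w. cmod (gauss_kernel l k z w) * fock_weight (l / 2) z * fock_weight (l / 2) w
      \<le> exp (- d * (norm (w - act1 k' z (vcnj z)))\<^sup>2)"
proof -
  have "cmod (gauss_kernel l k z w) = cmod (gauss_kernel l k' w z)" for z w
    using arg_cong[OF gauss_kernel_inverse[OF assms(3,2,4), of l w z], of cmod] by simp
  moreover obtain d where d: "d > 0"
    "\<And>z w. cmod (gauss_kernel l k' z w) * fock_weight (l / 2) z * fock_weight (l / 2) w
      \<le> exp (- d * (norm (z - act1 k' w (vcnj w)))\<^sup>2)"
    using gauss_kernel_bound_left[OF assms(1,3)] by blast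
  ultimately have "cmod (gauss_kernel l k z w) * fock_weight (l / 2) z * fock_weight (l / 2) w
      \<le> exp (- d * (norm (w - act1 k' z (vcnj z)))\<^sup>2)" for z w
    using d(2)[of w z] by (simp only: mult_ac)
  then show thesis by (rule that[OF d(1)])
qed

section \<open>Differentiation under the integral sign\<close>

lemma has_vector_derivative_iff_tendsto:
  fixes f :: "real \<Rightarrow> 'b::real_normed_vector"
  shows "(f has_vector_derivative D) (at t within S) \<longleftrightarrow>
    ((\<lambda>y. (f y - f t - (y - t) *\<^sub>R D) /\<^sub>R (y - t)) \<longlongrightarrow> 0) (at t within S)"
proof -
  have "((\<lambda>y. (f y - f t - (y - t) *\<^sub>R D) /\<^sub>R \<bar>y - t\<bar>) \<longlongrightarrow> 0) (at t within S) \<longleftrightarrow>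
    ((\<lambda>y. (f y - f t - (y - t) *\<^sub>R D) /\<^sub>R (y - t)) \<longlongrightarrow> 0) (at t within S)"
    by (subst (1 2) tendsto_norm_zero_iff[symmetric]) simp
  then show ?thesis
    by (simp add: has_vector_derivative_def has_derivative_within bounded_linear_scaleR_left
        diff_diff_eq inverse_eq_divide)
qed

text \<open>By the mean value inequality the remainder quotient q is dominated by 2 g, so dominated
  convergence applies. Derivatives are taken within the closed interval, hence one-sided at its
  ends.\<close>

lemma has_vector_derivative_integral_param:
  fixes F :: "real \<Rightarrow> 'a \<Rightarrow> complex"
  assumes int: "\<And>t. t \<in> {a..b} \<Longrightarrow> integrable M (F t)"
    and der: "\<And>t x. t \<in> {a..b} \<Longrightarrow> ((\<lambda>t. F t x) has_vector_derivative F' t x) (at t within {a..b})"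
    and bnd: "\<And>t x. t \<in> {a..b} \<Longrightarrow> norm (F' t x) \<le> g x"
    and g: "integrable M g"
    and meas: "\<And>t. t \<in> {a..b} \<Longrightarrow> F' t \<in> borel_measurable M"
    and t: "t \<in> {a..b}"
  shows "((\<lambda>t. LINT x|M. F t x) has_vector_derivative (LINT x|M. F' t x)) (at t within {a..b})"
proof -
  have int': "integrable M (F' t)"
    by (rule Bochner_Integration.integrable_bound[OF g])
      (use meas[OF t] bnd[OF t] in \<open>auto intro: order_trans[OF _ abs_ge_self]\<close>)
  define q where "q = (\<lambda>y x. (F y x - F t x - (y - t) *\<^sub>R F' t x) /\<^sub>R (y - t))"
  have qle: "norm (q y x) \<le> 2 * g x" if y: "y \<in> {a..b}" "y \<noteq> t" for y x
  proof -
    have "norm (F y x - F t x) \<le> g x * norm (y - t)"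
    proof (rule differentiable_bound[where S = "{a..b}" and f' = "\<lambda>t h. h *\<^sub>R F' t x"])
      fix s assume s: "s \<in> {a..b}"
      show "((\<lambda>t. F t x) has_derivative (\<lambda>h. h *\<^sub>R F' s x)) (at s within {a..b})"
        using der[OF s] by (simp add: has_vector_derivative_def)
      show "onorm (\<lambda>h. h *\<^sub>R F' s x) \<le> g x"
        by (rule onorm_le) (use mult_left_mono[OF bnd[OF s, of x] abs_ge_zero] in \<open>simp add: mult.commute\<close>)
    qed (use y t in auto)
    moreover have "norm ((y - t) *\<^sub>R F' t x) \<le> g x * norm (y - t)"
      using mult_left_mono[OF bnd[OF t, of x] abs_ge_zero[of "y - t"]] by (simp add: mult.commute)
    ultimately have "norm (F y x - F t x - (y - t) *\<^sub>R F' t x) \<le> 2 * g x * norm (y - t)"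
      using norm_triangle_ineq4[of "F y x - F t x" "(y - t) *\<^sub>R F' t x"] by simp
    moreover have "norm (q y x) = norm (F y x - F t x - (y - t) *\<^sub>R F' t x) / \<bar>y - t\<bar>"
      by (simp add: q_def divide_inverse mult.commute)
    ultimately show ?thesis using y by (simp add: pos_divide_le_eq)
  qed
  have "((\<lambda>y. LINT x|M. q y x) \<longlongrightarrow> 0) (at t within {a..b})"
    unfolding tendsto_at_iff_sequentially
  proof (intro allI impI)
    fix X assume X: "\<forall>i. X i \<in> {a..b} - {t}" "X \<longlonglongrightarrow> t"
    have "(\<lambda>i. LINT x|M. q (X i) x) \<longlonglongrightarrow> (LINT x|M. 0)"
    proof (rule integral_dominated_convergence[where w = "\<lambda>x. 2 * g x"])
      show "q (X i) \<in> borel_measurable M" for i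
        using int[of "X i"] X(1) int[OF t] meas[OF t] unfolding q_def
        by (intro borel_measurable_scaleR borel_measurable_diff borel_measurable_const) auto
      show "AE x in M. (\<lambda>i. q (X i) x) \<longlonglongrightarrow> 0"
      proof (rule AE_I2)
        fix x
        have "((\<lambda>y. q y x) \<longlongrightarrow> 0) (at t within {a..b})"
          using der[OF t, of x] by (simp add: has_vector_derivative_iff_tendsto q_def)
        then show "(\<lambda>i. q (X i) x) \<longlonglongrightarrow> 0"
          unfolding tendsto_at_iff_sequentially comp_def using X by blast
      qed
      show "AE x in M. norm (q (X i) x) \<le> 2 * g x" for i
        using qle X(1) by auto
    qed (use g in auto)
    then show "((\<lambda>y. LINT x|M. q y x) \<circ> X) \<longlonglongrightarrow> 0" by (simp add: comp_def)
  qed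
  moreover have "\<forall>\<^sub>F y in at t within {a..b}. (LINT x|M. q y x) =
      ((LINT x|M. F y x) - (LINT x|M. F t x) - (y - t) *\<^sub>R (LINT x|M. F' t x)) /\<^sub>R (y - t)"
    unfolding eventually_at_filter
    by (rule always_eventually) (use int[OF t] int int' in \<open>auto simp: q_def\<close>)
  ultimately show ?thesis
    unfolding has_vector_derivative_iff_tendsto by (rule Lim_transform_eventually)
qed

text \<open>A remainder that is quadratic in h with an integrable coefficient can be integrated
  directly. This gives a derivative in all directions at once, as \<open>holomorphic_cn\<close>
  demands.\<close>

lemma has_derivative_integral_quadratic:
  fixes F :: "'b::real_normed_vector \<Rightarrow> 'a \<Rightarrow> complex"
  assumes int: "\<And>y. integrable M (F y)" and intD: "\<And>h. integrable M (\<lambda>x. D x h)"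
    and lin: "\<And>x. linear (D x)" and bD: "\<And>x h. norm (D x h) \<le> g x * norm h"
    and g: "integrable M g"
    and rem: "\<And>h x. norm h \<le> 1 \<Longrightarrow> norm (F (y + h) x - F y x - D x h) \<le> g x * (norm h)\<^sup>2"
  shows "((\<lambda>y. LINT x|M. F y x) has_derivative (\<lambda>h. LINT x|M. D x h)) (at y)"
proof -
  define G where "G = (LINT x|M. g x)"
  have bl: "bounded_linear (\<lambda>h. LINT x|M. D x h)"
  proof (rule bounded_linear_intro[where K = G])
    show "(LINT x|M. D x (h + k)) = (LINT x|M. D x h) + (LINT x|M. D x k)" for h k
      by (simp add: linear_add[OF lin] intD)
    show "(LINT x|M. D x (r *\<^sub>R h)) = r *\<^sub>R (LINT x|M. D x h)" for r h
      by (simp add: linear_cmul[OF lin])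
    show "norm (LINT x|M. D x h) \<le> norm h * G" for h
    proof -
      have "norm (LINT x|M. D x h) \<le> (LINT x|M. norm (D x h))" by (rule integral_norm_bound)
      also have "\<dots> \<le> (LINT x|M. g x * norm h)"
        by (rule integral_mono) (use intD g bD in auto)
      finally show ?thesis by (simp add: G_def mult.commute)
    qed
  qed
  have r: "norm ((LINT x|M. F (y + h) x) - (LINT x|M. F y x) - (LINT x|M. D x h)) / norm h \<le> G * norm h"
    if h: "norm h \<le> 1" for h
  proof -
    have "norm ((LINT x|M. F (y + h) x) - (LINT x|M. F y x) - (LINT x|M. D x h))
        = norm (LINT x|M. F (y + h) x - F y x - D x h)"
      by (simp add: int intD)
    also have "\<dots> \<le> (LINT x|M. norm (F (y + h) x - F y x - D x h))" by (rule integral_norm_bound)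
    also have "\<dots> \<le> (LINT x|M. g x * (norm h)\<^sup>2)"
      by (rule integral_mono) (use int intD g rem[OF h] in auto)
    finally show ?thesis
      by (cases "h = 0") (auto simp: G_def field_simps power2_eq_square)
  qed
  have "((\<lambda>h. norm ((LINT x|M. F (y + h) x) - (LINT x|M. F y x) - (LINT x|M. D x h)) / norm h) \<longlongrightarrow> 0) (at 0)"
  proof (rule tendsto_sandwich[where f = "\<lambda>_. 0" and h = "\<lambda>h. G * norm h"])
    show "\<forall>\<^sub>F h in at 0. norm ((LINT x|M. F (y + h) x) - (LINT x|M. F y x) - (LINT x|M. D x h)) / norm h \<le> G * norm h"
      unfolding eventually_at by (intro exI[of _ 1]) (auto intro!: r)
    show "((\<lambda>h. G * norm h) \<longlongrightarrow> 0) (at (0::'b))"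
      by (rule tendsto_eq_intros | simp)+
  qed auto
  then show ?thesis
    using bl by (simp add: has_derivative_at)
qed

section \<open>Functions with Gaussian decay\<close>

text \<open>The factors and integrands that occur under Gaussian integrals. The summand 1 beside
  \<open>norm u\<close> absorbs multiplicative constants, so that one parameter bounds a function
  and products simply add the parameters.\<close>

definition subexp :: "(complex ^ 'n::finite \<Rightarrow> complex) \<Rightarrow> bool" where
  "subexp f \<longleftrightarrow> continuous_on UNIV f \<and> (\<exists>c. \<forall>u. cmod (f u) \<le> exp (c * (1 + norm u)))"

definition gauss_decay :: "(complex ^ 'n::finite \<Rightarrow> complex) \<Rightarrow> bool" where
  "gauss_decay f \<longleftrightarrow> continuous_on UNIV f \<and>
     (\<exists>c d. d > 0 \<and> (\<forall>u. cmod (f u) \<le> exp (c * (1 + norm u) - d * (norm u)\<^sup>2)))"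

lemma subexp_const: "subexp (\<lambda>u. c)"
  unfolding subexp_def
proof (intro conjI exI allI)
  fix u :: "complex ^ 'n"
  have "cmod c \<le> exp (cmod c)" using exp_ge_add_one_self[of "cmod c"] by linarith
  also have "\<dots> \<le> exp (cmod c * (1 + norm u))" by (simp add: mult_le_cancel_left1)
  finally show "cmod c \<le> exp (cmod c * (1 + norm u))" .
qed simp

lemma subexp_linear:
  assumes "continuous_on UNIV f" "\<And>u. cmod (f u) \<le> c * norm u"
  shows "subexp f"
  unfolding subexp_def
proof (intro conjI exI allI)
  fix u
  have "cmod (f u) \<le> \<bar>c\<bar> * norm u" using assms(2)[of u] by (smt (verit) mult_right_mono norm_ge_zero)
  also have "\<dots> \<le> \<bar>c\<bar> * (1 + norm u)" by (simp add: algebra_simps)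
  also have "\<dots> \<le> exp (\<bar>c\<bar> * (1 + norm u))"
    using exp_ge_add_one_self[of "\<bar>c\<bar> * (1 + norm u)"] by linarith
  finally show "cmod (f u) \<le> exp (\<bar>c\<bar> * (1 + norm u))" .
qed (rule assms)

lemma subexp_add:
  assumes "subexp f" "subexp g"
  shows "subexp (\<lambda>u. f u + g u)"
proof -
  obtain c d where c: "\<And>u. cmod (f u) \<le> exp (c * (1 + norm u))" and d: "\<And>u. cmod (g u) \<le> exp (d * (1 + norm u))"
    using assms unfolding subexp_def by metis
  have "cmod (f u + g u) \<le> exp ((max c d + 1) * (1 + norm u))" for u
  proof -
    have "cmod (f u + g u) \<le> exp (c * (1 + norm u)) + exp (d * (1 + norm u))"
      using norm_triangle_ineq[of "f u" "g u"] c[of u] d[of u] by linarith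
    also have "\<dots> \<le> exp (max c d * (1 + norm u)) + exp (max c d * (1 + norm u))"
      by (intro add_mono) (auto intro!: mult_right_mono)
    also have "\<dots> \<le> exp (max c d * (1 + norm u)) * exp (1 + norm u)"
    proof -
      have "2 \<le> exp (1 + norm u)"
        using exp_ge_add_one_self[of "1 + norm u"] norm_ge_zero[of u] by linarith
      then show ?thesis by (simp flip: mult_2_right)
    qed
    finally show ?thesis by (simp add: algebra_simps exp_add[symmetric])
  qed
  then show ?thesis
    using assms unfolding subexp_def by (auto intro!: continuous_intros)
qed

lemma subexp_mult:
  assumes "subexp f" "subexp g"
  shows "subexp (\<lambda>u. f u * g u)"
proof -
  obtain c d where c: "\<And>u. cmod (f u) \<le> exp (c * (1 + norm u))" and d: "\<And>u. cmod (g u) \<le> exp (d * (1 + norm u))"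
    using assms unfolding subexp_def by metis
  have "cmod (f u * g u) \<le> exp ((c + d) * (1 + norm u))" for u
    using mult_mono[OF c[of u] d[of u]] by (simp add: norm_mult algebra_simps exp_add[symmetric])
  then show ?thesis
    using assms unfolding subexp_def by (auto intro!: continuous_intros)
qed

lemma subexp_sp: "subexp (sp a)" "subexp (\<lambda>u. sp a (vcnj u))"
  by (rule subexp_linear[where c = "norm a"];
      auto intro!: continuous_intros order_trans[OF norm_sp_le] simp: norm_vcnj)+

lemma gauss_decay_mult:
  assumes "subexp f" "gauss_decay g"
  shows "gauss_decay (\<lambda>u. f u * g u)"
proof -
  obtain c where c: "\<And>u. cmod (f u) \<le> exp (c * (1 + norm u))"
    using assms unfolding subexp_def by metis
  obtain e d where d: "d > 0" "\<And>u. cmod (g u) \<le> exp (e * (1 + norm u) - d * (norm u)\<^sup>2)"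
    using assms unfolding gauss_decay_def by metis
  have "cmod (f u * g u) \<le> exp ((c + e) * (1 + norm u) - d * (norm u)\<^sup>2)" for u
  proof -
    have "(c + e) * (1 + norm u) - d * (norm u)\<^sup>2
        = c * (1 + norm u) + (e * (1 + norm u) - d * (norm u)\<^sup>2)" by (simp add: algebra_simps)
    then show ?thesis
      using mult_mono[OF c[of u] d(2)[of u]] by (simp only: norm_mult exp_add) simp
  qed
  with d(1) show ?thesis
    using assms unfolding subexp_def gauss_decay_def by (auto intro!: continuous_intros)
qed

lemma integrable_gauss_bound:
  fixes c d :: real
  assumes "0 < l" "0 < d"
  shows "integrable (fock_mu l) (\<lambda>u :: complex ^ 'n::finite. exp (c * (1 + norm u) - d * (norm u)\<^sup>2))"
proof (rule Bochner_Integration.integrable_bound)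
  have "integrable (fock_mu l) (\<lambda>u :: complex ^ 'n. exp (- (d / 2) * (norm u)\<^sup>2))"
    using fock_mu_gaussian[OF assms(1), of "d / 2"] assms by (auto simp: has_bochner_integral_iff)
  \<comment> \<open>Completing the square gives c x - (d/2) x^2 \<le> c^2 / (2 d); the other half of
    the quadratic decay stays.\<close>
  then show "integrable (fock_mu l) (\<lambda>u :: complex ^ 'n. exp (c + c\<^sup>2 / (2 * d)) * exp (- (d / 2) * (norm u)\<^sup>2))"
    by (rule integrable_mult_right)
  have "c * (1 + x) - d * x\<^sup>2 \<le> c + c\<^sup>2 / (2 * d) + - (d / 2) * x\<^sup>2" for x
  proof -
    have "0 \<le> (c - d * x)\<^sup>2 / (2 * d)" using assms by simp
    also have "\<dots> = c\<^sup>2 / (2 * d) - c * x + d / 2 * x\<^sup>2"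
      using assms by (simp add: power2_eq_square field_simps)
    finally show ?thesis by (simp add: algebra_simps)
  qed
  then show "AE u :: complex ^ 'n in fock_mu l. norm (exp (c * (1 + norm u) - d * (norm u)\<^sup>2))
      \<le> norm (exp (c + c\<^sup>2 / (2 * d)) * exp (- (d / 2) * (norm u)\<^sup>2))"
    by (simp flip: exp_add)
qed measurable

lemma gauss_decay_integrable:
  assumes "0 < l" "gauss_decay f"
  shows "integrable (fock_mu l) f"
proof -
  obtain e d where d: "d > 0" "\<And>u. cmod (f u) \<le> exp (e * (1 + norm u) - d * (norm u)\<^sup>2)"
    and "continuous_on UNIV f"
    using assms unfolding gauss_decay_def by metis
  then have m[measurable]: "f \<in> borel_measurable borel" by (intro borel_measurable_continuous_onI)
  show ?thesis
    by (rule Bochner_Integration.integrable_bound[OF integrable_gauss_bound[OF assms(1) d(1), of e]])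
      (use d in \<open>auto simp: m\<close>)
qed

text \<open>From |u|^2 \<le> 2 |u + s v|^2 + 2 |v|^2, at the cost of half the decay rate. Uniformity
  in s is what domination under the integral requires.\<close>

lemma gauss_decay_translate:
  assumes "gauss_decay f"
  obtains c d where "d > 0" "\<And>u s. \<bar>s\<bar> \<le> 1 \<Longrightarrow> cmod (f (u + s *\<^sub>R v)) \<le> exp (c * (1 + norm u) - d * (norm u)\<^sup>2)"
proof -
  obtain c d where d: "d > 0" "\<And>u. cmod (f u) \<le> exp (c * (1 + norm u) - d * (norm u)\<^sup>2)"
    using assms unfolding gauss_decay_def by metis
  let ?b = "norm v"
  have "cmod (f (u + s *\<^sub>R v)) \<le> exp ((\<bar>c\<bar> * (1 + ?b) + d * ?b\<^sup>2) * (1 + norm u) - d / 2 * (norm u)\<^sup>2)"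
    if s: "\<bar>s\<bar> \<le> 1" for u s
  proof -
    let ?w = "u + s *\<^sub>R v"
    have sv: "norm (s *\<^sub>R v) \<le> ?b" using s by (simp add: mult_left_le_one_le)
    have w1: "norm ?w \<le> norm u + ?b" using norm_triangle_ineq[of u "s *\<^sub>R v"] sv by linarith
    have "norm u \<le> norm ?w + ?b" using norm_triangle_ineq4[of ?w "s *\<^sub>R v"] sv by simp
    then have "(norm u)\<^sup>2 \<le> (norm ?w + ?b)\<^sup>2" by (intro power_mono) auto
    also have "\<dots> \<le> 2 * (norm ?w)\<^sup>2 + 2 * ?b\<^sup>2"
      using sum_squares_bound[of "norm ?w" ?b] by (simp add: power2_sum)
    finally have w2: "d / 2 * (norm u)\<^sup>2 \<le> d * (norm ?w)\<^sup>2 + d * ?b\<^sup>2"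
      using d(1) mult_left_mono[of "(norm u)\<^sup>2" "2 * (norm ?w)\<^sup>2 + 2 * ?b\<^sup>2" "d / 2"] by (simp add: algebra_simps)
    have "c * (1 + norm ?w) \<le> \<bar>c\<bar> * (1 + norm ?w)" by (intro mult_right_mono) auto
    also have "\<dots> \<le> \<bar>c\<bar> * ((1 + ?b) * (1 + norm u))"
    proof (rule mult_left_mono)
      have "(1 + ?b) * (1 + norm u) = 1 + norm u + ?b + norm u * ?b" by (simp add: algebra_simps)
      then show "1 + norm ?w \<le> (1 + ?b) * (1 + norm u)"
        using w1 mult_nonneg_nonneg[OF norm_ge_zero[of u] norm_ge_zero[of v]] by linarith
    qed simp
    finally have "c * (1 + norm ?w) - d * (norm ?w)\<^sup>2
        \<le> \<bar>c\<bar> * ((1 + ?b) * (1 + norm u)) + d * ?b\<^sup>2 - d / 2 * (norm u)\<^sup>2"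
      using w2 by linarith
    also have "\<dots> \<le> (\<bar>c\<bar> * (1 + ?b) + d * ?b\<^sup>2) * (1 + norm u) - d / 2 * (norm u)\<^sup>2"
      using d(1) by (simp add: algebra_simps)
    finally show ?thesis using d(2)[of ?w] by (meson exp_le_cancel_iff order_trans)
  qed
  then show thesis using d(1) by (intro that[of "d / 2"]) auto
qed

lemma subexp_dominated:
  assumes "continuous_on UNIV f" "subexp g" "\<And>u. cmod (f u) \<le> cmod (g u)"
  shows "subexp f"
  using assms unfolding subexp_def by (meson order_trans)

lemma subexp_cmod:
  assumes "subexp f"
  shows "subexp (\<lambda>u. complex_of_real (cmod (f u)))"
  using assms by (intro subexp_dominated[OF _ assms]) (auto simp: subexp_def intro!: continuous_intros)

lemma subexp_uminus: "subexp f \<Longrightarrow> subexp (\<lambda>u. - f u)"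
  by (rule subexp_dominated[of _ f]) (auto simp: subexp_def intro!: continuous_intros)

lemma subexp_diff: "subexp f \<Longrightarrow> subexp g \<Longrightarrow> subexp (\<lambda>u. f u - g u)"
  using subexp_add[OF _ subexp_uminus, of f g] by simp

lemma subexp_norm: "subexp (\<lambda>u. of_real (norm u))"
  by (rule subexp_linear[where c = 1]) (auto intro!: continuous_intros)

lemma subexp_sp_matrix:
  fixes A :: "complex ^ 'n::finite ^ 'n"
  shows "subexp (\<lambda>u. sp (A *v u) v)" "subexp (\<lambda>u. sp v (A *v u))"
    "subexp (\<lambda>u. sp (A *v vcnj u) v)" "subexp (\<lambda>u. sp v (A *v vcnj u))"
    "subexp (\<lambda>u. sp u v)" "subexp (\<lambda>u. sp (vcnj u) v)"
proof -
  show 1: "subexp (\<lambda>u. sp (A *v u) v)" "subexp (\<lambda>u. sp (A *v vcnj u) v)"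
  proof -
    have "sp (A *v u) v = sp (transpose A *v v) u" for u
      using sp_matrix_left[of A u v] sp_commute[of u "transpose A *v v"] by (rule trans)
    then show "subexp (\<lambda>u. sp (A *v u) v)" "subexp (\<lambda>u. sp (A *v vcnj u) v)"
      by (simp_all only: subexp_sp)
  qed
  show "subexp (\<lambda>u. sp v (A *v u))" "subexp (\<lambda>u. sp v (A *v vcnj u))"
    using 1 by (simp_all only: sp_commute[of v])
  show "subexp (\<lambda>u. sp u v)" "subexp (\<lambda>u. sp (vcnj u) v)"
    unfolding sp_commute[of _ v] by (rule subexp_sp)+
qed

lemma subexp_quadratic:
  fixes A :: "complex ^ 'n::finite ^ 'n"
  shows "subexp (\<lambda>u. sp u (A *v u))"
proof -
  obtain K where K: "K > 0" "\<And>x. norm (A *v x) \<le> K * norm x" using norm_matrix_le[of A] by auto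
  show ?thesis
  proof (rule subexp_dominated)
    show "subexp (\<lambda>u :: complex ^ 'n. of_real (norm u) * (of_real K * of_real (norm u)))"
      by (intro subexp_mult subexp_norm subexp_const)
    show "cmod (sp u (A *v u)) \<le> cmod (of_real (norm u) * (of_real K * of_real (norm u)))" for u
      using order_trans[OF norm_sp_le mult_left_mono[OF K(2) norm_ge_zero], of u u] K(1)
      by (simp add: norm_mult)
  qed (intro continuous_intros)
qed

text \<open>The integral of a translate does not depend on the translation; differentiating this at \<open>0\<close>
  is integration by parts.\<close>

lemma integral_translation_derivative:
  fixes v :: "complex ^ 'n::finite"
  assumes l: "0 < l" and p: "subexp p" and q: "continuous_on UNIV q" and q1: "subexp q1"
    and E: "gauss_decay (\<lambda>u. exp (q u))"
    and pe: "\<And>u s. p (u + s *\<^sub>R v) = p u + of_real s * p1"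
    and qe: "\<And>u s. q (u + s *\<^sub>R v) = q u + of_real s * q1 u + of_real s * of_real s * q2"
  shows "(LINT u|fock_mu l. (p1 + p u * q1 u) * exp (q u)) = 0"
proof -
  define F where "F s u = p (u + s *\<^sub>R v) * exp (q (u + s *\<^sub>R v))" for s u
  define F' where "F' s u = (p1 + (p u + of_real s * p1) * (q1 u + 2 * of_real s * q2)) * exp (q (u + s *\<^sub>R v))" for s u
  obtain c d where d: "d > 0"
    "\<And>u s. \<bar>s\<bar> \<le> 1 \<Longrightarrow> cmod (exp (q (u + s *\<^sub>R v))) \<le> exp (c * (1 + norm u) - d * (norm u)\<^sup>2)"
    by (rule gauss_decay_translate[OF E]) auto
  define S where "S u = complex_of_real (cmod p1) + (of_real (cmod (p u)) + of_real (cmod p1)) * (of_real (cmod (q1 u)) + 2 * of_real (cmod q2))" for u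
  have "subexp S"
    unfolding S_def by (intro subexp_add subexp_mult subexp_const subexp_cmod p q1)
  then obtain e where e: "\<And>u. cmod (S u) \<le> exp (e * (1 + norm u))"
    unfolding subexp_def by metis
  have Fd: "gauss_decay (\<lambda>u. p u * exp (q u))" by (rule gauss_decay_mult[OF p E])
  have Fm: "(\<lambda>u. p u * exp (q u)) \<in> borel_measurable borel"
    using Fd by (intro borel_measurable_continuous_onI) (auto simp: gauss_decay_def)
  have Fi: "integrable (fock_mu l) (F s)" and Fc: "(LINT u|fock_mu l. F s u) = (LINT u|fock_mu l. p u * exp (q u))" for s
    using fock_mu_translate_integral[OF Fm, of l "s *\<^sub>R v"] gauss_decay_integrable[OF l Fd]
    unfolding F_def[abs_def] by auto
  have "((\<lambda>s. LINT u|fock_mu l. F s u) has_vector_derivative (LINT u|fock_mu l. F' 0 u)) (at 0 within {-1..1})"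
  proof (rule has_vector_derivative_integral_param)
    show "((\<lambda>s. F s u) has_vector_derivative F' s u) (at s within {-1..1})" for s u
    proof -
      have "((\<lambda>z. (p u + z * p1) * exp (q u + z * q1 u + z * z * q2)) has_field_derivative
          (p1 + (p u + of_real s * p1) * (q1 u + 2 * of_real s * q2)) *
            exp (q u + of_real s * q1 u + of_real s * of_real s * q2)) (at (of_real s))"
        by (rule derivative_eq_intros refl)+ (simp add: algebra_simps)
      from has_vector_derivative_real_field[OF this] show ?thesis
        unfolding F_def F'_def pe qe .
    qed
    show "norm (F' s u) \<le> exp ((e + c) * (1 + norm u) - d * (norm u)\<^sup>2)" if s: "s \<in> {-1..1}" for s u
    proof -
      have s1: "\<bar>s\<bar> \<le> 1" using s by auto
      have "cmod (p1 + (p u + of_real s * p1) * (q1 u + 2 * of_real s * q2))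
          \<le> cmod p1 + (cmod (p u) + cmod p1) * (cmod (q1 u) + 2 * cmod q2)"
      proof -
        have "cmod (of_real s * p1) \<le> cmod p1" "cmod (2 * of_real s * q2) \<le> 2 * cmod q2"
          using s1 by (simp_all add: norm_mult mult_left_le_one_le)
        then have "cmod (p u + of_real s * p1) \<le> cmod (p u) + cmod p1"
          "cmod (q1 u + 2 * of_real s * q2) \<le> cmod (q1 u) + 2 * cmod q2"
          using norm_triangle_ineq[of "p u" "of_real s * p1"] norm_triangle_ineq[of "q1 u" "2 * of_real s * q2"]
          by linarith+
        then have "cmod ((p u + of_real s * p1) * (q1 u + 2 * of_real s * q2))
            \<le> (cmod (p u) + cmod p1) * (cmod (q1 u) + 2 * cmod q2)"
          unfolding norm_mult by (intro mult_mono) auto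
        then show ?thesis
          using norm_triangle_ineq[of p1 "(p u + of_real s * p1) * (q1 u + 2 * of_real s * q2)"] by linarith
      qed
      also have "\<dots> \<le> cmod (S u)"
      proof -
        have "S u = of_real (cmod p1 + (cmod (p u) + cmod p1) * (cmod (q1 u) + 2 * cmod q2))"
          by (simp add: S_def)
        then show ?thesis by (simp only: norm_of_real abs_ge_self)
      qed
      also have "\<dots> \<le> exp (e * (1 + norm u))" by (rule e)
      finally have "norm (F' s u) \<le> exp (e * (1 + norm u)) * exp (c * (1 + norm u) - d * (norm u)\<^sup>2)"
        unfolding F'_def norm_mult by (intro mult_mono d(2) s1) auto
      then show ?thesis by (simp add: algebra_simps flip: exp_add)
    qed
    show "integrable (fock_mu l) (\<lambda>u :: complex ^ 'n. exp ((e + c) * (1 + norm u) - d * (norm u)\<^sup>2))"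
      by (rule integrable_gauss_bound[OF l d(1)])
    have "continuous_on UNIV (F' s)" for s
      using p q1 unfolding F'_def subexp_def
      by (intro continuous_intros continuous_on_compose2[OF q]) auto
    then show "F' s \<in> borel_measurable (fock_mu l)" for s
      by (simp add: borel_measurable_continuous_onI borel_measurable_fock_mu)
  qed (use Fi in auto)
  moreover have "((\<lambda>s. LINT u|fock_mu l. F s u) has_vector_derivative 0) (at 0 within {-1..1})"
    by (simp add: Fc)
  ultimately have "(LINT u|fock_mu l. F' 0 u) = 0"
    using vector_derivative_unique_within_closed_interval[of "-1" 1 0] by (simp add: cbox_interval)
  then show ?thesis by (simp add: F'_def)
qed

section \<open>Derivative of the determinant\<close>

text \<open>In the Leibniz sum, a permutation other than the identity moves at least two points.
  After one factor is differentiated, an off-diagonal zero of the identity matrix remains, so only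
  the diagonal product contributes.\<close>

lemma det_one_plus_has_vector_derivative:
  fixes X :: "complex ^ 'n::finite ^ 'n"
  shows "((\<lambda>h. det (mat 1 + h *\<^sub>R X)) has_vector_derivative trace X) (at 0)"
proof -
  let ?S = "{p. p permutes (UNIV :: 'n set)}"
  have e: "det (mat 1 + h *\<^sub>R X) = (\<Sum>p\<in>?S. of_int (sign p) * (\<Prod>i\<in>UNIV. mat 1 $ i $ p i + h *\<^sub>R X $ i $ p i))" for h
    by (simp add: det_def)
  have z: "(\<Sum>i\<in>UNIV. X $ i $ p i * (\<Prod>j\<in>UNIV - {i}. mat 1 $ j $ p j)) = (if p = id then trace X else 0)"
    if "p \<in> ?S" for p
  proof (cases "p = id")
    case True
    have "(\<Prod>j\<in>UNIV - {i}. (mat 1 :: complex ^ 'n ^ 'n) $ j $ j) = 1" for i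
      by (simp add: mat_def)
    then show ?thesis using True by (simp add: trace_def)
  next
    case False
    then obtain a where a: "p a \<noteq> a" by (auto simp: fun_eq_iff)
    have inj: "inj p" using that by (auto simp: permutes_inj)
    have "(\<Prod>j\<in>UNIV - {i}. (mat 1 :: complex ^ 'n ^ 'n) $ j $ p j) = 0" for i
    proof -
      obtain b where "b \<noteq> i" "p b \<noteq> b"
      proof (cases "i = a")
        case True
        have "p (p a) \<noteq> p a" using a inj by (simp add: inj_eq)
        then show thesis using that[of "p a"] a True by simp
      qed (use that[of a] a in auto)
      then show ?thesis by (intro prod_zero) (auto simp: mat_def intro!: bexI[of _ b])
    qed
    then show ?thesis unfolding if_not_P[OF False] by (simp only: mult_zero_right sum.neutral_const)
  qed
  have "((\<lambda>h. \<Sum>p\<in>?S. of_int (sign p) * (\<Prod>i\<in>UNIV. mat 1 $ i $ p i + h *\<^sub>R X $ i $ p i)) has_derivative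
     (\<lambda>y. \<Sum>p\<in>?S. of_int (sign p) * (\<Sum>i\<in>UNIV. y *\<^sub>R X $ i $ p i * (\<Prod>j\<in>UNIV - {i}. mat 1 $ j $ p j + 0 *\<^sub>R X $ j $ p j)))) (at 0)"
  proof (intro has_derivative_sum has_derivative_mult_right has_derivative_prod)
    fix p and i :: 'n
    show "((\<lambda>h. mat 1 $ i $ p i + h *\<^sub>R X $ i $ p i) has_derivative (\<lambda>y. y *\<^sub>R X $ i $ p i)) (at 0)"
      using has_derivative_add[OF has_derivative_const
          bounded_linear_imp_has_derivative[OF bounded_linear_scaleR_left]] by simp
  qed
  also have "(\<lambda>y. \<Sum>p\<in>?S. of_int (sign p) * (\<Sum>i\<in>UNIV. y *\<^sub>R X $ i $ p i * (\<Prod>j\<in>UNIV - {i}. mat 1 $ j $ p j + 0 *\<^sub>R X $ j $ p j)))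
    = (\<lambda>y. y *\<^sub>R trace X)"
  proof
    fix y :: real
    have "(\<Sum>p\<in>?S. of_int (sign p) * (\<Sum>i\<in>UNIV. y *\<^sub>R X $ i $ p i * (\<Prod>j\<in>UNIV - {i}. mat 1 $ j $ p j + 0 *\<^sub>R X $ j $ p j)))
      = (\<Sum>p\<in>?S. of_int (sign p) * (y *\<^sub>R (if p = id then trace X else 0)))"
    proof (intro sum.cong refl)
      fix p assume p: "p \<in> ?S"
      have "(\<Sum>i\<in>UNIV. y *\<^sub>R X $ i $ p i * (\<Prod>j\<in>UNIV - {i}. mat 1 $ j $ p j + 0 *\<^sub>R X $ j $ p j))
          = y *\<^sub>R (\<Sum>i\<in>UNIV. X $ i $ p i * (\<Prod>j\<in>UNIV - {i}. mat 1 $ j $ p j))"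
        by (simp add: scaleR_sum_right)
      then show "of_int (sign p) * (\<Sum>i\<in>UNIV. y *\<^sub>R X $ i $ p i * (\<Prod>j\<in>UNIV - {i}. mat 1 $ j $ p j + 0 *\<^sub>R X $ j $ p j))
          = of_int (sign p) * (y *\<^sub>R (if p = id then trace X else 0))"
        unfolding z[OF p] by (rule arg_cong)
    qed
    also have "\<dots> = (\<Sum>p\<in>?S. if p = id then y *\<^sub>R trace X else 0)"
      by (intro sum.cong) (auto simp: sign_id)
    also have "\<dots> = y *\<^sub>R trace X"
      by (simp add: permutes_id finite_permutations)
    finally show "(\<Sum>p\<in>?S. of_int (sign p) * (\<Sum>i\<in>UNIV. y *\<^sub>R X $ i $ p i * (\<Prod>j\<in>UNIV - {i}. mat 1 $ j $ p j + 0 *\<^sub>R X $ j $ p j)))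
      = y *\<^sub>R trace X" .
  qed
  finally show ?thesis
    by (simp add: has_vector_derivative_def e)
qed

text \<open>Jacobi's formula along a line: factoring out N = M + t X moves the base point to the
  identity matrix.\<close>

lemma det_line_has_vector_derivative:
  fixes M X :: "complex ^ 'n::finite ^ 'n"
  assumes "invertible (M + t *\<^sub>R X)"
  shows "((\<lambda>t. det (M + t *\<^sub>R X)) has_vector_derivative
     det (M + t *\<^sub>R X) * trace (matrix_inv (M + t *\<^sub>R X) ** X)) (at t within S)"
proof -
  define N where "N = M + t *\<^sub>R X"
  have inv: "N ** matrix_inv N = mat 1"
    using assms unfolding N_def by (rule invertible_matrix_inv)
  have N: "M + s *\<^sub>R X = N ** (mat 1 + (s - t) *\<^sub>R (matrix_inv N ** X))" for s
  proof -
    have "N ** (mat 1 + (s - t) *\<^sub>R (matrix_inv N ** X)) = N + (s - t) *\<^sub>R (N ** matrix_inv N ** X)"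
      by (simp only: matrix_add_ldistrib matrix_mul_rid matrix_scalar_ac scalar_matrix_assoc matrix_mul_assoc)
    also have "\<dots> = M + s *\<^sub>R X"
      unfolding inv by (simp add: N_def algebra_simps)
    finally show ?thesis ..
  qed
  have 1: "((\<lambda>h. det (mat 1 + h *\<^sub>R (matrix_inv N ** X))) has_vector_derivative trace (matrix_inv N ** X)) (at (t - t))"
    using det_one_plus_has_vector_derivative by simp
  have "((\<lambda>s. s - t) has_real_derivative 1) (at t)"
    by (auto intro!: derivative_eq_intros)
  then have 2: "((\<lambda>s. s - t) has_vector_derivative 1) (at t)"
    by (simp add: has_real_derivative_iff_has_vector_derivative)
  from vector_diff_chain_at[OF 2 1]
  have "((\<lambda>s. det (mat 1 + (s - t) *\<^sub>R (matrix_inv N ** X))) has_vector_derivative trace (matrix_inv N ** X)) (at t)"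
    by (simp add: comp_def)
  then have "((\<lambda>s. det N * det (mat 1 + (s - t) *\<^sub>R (matrix_inv N ** X))) has_vector_derivative det N * trace (matrix_inv N ** X)) (at t)"
    by (rule has_vector_derivative_mult_right)
  then have "((\<lambda>s. det (M + s *\<^sub>R X)) has_vector_derivative det N * trace (matrix_inv N ** X)) (at t)"
    unfolding det_mul[symmetric] N[symmetric] .
  then show ?thesis
    unfolding N_def by (rule has_vector_derivative_at_within)
qed

section \<open>Complex Gaussian integrals\<close>

lemma has_vector_derivative_integral_exp:
  fixes q0 q1 :: "complex ^ 'n::finite \<Rightarrow> complex"
  assumes l: "0 < l" and d: "0 < d" and q0: "continuous_on UNIV q0" and q1: "subexp q1"
    and bnd: "\<And>s u. s \<in> {0..1} \<Longrightarrow> cmod (exp (q0 u + of_real s * q1 u)) \<le> exp (c * (1 + norm u) - d * (norm u)\<^sup>2)"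
    and s: "s \<in> {0..1}"
  shows "((\<lambda>s. LINT u|fock_mu l. exp (q0 u + of_real s * q1 u)) has_vector_derivative
    (LINT u|fock_mu l. q1 u * exp (q0 u + of_real s * q1 u))) (at s within {0..1})"
proof -
  obtain e where e: "\<And>u. cmod (q1 u) \<le> exp (e * (1 + norm u))"
    using q1 unfolding subexp_def by metis
  have cont: "continuous_on UNIV q1" using q1 by (simp add: subexp_def)
  show ?thesis
  proof (rule has_vector_derivative_integral_param[where g = "\<lambda>u. exp ((e + c) * (1 + norm u) - d * (norm u)\<^sup>2)"])
    fix t :: real and u :: "complex ^ 'n"
    assume t: "t \<in> {0..1}"
    have "continuous_on UNIV (\<lambda>u. exp (q0 u + of_real t * q1 u))"
      by (intro continuous_intros q0 cont)
    then have "gauss_decay (\<lambda>u. exp (q0 u + of_real t * q1 u))"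
      unfolding gauss_decay_def using bnd[OF t] d by blast
    then show "integrable (fock_mu l) (\<lambda>u. exp (q0 u + of_real t * q1 u))"
      by (rule gauss_decay_integrable[OF l])
    have "((\<lambda>z. exp (q0 u + z * q1 u)) has_field_derivative q1 u * exp (q0 u + of_real t * q1 u)) (at (of_real t))"
      by (rule derivative_eq_intros refl)+ simp
    then show "((\<lambda>t. exp (q0 u + of_real t * q1 u)) has_vector_derivative q1 u * exp (q0 u + of_real t * q1 u)) (at t within {0..1})"
      by (rule has_vector_derivative_real_field)
    have "norm (q1 u * exp (q0 u + of_real t * q1 u)) \<le> exp (e * (1 + norm u)) * exp (c * (1 + norm u) - d * (norm u)\<^sup>2)"
      unfolding norm_mult by (intro mult_mono e bnd[OF t]) auto
    then show "norm (q1 u * exp (q0 u + of_real t * q1 u)) \<le> exp ((e + c) * (1 + norm u) - d * (norm u)\<^sup>2)"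
      by (simp add: algebra_simps flip: exp_add)
    show "(\<lambda>u. q1 u * exp (q0 u + of_real t * q1 u)) \<in> borel_measurable (fock_mu l)"
      unfolding borel_measurable_fock_mu by (intro borel_measurable_continuous_onI continuous_intros q0 cont)
  qed (use s integrable_gauss_bound[OF l d] in auto)
qed

lemma constant_on_unit_interval:
  fixes f :: "real \<Rightarrow> complex"
  assumes "\<And>t. t \<in> {0..1} \<Longrightarrow> (f has_vector_derivative 0) (at t within {0..1})"
  shows "f 1 = f 0"
proof -
  have "\<exists>c. \<forall>x\<in>{0..1}. f x = c"
    by (rule has_derivative_zero_constant) (use assms in \<open>auto simp: has_vector_derivative_def\<close>)
  then show ?thesis by (metis atLeastAtMost_iff order_refl zero_le_one)
qed

text \<open>The composition of k and k' uses A = \<open>kerA k'\<close> and B =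
  \<open>kerB k\<close>, with r a common bound for the two contractions.\<close>

locale gauss_pair =
  fixes l r :: real and A B :: "complex ^ 'n::finite ^ 'n"
  assumes l: "0 < l" and r0: "0 \<le> r" and r1: "r < 1"
    and symA: "sp x (A *v y) = sp y (A *v x)" and symB: "sp x (B *v y) = sp y (B *v x)"
    and normA: "norm (A *v x) \<le> r * norm x" and normB: "norm (B *v x) \<le> r * norm x"
begin

text \<open>The u-dependent exponent of the composition integral, weight included, with two
  switches: s scales the linear terms and t scales A. The paths used are s in {0..1} at t = 1, and t
  in {0..1} at s = 0.\<close>

definition qexp :: "complex ^ 'n \<Rightarrow> complex ^ 'n \<Rightarrow> real \<Rightarrow> real \<Rightarrow> complex ^ 'n \<Rightarrow> complex" where
  "qexp a b t s u = of_real l / 4 * (of_real t * sp u (A *v u) + sp (vcnj u) (B *v vcnj u))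
     + of_real s * (of_real l / 2 * (sp a u + sp b (vcnj u))) - of_real l / 2 * sp u (vcnj u)"

lemma continuous_qexp: "continuous_on UNIV (qexp a b t s)"
  unfolding qexp_def by (intro continuous_intros)

lemma Re_quadratic_le:
  assumes "norm (M *v u) \<le> r * norm u"
  shows "Re (sp u (M *v u)) \<le> r * (norm u)\<^sup>2"
proof -
  have "Re (sp u (M *v u)) \<le> norm u * norm (M *v u)"
    by (rule order_trans[OF complex_Re_le_cmod norm_sp_le])
  also have "\<dots> \<le> norm u * (r * norm u)" by (intro mult_left_mono assms) auto
  finally show ?thesis by (simp add: power2_eq_square mult_ac)
qed

text \<open>Each quadratic form adds at most l/4 r |u|^2 and the weight subtracts l/2 |u|^2. The
  resulting bound is the same for all s and t on the paths.\<close>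

lemma qexp_bound:
  assumes t: "t \<in> {0..1}" and s: "s \<in> {0..1}"
  shows "cmod (exp (qexp a b t s u)) \<le> exp (l / 2 * (norm a + norm b) * (1 + norm u) - l / 2 * (1 - r) * (norm u)\<^sup>2)"
proof -
  have "t * Re (sp u (A *v u)) \<le> t * (r * (norm u)\<^sup>2)"
    using t by (intro mult_left_mono Re_quadratic_le normA) auto
  also have "\<dots> \<le> r * (norm u)\<^sup>2"
    using t r0 by (intro mult_left_le_one_le) auto
  finally have 1: "t * Re (sp u (A *v u)) \<le> r * (norm u)\<^sup>2" .
  have 2: "Re (sp (vcnj u) (B *v vcnj u)) \<le> r * (norm u)\<^sup>2"
    using Re_quadratic_le[OF normB, of "vcnj u"] by (simp add: norm_vcnj)
  have "Re (sp a u + sp b (vcnj u)) \<le> norm a * norm u + norm b * norm u"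
    using complex_Re_le_cmod[of "sp a u"] complex_Re_le_cmod[of "sp b (vcnj u)"]
      norm_sp_le[of a u] norm_sp_le[of b "vcnj u"] by (simp add: norm_vcnj)
  then have "s * Re (sp a u + sp b (vcnj u)) \<le> s * (norm a * norm u + norm b * norm u)"
    using s by (intro mult_left_mono) auto
  also have "\<dots> \<le> norm a * norm u + norm b * norm u"
    using s by (intro mult_left_le_one_le) auto
  also have "\<dots> \<le> (norm a + norm b) * (1 + norm u)" by (simp add: algebra_simps)
  finally have 3: "s * Re (sp a u + sp b (vcnj u)) \<le> (norm a + norm b) * (1 + norm u)" .
  have "Re (qexp a b t s u) = l / 4 * (t * Re (sp u (A *v u)) + Re (sp (vcnj u) (B *v vcnj u)))
      + l / 2 * (s * Re (sp a u + sp b (vcnj u))) - l / 2 * (norm u)\<^sup>2"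
    by (simp add: qexp_def sp_vcnj_self algebra_simps)
  also have "\<dots> \<le> l / 4 * (r * (norm u)\<^sup>2 + r * (norm u)\<^sup>2) + l / 2 * ((norm a + norm b) * (1 + norm u)) - l / 2 * (norm u)\<^sup>2"
    using l 1 2 3 by (intro diff_right_mono add_mono mult_left_mono) auto
  also have "\<dots> = l / 2 * (norm a + norm b) * (1 + norm u) - l / 2 * (1 - r) * (norm u)\<^sup>2"
    by (simp add: field_simps)
  finally show ?thesis by (simp add: norm_exp_eq_Re)
qed

lemma decay_pos: "l / 2 * (1 - r) > 0"
  using l r1 by simp

lemma gauss_decay_qexp:
  assumes "t \<in> {0..1}" "s \<in> {0..1}"
  shows "gauss_decay (\<lambda>u. exp (qexp a b t s u))"
  unfolding gauss_decay_def
  using qexp_bound[OF assms, of a b] decay_pos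
  by (intro conjI continuous_intros continuous_qexp) blast

text \<open>With the factor l/2, \<open>gradX\<close> and \<open>gradY\<close> are the derivatives
  of \<open>qexp\<close> in u and in the conjugate of u, regarded as independent variables.\<close>

definition gradX :: "complex ^ 'n \<Rightarrow> real \<Rightarrow> real \<Rightarrow> complex ^ 'n \<Rightarrow> complex ^ 'n" where
  "gradX a t s u = t *\<^sub>R (A *v u) + s *\<^sub>R a - vcnj u"

definition gradY :: "complex ^ 'n \<Rightarrow> real \<Rightarrow> complex ^ 'n \<Rightarrow> complex ^ 'n" where
  "gradY b s u = B *v vcnj u + s *\<^sub>R b - u"

lemma qexp_translate:
  "qexp a b t s (u + h *\<^sub>R v) = qexp a b t s u
     + of_real h * (of_real l / 2 * (sp (gradX a t s u) v + sp (gradY b s u) (vcnj v)))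
     + of_real h * of_real h * (of_real l / 4 * (of_real t * sp v (A *v v) + sp (vcnj v) (B *v vcnj v)) - of_real l / 2 * sp v (vcnj v))"
  using symA[of v u] symB[of "vcnj v" "vcnj u"]
    sp_commute[of "A *v u" v] sp_commute[of "B *v vcnj u" "vcnj v"] sp_commute[of "vcnj u" v]
  by (simp add: qexp_def gradX_def gradY_def sp_simps matrix_vector_right_distrib vcnj_simps
      matrix_vec_scaleR algebra_simps)

lemma subexp_grad: "subexp (\<lambda>u. sp (gradX a t s u) v)" "subexp (\<lambda>u. sp (gradY b s u) v)"
  unfolding gradX_def gradY_def sp_simps
  by (intro subexp_add subexp_diff subexp_mult subexp_const subexp_sp_matrix)+

lemma integrable_qexp:
  assumes "t \<in> {0..1}" "s \<in> {0..1}" "subexp p"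
  shows "integrable (fock_mu l) (\<lambda>u. p u * exp (qexp a b t s u))"
  by (intro gauss_decay_integrable[OF l] gauss_decay_mult assms gauss_decay_qexp)

lemma ibp_real:
  assumes "t \<in> {0..1}" "s \<in> {0..1}"
  shows "(LINT u|fock_mu l. (sp c v + (\<alpha> + sp c u) *
     (of_real l / 2 * (sp (gradX a t s u) v + sp (gradY b s u) (vcnj v)))) * exp (qexp a b t s u)) = 0"
proof (rule integral_translation_derivative[OF l _ continuous_qexp _ gauss_decay_qexp[OF assms] _ qexp_translate])
  show "subexp (\<lambda>u. \<alpha> + sp c u)"
    "subexp (\<lambda>u. of_real l / 2 * (sp (gradX a t s u) v + sp (gradY b s u) (vcnj v)))"
    by (intro subexp_add subexp_mult subexp_const subexp_sp subexp_grad)+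
qed (simp add: sp_simps)

text \<open>Combining the real directions \<open>v\<close> and \<open>\<i>v\<close> isolates the holomorphic and the
  antiholomorphic derivative.\<close>

lemma ibp:
  assumes ts: "t \<in> {0..1}" "s \<in> {0..1}"
  shows "(LINT u|fock_mu l. (sp c v + (\<alpha> + sp c u) * (of_real l / 2 * sp (gradX a t s u) v)) * exp (qexp a b t s u)) = 0"
    and "(LINT u|fock_mu l. ((\<alpha> + sp c u) * sp (gradY b s u) v) * exp (qexp a b t s u)) = 0"
proof -
  define T where "T v = (\<lambda>u. (sp c v + (\<alpha> + sp c u) *
     (of_real l / 2 * (sp (gradX a t s u) v + sp (gradY b s u) (vcnj v)))) * exp (qexp a b t s u))" for v
  have T0: "(LINT u|fock_mu l. T v u) = 0" for v
    unfolding T_def by (rule ibp_real[OF ts])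
  have Ti: "integrable (fock_mu l) (T v)" for v
    unfolding T_def by (intro integrable_qexp ts subexp_add subexp_mult subexp_const subexp_sp subexp_grad)
  have "(sp c v + (\<alpha> + sp c u) * (of_real l / 2 * sp (gradX a t s u) v)) * exp (qexp a b t s u)
      = (T v u - \<i> * T (\<i> *s v) u) / 2" for u
    by (simp add: T_def sp_simps vcnj_simps field_simps)
  note eX = this
  show "(LINT u|fock_mu l. (sp c v + (\<alpha> + sp c u) * (of_real l / 2 * sp (gradX a t s u) v)) * exp (qexp a b t s u)) = 0"
    unfolding eX by (simp add: Ti T0)
  define w where "w = vcnj v"
  have v: "v = vcnj w" by (simp add: w_def vcnj_simps)
  \<comment> \<open>The polynomial is holomorphic in u, so its derivative cancels in this
    combination of directions.\<close>
  have "((\<alpha> + sp c u) * sp (gradY b s u) v) * exp (qexp a b t s u)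
      = (T w u + \<i> * T (\<i> *s w) u) / of_real l" for u
    using l by (simp add: T_def sp_simps v vcnj_simps field_simps)
  note eY = this
  show "(LINT u|fock_mu l. ((\<alpha> + sp c u) * sp (gradY b s u) v) * exp (qexp a b t s u)) = 0"
    unfolding eY by (simp add: Ti T0)
qed

text \<open>The hypotheses say that (u0, v0) is the critical point at s = t = 1, with v0 in place of
  the conjugate of u0. The factor to be found is the exponential of the critical value. It arises by
  integrating J' = (l/2) s \<kappa> J over s.\<close>

lemma gauss_integral_linear:
  assumes v0: "v0 = A *v u0 + a" and u0: "u0 = B *v v0 + b"
  shows "(LINT u|fock_mu l. exp (qexp a b 1 1 u)) =
    (LINT u|fock_mu l. exp (qexp 0 0 1 0 u)) * exp (of_real l / 4 * (sp a u0 + sp b v0))"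
proof -
  define \<kappa> where "\<kappa> = sp a u0 + sp b v0"
  define J where "J s = (LINT u|fock_mu l. exp (qexp a b 1 s u))" for s
  have J': "(J has_vector_derivative of_real l / 2 * of_real s * \<kappa> * J s) (at s within {0..1})"
    if s: "s \<in> {0..1}" for s
  proof -
    define Q where "Q = qexp a b 1 0"
    have q: "qexp a b 1 s u = Q u + of_real s * (of_real l / 2 * (sp a u + sp b (vcnj u)))" for s u
      by (simp add: Q_def qexp_def)
    have "(J has_vector_derivative (LINT u|fock_mu l. (of_real l / 2 * (sp a u + sp b (vcnj u))) * exp (qexp a b 1 s u))) (at s within {0..1})"
      unfolding J_def q
    proof (rule has_vector_derivative_integral_exp[OF l decay_pos _ _ _ s])
      show "continuous_on UNIV Q" unfolding Q_def by (rule continuous_qexp)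
      show "subexp (\<lambda>u. of_real l / 2 * (sp a u + sp b (vcnj u)))"
        by (intro subexp_add subexp_mult subexp_const subexp_sp)
      show "cmod (exp (Q u + of_real s * (of_real l / 2 * (sp a u + sp b (vcnj u)))))
        \<le> exp (l / 2 * (norm a + norm b) * (1 + norm u) - l / 2 * (1 - r) * (norm u)\<^sup>2)" if "s \<in> {0..1}" for s u
        unfolding q[symmetric] by (rule qexp_bound) (use that in auto)
    qed
    moreover have "(LINT u|fock_mu l. (of_real l / 2 * (sp a u + sp b (vcnj u))) * exp (qexp a b 1 s u))
        = of_real l / 2 * of_real s * \<kappa> * J s"
    proof -
      \<comment> \<open>Pair the two gradients with the components of the critical point. By
        symmetry of A and B, the terms in u and its conjugate collapse to - a^t u and - b^t ubar;
        the gradients themselves integrate to 0.\<close>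
      have id: "sp a u + sp b (vcnj u) = of_real s * \<kappa> - sp (gradX a 1 s u) u0 - sp (gradY b s u) v0" for u
      proof -
        have "sp a u = sp v0 u - sp (A *v u0) u" "sp b (vcnj u) = sp u0 (vcnj u) - sp (B *v v0) (vcnj u)"
          using arg_cong[OF v0, of "\<lambda>x. sp x u"] arg_cong[OF u0, of "\<lambda>x. sp x (vcnj u)"]
          by (simp_all only: sp_add_left add_diff_cancel_left')
        then show ?thesis
          using symA[of u u0] symB[of "vcnj u" v0]
          by (simp add: \<kappa>_def gradX_def gradY_def sp_simps sp_commute algebra_simps)
      qed
      have one: "(1::real) \<in> {0..1}" by simp
      define f1 where "f1 u = (sp 0 u0 + (1 + sp 0 u) * (of_real l / 2 * sp (gradX a 1 s u) u0)) * exp (qexp a b 1 s u)" for u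
      define f2 where "f2 u = ((1 + sp 0 u) * sp (gradY b s u) v0) * exp (qexp a b 1 s u)" for u
      define f3 where "f3 u = exp (qexp a b 1 s u)" for u
      have int: "integrable (fock_mu l) f1" "integrable (fock_mu l) f2" "integrable (fock_mu l) f3"
        unfolding f1_def f2_def f3_def
        by (intro integrable_qexp one s subexp_add subexp_mult subexp_const subexp_sp subexp_grad
            gauss_decay_integrable[OF l gauss_decay_qexp[OF one s]])+
      have zero: "(LINT u|fock_mu l. f1 u) = 0" "(LINT u|fock_mu l. f2 u) = 0"
        unfolding f1_def f2_def by (rule ibp[OF one s])+
      have p: "(of_real l / 2 * (sp a u + sp b (vcnj u))) * exp (qexp a b 1 s u)
        = of_real l / 2 * of_real s * \<kappa> * f3 u - f1 u - of_real l / 2 * f2 u" for u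
        by (simp add: id f1_def f2_def f3_def sp_simps algebra_simps)
      show ?thesis
        unfolding p by (simp add: int zero J_def flip: f3_def)
    qed
    ultimately show ?thesis by simp
  qed
  \<comment> \<open>The integrating factor of the differential equation for J.\<close>
  define K where "K s = J s * exp (- (of_real l / 4 * \<kappa>) * (of_real s * of_real s))" for s
  have "K 1 = K 0"
  proof (rule constant_on_unit_interval)
    fix s :: real assume s: "s \<in> {0..1}"
    have "((\<lambda>z. exp (- (of_real l / 4 * \<kappa>) * (z * z))) has_field_derivative
        (- (of_real l / 2 * \<kappa> * of_real s)) * exp (- (of_real l / 4 * \<kappa>) * (of_real s * of_real s))) (at (of_real s))"
      by (rule derivative_eq_intros refl)+ (simp add: field_simps)
    from has_vector_derivative_real_field[OF this]
    show "(K has_vector_derivative 0) (at s within {0..1})"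
      unfolding K_def
      by (intro has_vector_derivative_eq_rhs[OF has_vector_derivative_mult[OF J'[OF s]]]) (auto simp: algebra_simps)
  qed
  moreover have "J 0 = (LINT u|fock_mu l. exp (qexp 0 0 1 0 u))"
    by (simp add: J_def qexp_def)
  ultimately have "J 1 * exp (- (of_real l / 4 * \<kappa>)) = (LINT u|fock_mu l. exp (qexp 0 0 1 0 u))"
    by (simp add: K_def)
  then have "J 1 * (exp (- (of_real l / 4 * \<kappa>)) * exp (of_real l / 4 * \<kappa>))
      = (LINT u|fock_mu l. exp (qexp 0 0 1 0 u)) * exp (of_real l / 4 * \<kappa>)"
    by (simp only: mult.assoc[symmetric])
  then show ?thesis
    by (simp add: J_def \<kappa>_def flip: exp_add)
qed

end

section \<open>The pure quadratic integral\<close>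

context gauss_pair
begin

text \<open>This is 1 - tAB, written as a line with direction - (A ** B) so that Jacobi's formula
  applies as stated.\<close>

definition pathM :: "real \<Rightarrow> complex ^ 'n ^ 'n" where
  "pathM t = mat 1 + t *\<^sub>R (- (A ** B))"

lemma pathM_mult: "pathM t *v x = x - t *\<^sub>R (A *v (B *v x))"
proof -
  show ?thesis
    unfolding pathM_def scaleR_minus_right matrix_vector_mult_add_rdistrib matrix_vec_minus scaleR_matrix_vec
      matrix_vector_mul_assoc by simp
qed

text \<open>A vector x in the kernel satisfies |x| \<le> r^2 |x|.\<close>

lemma invertible_pathM:
  assumes t: "t \<in> {0..1}"
  shows "invertible (pathM t)"
proof -
  have "inj ((*v) (pathM t))"
  proof (rule injI)
    fix x y assume "pathM t *v x = pathM t *v y"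
    then have "pathM t *v (x - y) = 0" by (simp add: matrix_vector_mult_diff_distrib)
    then have e: "x - y = t *\<^sub>R (A *v (B *v (x - y)))" by (simp add: pathM_mult)
    have "norm (x - y) = \<bar>t\<bar> * norm (A *v (B *v (x - y)))" by (subst e) simp
    also have "\<dots> \<le> 1 * norm (A *v (B *v (x - y)))" using t by (intro mult_right_mono) auto
    also have "\<dots> \<le> r * norm (B *v (x - y))" using normA by simp
    also have "\<dots> \<le> r * (r * norm (x - y))" using r0 normB by (intro mult_left_mono) auto
    finally have "norm (x - y) * (1 - r * r) \<le> 0" by (simp add: algebra_simps)
    moreover have "1 - r * r > 0" using r0 r1 by (simp add: mult_less_cancel_right_pos mult_strict_mono less_1_mult mult_le_one)
      (meson mult_left_le r1 le_less_trans less_imp_le)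
    ultimately have "norm (x - y) \<le> 0" by (simp add: mult_le_0_iff)
    then show "x = y" by simp
  qed
  then show ?thesis
    by (simp add: matrix_left_invertible_injective[symmetric] invertible_left_inverse)
qed

text \<open>Integration by parts shows that the matrix of the moments of u_i u_j is 2/l B (1 -
  tAB)^-1 times the integral. Contracting it with A gives the trace, up to cyclic order.\<close>

lemma second_moment:
  assumes t: "t \<in> {0..1}"
  shows "(LINT u|fock_mu l. sp u (A *v u) * exp (qexp 0 0 t 0 u))
    = 2 / of_real l * trace (matrix_inv (pathM t) ** (A ** B)) * (LINT u|fock_mu l. exp (qexp 0 0 t 0 u))"
proof -
  define N where "N = matrix_inv (pathM t)"
  define E where "E u = exp (qexp 0 0 t 0 u)" for u
  have zero: "(0::real) \<in> {0..1}" by simp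
  have inv: "N *v x - t *\<^sub>R (A *v (B *v (N *v x))) = x" for x
    using invertible_matrix_inv(3)[OF invertible_pathM[OF t], of x] by (simp add: N_def pathM_mult)
  have intE: "integrable (fock_mu l) E"
    unfolding E_def by (rule gauss_decay_integrable[OF l gauss_decay_qexp[OF t zero]])
  have intq: "integrable (fock_mu l) (\<lambda>u. (sp c u * sp u v) * E u)" for c v
    unfolding E_def by (intro integrable_qexp t zero subexp_mult subexp_sp subexp_sp_matrix)
  have mom: "(LINT u|fock_mu l. (sp c u * sp u v) * E u) = 2 / of_real l * sp c (B *v (N *v v)) * (LINT u|fock_mu l. E u)" for c v
  proof -
    \<comment> \<open>Chosen so that w - tABw = v. In the pairing of \<open>gradX\<close> with B w
      plus that of \<open>gradY\<close> with w, the conjugate of u then drops out by symmetry of B,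
      and - u^t v remains.\<close>
    define w where "w = N *v v"
    define f1 where "f1 u = (sp c (B *v w) + (0 + sp c u) * (of_real l / 2 * sp (gradX 0 t 0 u) (B *v w))) * E u" for u
    define f2 where "f2 u = ((0 + sp c u) * sp (gradY 0 0 u) w) * E u" for u
    have int: "integrable (fock_mu l) f1" "integrable (fock_mu l) f2"
      unfolding f1_def f2_def E_def
      by (intro integrable_qexp t zero subexp_add subexp_mult subexp_const subexp_sp subexp_grad)+
    have z: "(LINT u|fock_mu l. f1 u) = 0" "(LINT u|fock_mu l. f2 u) = 0"
      unfolding f1_def f2_def E_def by (rule ibp[OF t zero])+
    have "sp u v = - (sp (gradX 0 t 0 u) (B *v w) + sp (gradY 0 0 u) w)" for u
    proof -
      have "sp u v = sp u w - of_real t * sp u (A *v (B *v w))"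
        by (subst inv[of v, symmetric]) (simp add: w_def sp_simps)
      then show ?thesis
        using symA[of u "B *v w"] symB[of "vcnj u" w]
        by (simp add: gradX_def gradY_def sp_simps sp_commute)
    qed
    note uv = this
    have f1: "2 / of_real l * f1 u = 2 / of_real l * sp c (B *v w) * E u + sp c u * sp (gradX 0 t 0 u) (B *v w) * E u" for u
      using l by (simp add: f1_def field_simps)
    have e: "(sp c u * sp u v) * E u = 2 / of_real l * sp c (B *v w) * E u - 2 / of_real l * f1 u - f2 u" for u
      unfolding uv f1 f2_def by (simp only: add_0 distrib_right distrib_left mult_minus_right mult_minus_left mult.assoc minus_add_distrib)
        simp
    show ?thesis
      unfolding e by (simp add: int z intE w_def)
  qed
  have quad: "sp u (A *v u) * E u = (\<Sum>i\<in>UNIV. (sp (A *v axis i 1) u * sp u (axis i 1)) * E u)" for u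
  proof -
    have "sp (A *v axis i 1) u * sp u (axis i 1) = u $ i * (A *v u) $ i" for i
    proof -
      have "sp (A *v axis i 1) u = sp (axis i 1) (A *v u)"
        using symA[of u "axis i 1"] sp_commute[of "A *v axis i 1" u] by (rule trans[rotated])
      then show ?thesis
        unfolding sp_commute[of u "axis i 1"] sp_axis_left by simp
    qed
    then show ?thesis
      unfolding scalar_product_def[of u "A *v u"] sum_distrib_right by simp
  qed
  have tr: "(\<Sum>i\<in>UNIV. sp (A *v axis i 1) (B *v (N *v axis i 1))) = trace (N ** (A ** B))"
  proof -
    have "sp (A *v axis i 1) (B *v (N *v axis i 1)) = ((A ** B) ** N) $ i $ i" for i
    proof -
      have "sp (A *v axis i 1) (B *v (N *v axis i 1)) = sp (axis i 1) (A *v (B *v (N *v axis i 1)))"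
        using sp_commute[of "A *v axis i 1"] symA[of "B *v (N *v axis i 1)" "axis i 1"] by (rule trans)
      also have "\<dots> = (((A ** B) ** N) *v axis i 1) $ i"
        by (simp only: sp_axis_left matrix_vector_mul_assoc matrix_mul_assoc)
      finally show ?thesis
        unfolding matrix_vec_axis .
    qed
    then show ?thesis
      unfolding trace_mul_sym[of N] unfolding trace_def by simp
  qed
  have "(LINT u|fock_mu l. sp u (A *v u) * E u)
      = (\<Sum>i\<in>UNIV. LINT u|fock_mu l. (sp (A *v axis i 1) u * sp u (axis i 1)) * E u)"
    unfolding quad by (rule Bochner_Integration.integral_sum) (rule intq)
  also have "\<dots> = 2 / of_real l * trace (N ** (A ** B)) * (LINT u|fock_mu l. E u)"
    unfolding mom tr[symmetric] by (simp add: sum_distrib_left sum_distrib_right)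
  finally show ?thesis by (simp add: E_def N_def)
qed

text \<open>Without A the integrand is an antiholomorphic function times the weight, so its
  conjugate falls under the mean value property.\<close>

lemma antiholomorphic_mean: "(LINT u|fock_mu l. exp (qexp 0 0 0 0 u)) = 1"
proof -
  define f where "f u = exp (of_real l / 4 * sp u (mcnj B *v u))" for u
  have "cnj (exp (qexp 0 0 0 0 u)) = f u * of_real (fock_weight l u)" for u
    unfolding f_def fock_weight_exp
    by (simp add: exp_cnj qexp_def cnj_sp vcnj_matrix vcnj_simps sp_simps sp_commute[of "vcnj u" u]
        flip: exp_add)
  note e = this
  have E: "integrable (fock_mu l) (\<lambda>u. exp (qexp 0 0 0 0 u))"
    by (rule gauss_decay_integrable[OF l gauss_decay_qexp]) auto
  have "(LINT u|fock_mu l. f u * of_real (fock_weight l u)) = f 0"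
  proof (rule fock_mean_value[OF l])
    show "holomorphic_cn f"
      unfolding f_def by (intro holomorphic_cn_exp holomorphic_cn_mult holomorphic_cn_const holomorphic_cn_sp_matrix)
    show "integrable (fock_mu l) (\<lambda>u. f u * of_real (fock_weight l u))"
      unfolding e[symmetric] by (rule integrable_cnj[OF E])
  qed
  moreover have "cnj (LINT u|fock_mu l. exp (qexp 0 0 0 0 u)) = (LINT u|fock_mu l. cnj (exp (qexp 0 0 0 0 u)))"
    by (rule Bochner_Integration.integral_cnj[symmetric])
  ultimately have "cnj (LINT u|fock_mu l. exp (qexp 0 0 0 0 u)) = 1"
    unfolding e by (simp add: f_def sp_simps)
  then show ?thesis by (metis complex_cnj_cnj complex_cnj_one)
qed

text \<open>Along \<open>t \<mapsto> tA\<close> the logarithmic derivatives of the squared integral and of \<open>det (1 - tAB)\<close>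
  cancel.\<close>

lemma gauss_integral_det:
  "(LINT u|fock_mu l. exp (qexp 0 0 1 0 u))\<^sup>2 * det (mat 1 - A ** B) = 1"
proof -
  define I where "I t = (LINT u|fock_mu l. exp (qexp 0 0 t 0 u))" for t
  define D where "D t = det (pathM t)" for t
  define T where "T t = trace (matrix_inv (pathM t) ** (A ** B))" for t
  have zero: "(0::real) \<in> {0..1}" by simp
  have I': "(I has_vector_derivative T t / 2 * I t) (at t within {0..1})" if t: "t \<in> {0..1}" for t
  proof -
    define Q where "Q = qexp 0 0 0 0"
    have q: "qexp 0 0 s 0 u = Q u + of_real s * (of_real l / 4 * sp u (A *v u))" for s u
      by (simp add: Q_def qexp_def algebra_simps)
    have "(I has_vector_derivative (LINT u|fock_mu l. (of_real l / 4 * sp u (A *v u)) * exp (qexp 0 0 t 0 u))) (at t within {0..1})"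
      unfolding I_def q
    proof (rule has_vector_derivative_integral_exp[OF l decay_pos _ _ _ t])
      show "continuous_on UNIV Q" unfolding Q_def by (rule continuous_qexp)
      show "subexp (\<lambda>u. of_real l / 4 * sp u (A *v u))"
        by (intro subexp_mult subexp_const subexp_quadratic)
      show "cmod (exp (Q u + of_real s * (of_real l / 4 * sp u (A *v u))))
        \<le> exp (l / 2 * (norm (0 :: complex ^ 'n) + norm (0 :: complex ^ 'n)) * (1 + norm u) - l / 2 * (1 - r) * (norm u)\<^sup>2)" if "s \<in> {0..1}" for s u
        unfolding q[symmetric] by (rule qexp_bound[OF that zero])
    qed
    moreover have "(LINT u|fock_mu l. (of_real l / 4 * sp u (A *v u)) * exp (qexp 0 0 t 0 u)) = T t / 2 * I t"
      using second_moment[OF t] l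
      by (simp add: mult.assoc T_def I_def)
    ultimately show ?thesis by (simp only:)
  qed
  have D': "(D has_vector_derivative - (D t * T t)) (at t within {0..1})" if t: "t \<in> {0..1}" for t
  proof -
    have "(D has_vector_derivative D t * trace (matrix_inv (pathM t) ** (- (A ** B)))) (at t within {0..1})"
      using det_line_has_vector_derivative[of "mat 1" t "- (A ** B)" "{0..1}"] invertible_pathM[OF t]
      unfolding D_def pathM_def by simp
    moreover have "trace (matrix_inv (pathM t) ** (- (A ** B))) = - T t"
      by (simp add: T_def matrix_mul_uminus trace_def sum_negf)
    ultimately show ?thesis by simp
  qed
  define K where "K t = I t * I t * D t" for t
  have "K 1 = K 0"
  proof (rule constant_on_unit_interval)
    fix t :: real assume t: "t \<in> {0..1}"
    show "(K has_vector_derivative 0) (at t within {0..1})"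
      unfolding K_def
      by (rule has_vector_derivative_eq_rhs[OF has_vector_derivative_mult[OF has_vector_derivative_mult[OF I'[OF t] I'[OF t]] D'[OF t]]])
        (simp add: field_simps)
  qed
  moreover have "K 0 = 1"
    by (simp add: K_def I_def D_def pathM_def antiholomorphic_mean)
  ultimately show ?thesis
    by (simp add: K_def I_def D_def pathM_def power2_eq_square)
qed

end

section \<open>Boundedness of the kernel operators\<close>

definition fock_L2 :: "real \<Rightarrow> (complex ^ 'n::finite \<Rightarrow> complex) set" where
  "fock_L2 l = {f. f \<in> borel_measurable borel \<and>
     integrable (fock_mu l) (\<lambda>z. (cmod (f z))\<^sup>2 * fock_weight l z)}"

lemma fock_subset_L2: "f \<in> fock l \<Longrightarrow> f \<in> fock_L2 l"
  by (auto simp: fock_def fock_L2_def holomorphic_cn_measurable)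

lemma fock_weight_split: "fock_weight l z = fock_weight (l / 2) z * fock_weight (l / 2) z"
  by (simp add: fock_weight_def flip: exp_add)

lemma fock_L2_mult_integrable:
  assumes "f \<in> fock_L2 l" "g \<in> fock_L2 l"
  shows "integrable (fock_mu l) (\<lambda>z. f z * g z * of_real (fock_weight l z))"
proof (rule Bochner_Integration.integrable_bound)
  show "integrable (fock_mu l) (\<lambda>z. (cmod (f z))\<^sup>2 * fock_weight l z + (cmod (g z))\<^sup>2 * fock_weight l z)"
    using assms by (auto simp: fock_L2_def)
  have [measurable]: "f \<in> borel_measurable borel" "g \<in> borel_measurable borel"
    using assms by (auto simp: fock_L2_def)
  show "(\<lambda>z. f z * g z * of_real (fock_weight l z)) \<in> borel_measurable (fock_mu l)"
    unfolding borel_measurable_fock_mu by measurable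
  show "AE z in fock_mu l. norm (f z * g z * of_real (fock_weight l z))
      \<le> norm ((cmod (f z))\<^sup>2 * fock_weight l z + (cmod (g z))\<^sup>2 * fock_weight l z)"
  proof (rule AE_I2)
    fix z :: "complex ^ 'a"
    have "2 * (cmod (f z) * cmod (g z)) \<le> (cmod (f z))\<^sup>2 + (cmod (g z))\<^sup>2"
      using sum_squares_bound[of "cmod (f z)" "cmod (g z)"] by simp
    moreover have "0 \<le> cmod (f z) * cmod (g z)" by simp
    ultimately have "cmod (f z) * cmod (g z) \<le> (cmod (f z))\<^sup>2 + (cmod (g z))\<^sup>2" by linarith
    then have "cmod (f z) * cmod (g z) * fock_weight l z \<le> ((cmod (f z))\<^sup>2 + (cmod (g z))\<^sup>2) * fock_weight l z"
      by (intro mult_right_mono) auto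
    also have "\<dots> \<le> norm ((cmod (f z))\<^sup>2 * fock_weight l z + (cmod (g z))\<^sup>2 * fock_weight l z)"
      by (simp add: distrib_right)
    finally show "norm (f z * g z * of_real (fock_weight l z)) \<le> norm ((cmod (f z))\<^sup>2 * fock_weight l z + (cmod (g z))\<^sup>2 * fock_weight l z)"
      by (simp add: norm_mult)
  qed
qed

lemma nn_integral_fock_mu_translate:
  fixes f :: "complex ^ 'n::finite \<Rightarrow> ennreal"
  assumes [measurable]: "f \<in> borel_measurable borel"
  shows "(\<integral>\<^sup>+z. f (c + z) \<partial>fock_mu l) = (\<integral>\<^sup>+z. f z \<partial>fock_mu l)"
  by (simp add: nn_integral_fock_mu nn_integral_lborel_translate)

text \<open>The half-weights turn the kernel into one that is integrable in each variable, uniformly in the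
  other one.\<close>

definition abs_kernel :: "real \<Rightarrow> complex ^ ('n::finite + 'n) ^ ('n + 'n) \<Rightarrow> complex ^ 'n \<Rightarrow> complex ^ 'n \<Rightarrow> real" where
  "abs_kernel l k z w = cmod (gauss_kernel l k z w) * fock_weight (l / 2) z * fock_weight (l / 2) w"

lemma continuous_gauss_kernel:
  "continuous_on S f \<Longrightarrow> continuous_on S g \<Longrightarrow> continuous_on S (\<lambda>x. gauss_kernel l k (f x) (g x))"
  unfolding gauss_kernel_exp gauss_exp_def by (intro continuous_intros) auto

lemma borel_measurable_pair_continuous:
  fixes f :: "complex ^ 'n::finite \<Rightarrow> complex ^ 'n \<Rightarrow> complex"
  assumes "continuous_on UNIV (\<lambda>p. f (fst p) (snd p))"
  shows "(\<lambda>p. f (fst p) (snd p)) \<in> borel_measurable (borel \<Otimes>\<^sub>M borel)"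
  using borel_measurable_continuous_onI[OF assms] by (simp add: borel_prod)

lemma measurable_gauss_kernel[measurable]:
  "(\<lambda>p. gauss_kernel l k (fst p) (snd p)) \<in> borel_measurable (borel \<Otimes>\<^sub>M borel)"
  "gauss_kernel l k z \<in> borel_measurable borel"
  "(\<lambda>z. gauss_kernel l k z w) \<in> borel_measurable borel"
  by (intro borel_measurable_pair_continuous borel_measurable_continuous_onI continuous_gauss_kernel
      continuous_intros)+

lemma measurable_abs_kernel[measurable]:
  "(\<lambda>p. abs_kernel l k (fst p) (snd p)) \<in> borel_measurable (borel \<Otimes>\<^sub>M borel)"
  "abs_kernel l k z \<in> borel_measurable borel"
  "(\<lambda>z. abs_kernel l k z w) \<in> borel_measurable borel"
  unfolding abs_kernel_def by measurable

lemma abs_kernel_nonneg: "0 \<le> abs_kernel l k z w"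
  by (simp add: abs_kernel_def)

lemma abs_kernel_schur:
  fixes k :: "complex ^ ('n::finite + 'n) ^ ('n + 'n)"
  assumes l: "0 < l" and k: "k \<in> symp_S"
  obtains C :: real where "C \<ge> 0"
    "\<And>w. (\<integral>\<^sup>+z. ennreal (abs_kernel l k z w) \<partial>fock_mu l) \<le> ennreal C"
    "\<And>z. (\<integral>\<^sup>+w. ennreal (abs_kernel l k z w) \<partial>fock_mu l) \<le> ennreal C"
proof -
  obtain k' where k': "k' \<in> symp_S" "k ** k' = mat 1" using inverse_symp_S[OF k] by metis
  obtain d where d: "d > 0" "\<And>z w. abs_kernel l k z w \<le> exp (- d * (norm (z - act1 k w (vcnj w)))\<^sup>2)"
    using gauss_kernel_bound_left[OF l k] unfolding abs_kernel_def by blast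
  obtain d' where d': "d' > 0" "\<And>z w. abs_kernel l k z w \<le> exp (- d' * (norm (w - act1 k' z (vcnj z)))\<^sup>2)"
    using gauss_kernel_bound_right[OF l k k'] unfolding abs_kernel_def by blast
  define C where "C e = (l / (2 * e)) ^ CARD('n)" for e :: real
  have g: "(\<integral>\<^sup>+z. ennreal (exp (- e * (norm (z - c))\<^sup>2)) \<partial>fock_mu l) = ennreal (C e)" if e: "e > 0" for e and c :: "complex ^ 'n"
  proof -
    have "(\<integral>\<^sup>+z. ennreal (exp (- e * (norm (z - c))\<^sup>2)) \<partial>fock_mu l)
        = (\<integral>\<^sup>+z. ennreal (exp (- e * (norm (z :: complex ^ 'n))\<^sup>2)) \<partial>fock_mu l)"
      using nn_integral_fock_mu_translate[where f = "\<lambda>z. ennreal (exp (- e * (norm (z :: complex ^ 'n))\<^sup>2))" and c = "- c" and l = l]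
      by simp
    also have "\<dots> = ennreal (C e)"
      using fock_mu_gaussian[OF l e, where 'n = 'n] l e
      by (subst nn_integral_eq_integral) (auto simp: has_bochner_integral_iff C_def)
    finally show ?thesis .
  qed
  have "(\<integral>\<^sup>+z. ennreal (abs_kernel l k z w) \<partial>fock_mu l) \<le> ennreal (C d)" for w
    unfolding g[OF d(1), of "act1 k w (vcnj w)", symmetric] by (intro nn_integral_mono ennreal_leI d)
  moreover have "(\<integral>\<^sup>+w. ennreal (abs_kernel l k z w) \<partial>fock_mu l) \<le> ennreal (C d')" for z
    unfolding g[OF d'(1), of "act1 k' z (vcnj z)", symmetric] by (intro nn_integral_mono ennreal_leI d')
  moreover have "C d \<ge> 0" "C d' \<ge> 0" using l d(1) d'(1) by (auto simp: C_def)
  ultimately show thesis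
    by (intro that[of "max (C d) (C d')"])
      (auto intro: order_trans[OF _ ennreal_leI[OF max.cobounded1]] order_trans[OF _ ennreal_leI[OF max.cobounded2]])
qed

text \<open>In \<open>abs_kernel\<close> the half-weight of z is constant in w, so squaring the
  bound leaves a translated Gaussian in w of rate 2 d.\<close>

lemma gauss_kernel_L2:
  assumes l: "0 < l" and k: "k \<in> symp_S"
  shows "gauss_kernel l k z \<in> fock_L2 l"
proof -
  obtain k' where k': "k' \<in> symp_S" "k ** k' = mat 1" using inverse_symp_S[OF k] by metis
  obtain d where d: "d > 0" "\<And>z w. abs_kernel l k z w \<le> exp (- d * (norm (w - act1 k' z (vcnj z)))\<^sup>2)"
    using gauss_kernel_bound_right[OF l k k'] unfolding abs_kernel_def by blast
  define c where "c = act1 k' z (vcnj z)"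
  have i: "integrable (fock_mu l) (\<lambda>w. exp (- (2 * d) * (norm (w - c))\<^sup>2))"
    using fock_mu_gaussian[OF l, of "2 * d"] d(1)
      fock_mu_translate_integral(1)[of "\<lambda>w. exp (- (2 * d) * (norm (w - c))\<^sup>2)" l c]
    by (auto simp: has_bochner_integral_iff)
  have "integrable (fock_mu l) (\<lambda>w. (cmod (gauss_kernel l k z w))\<^sup>2 * fock_weight l w)"
  proof (rule Bochner_Integration.integrable_bound[OF integrable_mult_left[OF i, of "1 / (fock_weight (l / 2) z)\<^sup>2"]])
    show "(\<lambda>w. (cmod (gauss_kernel l k z w))\<^sup>2 * fock_weight l w) \<in> borel_measurable (fock_mu l)"
      unfolding borel_measurable_fock_mu by measurable
    show "AE w in fock_mu l. norm ((cmod (gauss_kernel l k z w))\<^sup>2 * fock_weight l w)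
        \<le> norm (exp (- (2 * d) * (norm (w - c))\<^sup>2) * (1 / (fock_weight (l / 2) z)\<^sup>2))"
    proof (rule AE_I2)
      fix w
      have "(abs_kernel l k z w)\<^sup>2 \<le> (exp (- d * (norm (w - c))\<^sup>2))\<^sup>2"
        using d(2)[of z w] by (intro power_mono abs_kernel_nonneg) (simp add: c_def)
      also have "\<dots> = exp (- (2 * d) * (norm (w - c))\<^sup>2)"
        by (simp flip: exp_double)
      finally have "(cmod (gauss_kernel l k z w))\<^sup>2 * fock_weight l w * (fock_weight (l / 2) z)\<^sup>2
          \<le> exp (- (2 * d) * (norm (w - c))\<^sup>2)"
        by (simp add: abs_kernel_def power_mult_distrib fock_weight_split[of l w] power2_eq_square mult_ac)
      then have "(cmod (gauss_kernel l k z w))\<^sup>2 * fock_weight l w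
          \<le> exp (- (2 * d) * (norm (w - c))\<^sup>2) / (fock_weight (l / 2) z)\<^sup>2"
        by (subst pos_le_divide_eq) (auto simp: fock_weight_def)
      then show "norm ((cmod (gauss_kernel l k z w))\<^sup>2 * fock_weight l w)
        \<le> norm (exp (- (2 * d) * (norm (w - c))\<^sup>2) * (1 / (fock_weight (l / 2) z)\<^sup>2))"
        by simp
    qed
  qed
  then show ?thesis by (simp add: fock_L2_def)
qed

lemma gauss_kernel_integrable:
  assumes "0 < l" "k \<in> symp_S" "f \<in> fock_L2 l"
  shows "integrable (fock_mu l) (\<lambda>w. gauss_kernel l k z w * f w * of_real (fock_weight l w))"
  by (intro fock_L2_mult_integrable gauss_kernel_L2 assms)

lemma fock_L2_nn_integral:
  assumes "f \<in> fock_L2 l"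
  shows "(\<integral>\<^sup>+z. ennreal ((cmod (f z) * fock_weight (l / 2) z)\<^sup>2) \<partial>fock_mu l) < \<infinity>"
proof -
  have e: "(cmod (f z) * fock_weight (l / 2) z)\<^sup>2 = (cmod (f z))\<^sup>2 * fock_weight l z" for z
    by (simp add: power_mult_distrib fock_weight_split[of l z] power2_eq_square)
  have "(\<integral>\<^sup>+z. ennreal ((cmod (f z))\<^sup>2 * fock_weight l z) \<partial>fock_mu l)
      = ennreal (LINT z|fock_mu l. (cmod (f z))\<^sup>2 * fock_weight l z)"
    using assms by (intro nn_integral_eq_integral) (auto simp: fock_L2_def)
  then show ?thesis unfolding e by simp
qed

text \<open>This licenses the exchanges of integrals in the composition and adjoint formulas. The
  product of f and g is bounded by the sum of their squares; in each summand the variable that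
  occurs only in the kernel is integrated first.\<close>

lemma gauss_kernel_bilinear_integrable:
  fixes f g :: "complex ^ 'n::finite \<Rightarrow> complex"
  assumes l: "0 < l" and k: "k \<in> symp_S" and f: "f \<in> fock_L2 l" and g: "g \<in> fock_L2 l"
  shows "integrable (fock_mu l \<Otimes>\<^sub>M fock_mu l)
    (\<lambda>(z, w). (g z * of_real (fock_weight l z)) * (gauss_kernel l k z w * f w * of_real (fock_weight l w)))"
proof (rule integrableI_bounded)
  obtain C where C: "C \<ge> 0"
    "\<And>w. (\<integral>\<^sup>+z. ennreal (abs_kernel l k z w) \<partial>fock_mu l) \<le> ennreal C"
    "\<And>z. (\<integral>\<^sup>+w. ennreal (abs_kernel l k z w) \<partial>fock_mu l) \<le> ennreal C"
    using abs_kernel_schur[OF l k] by metis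
  interpret F: sigma_finite_measure "fock_mu l :: (complex ^ 'n) measure"
    by (rule sigma_finite_fock_mu)
  interpret P: pair_sigma_finite "fock_mu l :: (complex ^ 'n) measure" "fock_mu l :: (complex ^ 'n) measure" ..
  have [measurable]: "f \<in> borel_measurable borel" "g \<in> borel_measurable borel"
    using f g by (auto simp: fock_L2_def)
  have sets: "sets (fock_mu l \<Otimes>\<^sub>M fock_mu l :: ((complex ^ 'n) \<times> (complex ^ 'n)) measure) = sets (borel \<Otimes>\<^sub>M borel)"
    by (rule sets_pair_measure_cong) simp_all
  have bm: "borel_measurable (fock_mu l \<Otimes>\<^sub>M fock_mu l :: ((complex ^ 'n) \<times> (complex ^ 'n)) measure) = borel_measurable (borel \<Otimes>\<^sub>M borel)"
    by (rule measurable_cong_sets[OF sets refl])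
  show "(\<lambda>(z, w). (g z * of_real (fock_weight l z)) * (gauss_kernel l k z w * f w * of_real (fock_weight l w)))
      \<in> borel_measurable (fock_mu l \<Otimes>\<^sub>M fock_mu l)"
    unfolding bm case_prod_beta' by measurable
  define G where "G z = (cmod (g z) * fock_weight (l / 2) z)\<^sup>2" for z
  define F where "F z = (cmod (f z) * fock_weight (l / 2) z)\<^sup>2" for z
  have [measurable]: "G \<in> borel_measurable borel" "F \<in> borel_measurable borel"
    unfolding G_def[abs_def] F_def[abs_def] by measurable
  have m1: "(\<lambda>p. ennreal (abs_kernel l k (fst p) (snd p)) * ennreal (G (fst p))) \<in> borel_measurable (fock_mu l \<Otimes>\<^sub>M fock_mu l)"
    and m2: "(\<lambda>p. ennreal (abs_kernel l k (fst p) (snd p)) * ennreal (F (snd p))) \<in> borel_measurable (fock_mu l \<Otimes>\<^sub>M fock_mu l)"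
    by (subst measurable_cong_sets[OF sets refl], measurable)+
  have bnd: "norm ((g z * of_real (fock_weight l z)) * (gauss_kernel l k z w * f w * of_real (fock_weight l w)))
      \<le> abs_kernel l k z w * G z + abs_kernel l k z w * F w" for z w
  proof -
    define x where "x = cmod (g z) * fock_weight (l / 2) z"
    define y where "y = cmod (f w) * fock_weight (l / 2) w"
    have "2 * (x * y) \<le> x\<^sup>2 + y\<^sup>2" using sum_squares_bound[of x y] by simp
    moreover have "0 \<le> x * y" by (simp add: x_def y_def)
    ultimately have "x * y \<le> x\<^sup>2 + y\<^sup>2" by linarith
    then have "abs_kernel l k z w * (x * y) \<le> abs_kernel l k z w * (x\<^sup>2 + y\<^sup>2)"
      by (intro mult_left_mono abs_kernel_nonneg)
    moreover have "norm ((g z * of_real (fock_weight l z)) * (gauss_kernel l k z w * f w * of_real (fock_weight l w)))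
        = abs_kernel l k z w * (x * y)"
      by (simp add: norm_mult x_def y_def abs_kernel_def fock_weight_split[of l z] fock_weight_split[of l w] mult_ac)
    ultimately show ?thesis by (simp add: G_def F_def x_def y_def distrib_left)
  qed
  have "(\<integral>\<^sup>+p. ennreal (norm (case p of (z, w) \<Rightarrow> (g z * of_real (fock_weight l z)) * (gauss_kernel l k z w * f w * of_real (fock_weight l w)))) \<partial>(fock_mu l \<Otimes>\<^sub>M fock_mu l))
    \<le> (\<integral>\<^sup>+p. ennreal (abs_kernel l k (fst p) (snd p)) * ennreal (G (fst p)) + ennreal (abs_kernel l k (fst p) (snd p)) * ennreal (F (snd p)) \<partial>(fock_mu l \<Otimes>\<^sub>M fock_mu l))"
  proof (rule nn_integral_mono)
    fix p :: "(complex ^ 'n) \<times> (complex ^ 'n)"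
    have "ennreal (abs_kernel l k (fst p) (snd p)) * ennreal (G (fst p)) + ennreal (abs_kernel l k (fst p) (snd p)) * ennreal (F (snd p))
        = ennreal (abs_kernel l k (fst p) (snd p) * G (fst p) + abs_kernel l k (fst p) (snd p) * F (snd p))"
      by (simp add: ennreal_mult[symmetric] ennreal_plus[symmetric] abs_kernel_nonneg G_def F_def del: ennreal_plus)
    then show "ennreal (norm (case p of (z, w) \<Rightarrow> (g z * of_real (fock_weight l z)) * (gauss_kernel l k z w * f w * of_real (fock_weight l w))))
      \<le> ennreal (abs_kernel l k (fst p) (snd p)) * ennreal (G (fst p)) + ennreal (abs_kernel l k (fst p) (snd p)) * ennreal (F (snd p))"
      using bnd[of "fst p" "snd p"] by (simp add: case_prod_beta' ennreal_leI)
  qed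
  also have "\<dots> = (\<integral>\<^sup>+p. ennreal (abs_kernel l k (fst p) (snd p)) * ennreal (G (fst p)) \<partial>(fock_mu l \<Otimes>\<^sub>M fock_mu l))
      + (\<integral>\<^sup>+p. ennreal (abs_kernel l k (fst p) (snd p)) * ennreal (F (snd p)) \<partial>(fock_mu l \<Otimes>\<^sub>M fock_mu l))"
    by (rule nn_integral_add[OF m1 m2])
  also have "(\<integral>\<^sup>+p. ennreal (abs_kernel l k (fst p) (snd p)) * ennreal (G (fst p)) \<partial>(fock_mu l \<Otimes>\<^sub>M fock_mu l))
      = (\<integral>\<^sup>+z. \<integral>\<^sup>+w. ennreal (abs_kernel l k z w) * ennreal (G z) \<partial>fock_mu l \<partial>fock_mu l)"
    by (subst F.nn_integral_fst[OF m1, symmetric]) simp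
  also have "\<dots> = (\<integral>\<^sup>+z. (\<integral>\<^sup>+w. ennreal (abs_kernel l k z w) \<partial>fock_mu l) * ennreal (G z) \<partial>fock_mu l)"
    by (intro nn_integral_cong nn_integral_multc) (unfold borel_measurable_fock_mu, measurable)
  also have "\<dots> \<le> (\<integral>\<^sup>+z. ennreal C * ennreal (G z) \<partial>fock_mu l)"
    by (intro nn_integral_mono mult_right_mono C) auto
  also have "\<dots> = ennreal C * (\<integral>\<^sup>+z. ennreal (G z) \<partial>fock_mu l)"
    by (rule nn_integral_cmult) (unfold borel_measurable_fock_mu, measurable)
  also have "(\<integral>\<^sup>+p. ennreal (abs_kernel l k (fst p) (snd p)) * ennreal (F (snd p)) \<partial>(fock_mu l \<Otimes>\<^sub>M fock_mu l))
      = (\<integral>\<^sup>+w. \<integral>\<^sup>+z. ennreal (abs_kernel l k z w) * ennreal (F w) \<partial>fock_mu l \<partial>fock_mu l)"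
    by (subst P.nn_integral_snd[symmetric]) (use m2 in \<open>simp_all add: case_prod_beta'\<close>)
  also have "\<dots> = (\<integral>\<^sup>+w. (\<integral>\<^sup>+z. ennreal (abs_kernel l k z w) \<partial>fock_mu l) * ennreal (F w) \<partial>fock_mu l)"
    by (intro nn_integral_cong nn_integral_multc) (unfold borel_measurable_fock_mu, measurable)
  also have "\<dots> \<le> (\<integral>\<^sup>+z. ennreal C * ennreal (F z) \<partial>fock_mu l)"
    by (intro nn_integral_mono mult_right_mono C) auto
  also have "\<dots> = ennreal C * (\<integral>\<^sup>+z. ennreal (F z) \<partial>fock_mu l)"
    by (rule nn_integral_cmult) (unfold borel_measurable_fock_mu, measurable)
  also have "ennreal C * (\<integral>\<^sup>+z. ennreal (G z) \<partial>fock_mu l) + ennreal C * (\<integral>\<^sup>+z. ennreal (F z) \<partial>fock_mu l) < \<infinity>"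
    using fock_L2_nn_integral[OF f] fock_L2_nn_integral[OF g]
    by (simp add: F_def G_def ennreal_mult_less_top)
  finally show "(\<integral>\<^sup>+p. ennreal (norm (case p of (z, w) \<Rightarrow> (g z * of_real (fock_weight l z)) * (gauss_kernel l k z w * f w * of_real (fock_weight l w)))) \<partial>(fock_mu l \<Otimes>\<^sub>M fock_mu l)) < \<infinity>"
    by (simp add: add_mono)
qed

text \<open>Schur's test: one row integral bounds the factor produced by the Cauchy-Schwarz
  inequality, one column integral the double integral that is left.\<close>

lemma op_of_gauss_kernel_L2:
  fixes f :: "complex ^ 'n::finite \<Rightarrow> complex"
  assumes l: "0 < l" and k: "k \<in> symp_S" and f: "f \<in> fock_L2 l"
  shows "(\<integral>\<^sup>+z. ennreal ((cmod (op_of_kernel l (gauss_kernel l k) f z))\<^sup>2 * fock_weight l z) \<partial>fock_mu l) < \<infinity>"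
proof -
  obtain C where C: "C \<ge> 0"
    "\<And>w. (\<integral>\<^sup>+z. ennreal (abs_kernel l k z w) \<partial>fock_mu l) \<le> ennreal C"
    "\<And>z. (\<integral>\<^sup>+w. ennreal (abs_kernel l k z w) \<partial>fock_mu l) \<le> ennreal C"
    using abs_kernel_schur[OF l k] by metis
  interpret F: sigma_finite_measure "fock_mu l :: (complex ^ 'n) measure"
    by (rule sigma_finite_fock_mu)
  interpret P: pair_sigma_finite "fock_mu l :: (complex ^ 'n) measure" "fock_mu l :: (complex ^ 'n) measure" ..
  have [measurable]: "f \<in> borel_measurable borel"
    using f by (auto simp: fock_L2_def)
  define \<phi> where "\<phi> w = cmod (f w) * fock_weight (l / 2) w" for w
  have [measurable]: "\<phi> \<in> borel_measurable borel" unfolding \<phi>_def[abs_def] by measurable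
  have \<phi>0: "\<phi> w \<ge> 0" for w by (simp add: \<phi>_def)
  define T where "T = op_of_kernel l (gauss_kernel l k) f"
  have 1: "ennreal (cmod (T z) * fock_weight (l / 2) z) \<le> (\<integral>\<^sup>+w. ennreal (abs_kernel l k z w * \<phi> w) \<partial>fock_mu l)" for z
  proof -
    have "ennreal (cmod (T z)) \<le> (\<integral>\<^sup>+w. ennreal (norm (gauss_kernel l k z w * f w * of_real (fock_weight l w))) \<partial>fock_mu l)"
      unfolding T_def op_of_kernel_def by (intro integral_norm_bound_ennreal gauss_kernel_integrable l k f)
    then have "ennreal (fock_weight (l / 2) z) * ennreal (cmod (T z)) \<le> ennreal (fock_weight (l / 2) z) * (\<integral>\<^sup>+w. ennreal (norm (gauss_kernel l k z w * f w * of_real (fock_weight l w))) \<partial>fock_mu l)"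
      by (intro mult_left_mono) auto
    also have "\<dots> = (\<integral>\<^sup>+w. ennreal (fock_weight (l / 2) z) * ennreal (norm (gauss_kernel l k z w * f w * of_real (fock_weight l w))) \<partial>fock_mu l)"
      by (rule nn_integral_cmult[symmetric]) (unfold borel_measurable_fock_mu, measurable)
    also have "\<dots> = (\<integral>\<^sup>+w. ennreal (abs_kernel l k z w * \<phi> w) \<partial>fock_mu l)"
      by (intro nn_integral_cong)
        (simp add: abs_kernel_def \<phi>_def norm_mult ennreal_mult[symmetric] fock_weight_split[of l] mult_ac)
    finally show ?thesis by (simp add: ennreal_mult[symmetric] mult.commute)
  qed
  have 2: "ennreal ((cmod (T z))\<^sup>2 * fock_weight l z) \<le> ennreal C * (\<integral>\<^sup>+w. ennreal (abs_kernel l k z w) * ennreal ((\<phi> w)\<^sup>2) \<partial>fock_mu l)" for z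
  proof -
    have "ennreal ((cmod (T z))\<^sup>2 * fock_weight l z) = (ennreal (cmod (T z) * fock_weight (l / 2) z))\<^sup>2"
      by (subst ennreal_power) (simp_all add: power_mult_distrib fock_weight_split[of l z] power2_eq_square)
    also have "\<dots> \<le> (\<integral>\<^sup>+w. ennreal (abs_kernel l k z w * \<phi> w) \<partial>fock_mu l)\<^sup>2"
      by (intro power_mono 1) auto
    \<comment> \<open>The kernel is split into two square roots, and only one of them is paired with
      \<phi>.\<close>
    also have "(\<integral>\<^sup>+w. ennreal (abs_kernel l k z w * \<phi> w) \<partial>fock_mu l)
        = (\<integral>\<^sup>+w. ennreal (sqrt (abs_kernel l k z w)) * ennreal (sqrt (abs_kernel l k z w) * \<phi> w) \<partial>fock_mu l)"
      by (intro nn_integral_cong)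
        (simp add: ennreal_mult[symmetric] abs_kernel_nonneg \<phi>0 mult.assoc[symmetric])
    also have "(\<dots>)\<^sup>2 \<le> (\<integral>\<^sup>+w. (ennreal (sqrt (abs_kernel l k z w)))\<^sup>2 \<partial>fock_mu l)
        * (\<integral>\<^sup>+w. (ennreal (sqrt (abs_kernel l k z w) * \<phi> w))\<^sup>2 \<partial>fock_mu l)"
      by (rule Cauchy_Schwarz_nn_integral) (unfold borel_measurable_fock_mu, measurable)
    also have "\<dots> = (\<integral>\<^sup>+w. ennreal (abs_kernel l k z w) \<partial>fock_mu l)
        * (\<integral>\<^sup>+w. ennreal (abs_kernel l k z w) * ennreal ((\<phi> w)\<^sup>2) \<partial>fock_mu l)"
      by (simp add: ennreal_power abs_kernel_nonneg \<phi>0 power_mult_distrib ennreal_mult[symmetric])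
    also have "\<dots> \<le> ennreal C * (\<integral>\<^sup>+w. ennreal (abs_kernel l k z w) * ennreal ((\<phi> w)\<^sup>2) \<partial>fock_mu l)"
      by (intro mult_right_mono C) auto
    finally show ?thesis .
  qed
  have sets: "sets (fock_mu l \<Otimes>\<^sub>M fock_mu l :: ((complex ^ 'n) \<times> (complex ^ 'n)) measure) = sets (borel \<Otimes>\<^sub>M borel)"
    by (rule sets_pair_measure_cong) simp_all
  have m: "(\<lambda>p. ennreal (abs_kernel l k (fst p) (snd p)) * ennreal ((\<phi> (snd p))\<^sup>2)) \<in> borel_measurable (fock_mu l \<Otimes>\<^sub>M fock_mu l)"
    by (subst measurable_cong_sets[OF sets refl], measurable)
  have m': "(\<lambda>z. \<integral>\<^sup>+w. ennreal (abs_kernel l k z w) * ennreal ((\<phi> w)\<^sup>2) \<partial>fock_mu l) \<in> borel_measurable (fock_mu l)"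
    using F.borel_measurable_nn_integral_fst[OF m] by simp
  have "(\<integral>\<^sup>+z. ennreal ((cmod (T z))\<^sup>2 * fock_weight l z) \<partial>fock_mu l)
      \<le> (\<integral>\<^sup>+z. ennreal C * (\<integral>\<^sup>+w. ennreal (abs_kernel l k z w) * ennreal ((\<phi> w)\<^sup>2) \<partial>fock_mu l) \<partial>fock_mu l)"
    by (intro nn_integral_mono 2)
  also have "\<dots> = ennreal C * (\<integral>\<^sup>+z. \<integral>\<^sup>+w. ennreal (abs_kernel l k z w) * ennreal ((\<phi> w)\<^sup>2) \<partial>fock_mu l \<partial>fock_mu l)"
    by (rule nn_integral_cmult[OF m'])
  also have "(\<integral>\<^sup>+z. \<integral>\<^sup>+w. ennreal (abs_kernel l k z w) * ennreal ((\<phi> w)\<^sup>2) \<partial>fock_mu l \<partial>fock_mu l)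
      = (\<integral>\<^sup>+w. \<integral>\<^sup>+z. ennreal (abs_kernel l k z w) * ennreal ((\<phi> w)\<^sup>2) \<partial>fock_mu l \<partial>fock_mu l)"
    by (rule P.Fubini'[symmetric]) (use m in \<open>simp add: case_prod_beta'\<close>)
  also have "\<dots> = (\<integral>\<^sup>+w. (\<integral>\<^sup>+z. ennreal (abs_kernel l k z w) \<partial>fock_mu l) * ennreal ((\<phi> w)\<^sup>2) \<partial>fock_mu l)"
    by (intro nn_integral_cong nn_integral_multc) (unfold borel_measurable_fock_mu, measurable)
  also have "ennreal C * \<dots> \<le> ennreal C * (\<integral>\<^sup>+w. ennreal C * ennreal ((\<phi> w)\<^sup>2) \<partial>fock_mu l)"
    by (intro mult_left_mono nn_integral_mono mult_right_mono C) auto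
  also have "(\<integral>\<^sup>+w. ennreal C * ennreal ((\<phi> w)\<^sup>2) \<partial>fock_mu l) = ennreal C * (\<integral>\<^sup>+w. ennreal ((\<phi> w)\<^sup>2) \<partial>fock_mu l)"
    by (rule nn_integral_cmult) (unfold borel_measurable_fock_mu, measurable)
  also have "ennreal C * \<dots> < \<infinity>"
    using fock_L2_nn_integral[OF f] by (simp add: \<phi>_def ennreal_mult_less_top)
  finally show ?thesis by (simp add: T_def)
qed

section \<open>Holomorphy of the image functions\<close>

lemma norm_exp_remainder: "cmod (exp x - 1 - x) \<le> (cmod x)\<^sup>2 * exp (cmod x)"
proof -
  have "cmod (exp x - (\<Sum>i\<le>1. x ^ i / fact i)) \<le> exp \<bar>Re x\<bar> * cmod x ^ Suc 1 / fact 1"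
    by (rule Taylor_exp)
  also have "\<dots> \<le> exp (cmod x) * (cmod x)\<^sup>2"
    by (simp add: power2_eq_square mult_right_mono abs_Re_le_cmod)
  finally show ?thesis by (simp add: mult.commute diff_diff_eq)
qed

text \<open>Exponential moments of every order are assumed because y is arbitrary and because the
  powers of |w| in the derivative and the remainder are absorbed into exponentials.\<close>

lemma holomorphic_cn_laplace:
  fixes g :: "complex ^ 'n::finite \<Rightarrow> complex"
  assumes l: "0 < l" and g: "g \<in> borel_measurable borel"
    and int: "\<And>c. integrable (fock_mu l) (\<lambda>w. exp (c * (1 + norm w)) * cmod (g w))"
  shows "holomorphic_cn (\<lambda>y. LINT w|fock_mu l. exp (of_real l / 2 * sp y (vcnj w)) * g w)"
proof (rule holomorphic_cnI)
  fix y :: "complex ^ 'n"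
  define D where "D y w h = of_real l / 2 * sp h (vcnj w) * (exp (of_real l / 2 * sp y (vcnj w)) * g w)" for y w h
  have e_le: "cmod (exp (of_real l / 2 * sp y (vcnj w))) \<le> exp (l / 2 * norm y * (1 + norm w))" for w y
  proof -
    have "Re (of_real l / 2 * sp y (vcnj w)) \<le> l / 2 * (norm y * norm w)"
      using complex_Re_le_cmod[of "sp y (vcnj w)"] norm_sp_le[of y "vcnj w"] l by (simp add: norm_vcnj)
    also have "\<dots> \<le> l / 2 * norm y * (1 + norm w)" using l by (simp add: algebra_simps)
    finally show ?thesis by (simp add: norm_exp_eq_Re)
  qed
  have x_le: "cmod (of_real l / 2 * sp h (vcnj w)) \<le> l / 2 * norm h * norm w" for h w
    using norm_sp_le[of h "vcnj w"] l by (simp add: norm_mult norm_vcnj)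
  have w_le: "l / 2 * norm w \<le> exp (l * (1 + norm w))" for w :: "complex ^ 'n"
  proof -
    have "0 \<le> l * norm w" using l by simp
    then have "l / 2 * norm w \<le> 1 + l * (1 + norm w)" using l by (simp add: algebra_simps)
    also have "\<dots> \<le> exp (l * (1 + norm w))" by (rule exp_ge_add_one_self)
    finally show ?thesis .
  qed
  \<comment> \<open>The part with \<open>norm y\<close> bounds the exponential at y. The remainder
    costs three factors exp (l (1 + |w|)), two from the square of l/2 |w| and one from exp |x|; 4 l
    covers them.\<close>
  define c where "c = l / 2 * norm y + 4 * l"
  show "((\<lambda>y. LINT w|fock_mu l. exp (of_real l / 2 * sp y (vcnj w)) * g w) has_derivative (\<lambda>h. LINT w|fock_mu l. D y w h)) (at y)"
  proof (rule has_derivative_integral_quadratic[where g = "\<lambda>w. exp (c * (1 + norm w)) * cmod (g w)"])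
    have m: "(\<lambda>w. exp (of_real l / 2 * sp y (vcnj w))) \<in> borel_measurable borel"
      "(\<lambda>w. of_real l / 2 * sp y (vcnj w)) \<in> borel_measurable borel" for y :: "complex ^ 'n"
      by (intro borel_measurable_continuous_onI continuous_intros)+
    show "integrable (fock_mu l) (\<lambda>w. exp (of_real l / 2 * sp y (vcnj w)) * g w)" for y
      by (rule Bochner_Integration.integrable_bound[OF int[of "l / 2 * norm y"]])
        (use e_le[of y] m g in \<open>auto simp: borel_measurable_fock_mu norm_mult intro!: mult_right_mono\<close>)
    show "linear (D y w)" for w
      by (rule linearI) (auto simp: D_def sp_simps algebra_simps scaleR_conv_of_real[where 'a = complex])
    show bD: "norm (D y w h) \<le> exp (c * (1 + norm w)) * cmod (g w) * norm h" for w h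
    proof -
      have "norm (D y w h) \<le> (l / 2 * norm h * norm w) * (exp (l / 2 * norm y * (1 + norm w)) * cmod (g w))"
        unfolding D_def norm_mult[of "of_real l / 2 * sp h (vcnj w)"] norm_mult[of _ "g w"]
        by (intro mult_mono x_le e_le) (use l in auto)
      also have "\<dots> = (l / 2 * norm w) * (exp (l / 2 * norm y * (1 + norm w)) * cmod (g w) * norm h)"
        by simp
      also have "\<dots> \<le> exp (4 * l * (1 + norm w)) * (exp (l / 2 * norm y * (1 + norm w)) * cmod (g w) * norm h)"
      proof (intro mult_right_mono)
        have "exp (l * (1 + norm w)) \<le> exp (4 * l * (1 + norm w))" using l by simp
        then show "l / 2 * norm w \<le> exp (4 * l * (1 + norm w))" using w_le[of w] by linarith
      qed simp
      also have "\<dots> = exp (4 * l * (1 + norm w)) * exp (l / 2 * norm y * (1 + norm w)) * cmod (g w) * norm h"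
        by simp
      also have "exp (4 * l * (1 + norm w)) * exp (l / 2 * norm y * (1 + norm w)) = exp (c * (1 + norm w))"
        by (simp add: c_def algebra_simps flip: exp_add)
      finally show ?thesis .
    qed
    show "integrable (fock_mu l) (\<lambda>w. D y w h)" for h
    proof (rule Bochner_Integration.integrable_bound[OF integrable_mult_left[OF int[of c], of "norm h"]])
      show "(\<lambda>w. D y w h) \<in> borel_measurable (fock_mu l)"
        unfolding borel_measurable_fock_mu D_def
        by (rule borel_measurable_times[OF m(2) borel_measurable_times[OF m(1) g]])
    qed (use bD in auto)
    show "norm (exp (of_real l / 2 * sp (y + h) (vcnj w)) * g w - exp (of_real l / 2 * sp y (vcnj w)) * g w - D y w h)
        \<le> exp (c * (1 + norm w)) * cmod (g w) * (norm h)\<^sup>2" if h: "norm h \<le> 1" for h w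
    proof -
      define x where "x = of_real l / 2 * sp h (vcnj w)"
      have xw: "cmod x \<le> l / 2 * norm w * norm h" using x_le[of h w] by (simp add: x_def mult_ac)
      have "l / 2 * norm w * norm h \<le> l / 2 * norm w" using h l by (simp add: mult_left_le)
      also have "\<dots> \<le> l * (1 + norm w)" using l by (simp add: algebra_simps)
      finally have xl: "cmod x \<le> l * (1 + norm w)" using xw by linarith
      have "exp (of_real l / 2 * sp (y + h) (vcnj w)) = exp (of_real l / 2 * sp y (vcnj w)) * exp x"
        by (simp add: x_def sp_simps algebra_simps flip: exp_add)
      then have "exp (of_real l / 2 * sp (y + h) (vcnj w)) * g w - exp (of_real l / 2 * sp y (vcnj w)) * g w - D y w h
          = (exp x - 1 - x) * (exp (of_real l / 2 * sp y (vcnj w)) * g w)"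
        unfolding D_def x_def[symmetric] by (simp add: algebra_simps)
      then have "norm (exp (of_real l / 2 * sp (y + h) (vcnj w)) * g w - exp (of_real l / 2 * sp y (vcnj w)) * g w - D y w h)
          = cmod (exp x - 1 - x) * (cmod (exp (of_real l / 2 * sp y (vcnj w))) * cmod (g w))"
        by (simp add: norm_mult)
      also have "\<dots> \<le> ((l / 2 * norm w * norm h)\<^sup>2 * exp (l * (1 + norm w))) * (exp (l / 2 * norm y * (1 + norm w)) * cmod (g w))"
      proof (intro mult_mono e_le)
        show "cmod (exp x - 1 - x) \<le> (l / 2 * norm w * norm h)\<^sup>2 * exp (l * (1 + norm w))"
          by (rule order_trans[OF norm_exp_remainder mult_mono]) (use xw xl in \<open>auto intro!: power_mono\<close>)
      qed auto
      also have "\<dots> = (l / 2 * norm w)\<^sup>2 * (exp (l * (1 + norm w)) * exp (l / 2 * norm y * (1 + norm w)) * cmod (g w) * (norm h)\<^sup>2)"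
        unfolding power_mult_distrib by (simp only: mult_ac)
      also have "\<dots> \<le> (exp (l * (1 + norm w)))\<^sup>2 * (exp (l * (1 + norm w)) * exp (l / 2 * norm y * (1 + norm w)) * cmod (g w) * (norm h)\<^sup>2)"
        using w_le[of w] l by (intro mult_right_mono power_mono) auto
      also have "\<dots> = exp (2 * (l * (1 + norm w)) + l * (1 + norm w) + l / 2 * norm y * (1 + norm w)) * cmod (g w) * (norm h)\<^sup>2"
        by (simp only: exp_add exp_double mult.assoc)
      also have "\<dots> \<le> exp (c * (1 + norm w)) * cmod (g w) * (norm h)\<^sup>2"
      proof (intro mult_right_mono)
        have "c * (1 + norm w) = l / 2 * norm y * (1 + norm w) + 4 * (l * (1 + norm w))"
          by (simp add: c_def distrib_right)
        moreover have "0 \<le> l * (1 + norm w)" using l by simp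
        ultimately show "exp (2 * (l * (1 + norm w)) + l * (1 + norm w) + l / 2 * norm y * (1 + norm w)) \<le> exp (c * (1 + norm w))"
          unfolding exp_le_cancel_iff by linarith
      qed auto
      finally show ?thesis .
    qed
  qed (rule int)
  show "(LINT w|fock_mu l. D y w (c *s v)) = c * (LINT w|fock_mu l. D y w v)" for c v
    by (simp add: D_def sp_simps mult.assoc mult.left_commute[of _ c])
qed

text \<open>The z-dependence splits into the entire factor exp (l/4 z^t A z) and a Laplace transform
  evaluated at P^-1 z.\<close>

lemma op_of_gauss_kernel_holomorphic:
  fixes f :: "complex ^ 'n::finite \<Rightarrow> complex"
  assumes l: "0 < l" and k: "k \<in> symp_S" and f: "f \<in> fock_L2 l"
  shows "holomorphic_cn (op_of_kernel l (gauss_kernel l k) f)"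
proof -
  define g where "g w = exp (of_real l / 4 * sp (vcnj w) (kerB k *v vcnj w)) * f w * of_real (fock_weight l w)" for w
  define H where "H y = (LINT w|fock_mu l. exp (of_real l / 2 * sp y (vcnj w)) * g w)" for y
  have fm[measurable]: "f \<in> borel_measurable borel" using f by (simp add: fock_L2_def)
  have "(\<lambda>w :: complex ^ 'n. exp (of_real l / 4 * sp (vcnj w) (kerB k *v vcnj w))) \<in> borel_measurable borel"
    by (intro borel_measurable_continuous_onI continuous_intros)
  then have gm[measurable]: "g \<in> borel_measurable borel" unfolding g_def[abs_def] by measurable
  obtain k' where k': "k' \<in> symp_S" "k ** k' = mat 1" using inverse_symp_S[OF k] by metis
  obtain d where d: "d > 0" "\<And>z w. abs_kernel l k z w \<le> exp (- d * (norm (w - act1 k' z (vcnj z)))\<^sup>2)"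
    using gauss_kernel_bound_right[OF l k k'] unfolding abs_kernel_def by blast
  \<comment> \<open>At z = 0 only the form \<open>kerB k\<close> is left in the kernel, and the
    centre of the Gaussian bound is 0.\<close>
  have b: "cmod (exp (of_real l / 4 * sp (vcnj w) (kerB k *v vcnj w))) * fock_weight (l / 2) w \<le> exp (- d * (norm w)\<^sup>2)" for w
    using d(2)[of 0 w]
    by (simp add: abs_kernel_def gauss_kernel_exp gauss_exp_def sp_simps vcnj_simps act1_def fock_weight_def)
  have "holomorphic_cn H"
    unfolding H_def
  proof (rule holomorphic_cn_laplace[OF l gm])
    fix c :: real
    show "integrable (fock_mu l) (\<lambda>w. exp (c * (1 + norm w)) * cmod (g w))"
    proof (rule Bochner_Integration.integrable_bound)
      show "integrable (fock_mu l) (\<lambda>w. exp (2 * c * (1 + norm w) - 2 * d * (norm w)\<^sup>2) + (cmod (f w))\<^sup>2 * fock_weight l w)"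
        using f d(1) integrable_gauss_bound[OF l, of "2 * d" "2 * c", where 'n = 'n] by (auto simp: fock_L2_def)
      show "AE w in fock_mu l. norm (exp (c * (1 + norm w)) * cmod (g w))
          \<le> norm (exp (2 * c * (1 + norm w) - 2 * d * (norm w)\<^sup>2) + (cmod (f w))\<^sup>2 * fock_weight l w)"
      proof (rule AE_I2)
        fix w :: "complex ^ 'n"
        define x where "x = exp (c * (1 + norm w) - d * (norm w)\<^sup>2)"
        define y where "y = cmod (f w) * fock_weight (l / 2) w"
        have "exp (c * (1 + norm w)) * cmod (g w) = exp (c * (1 + norm w)) * (cmod (exp (of_real l / 4 * sp (vcnj w) (kerB k *v vcnj w))) * fock_weight (l / 2) w) * y"
          by (simp add: g_def y_def norm_mult fock_weight_split[of l w] mult_ac)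
        also have "\<dots> \<le> exp (c * (1 + norm w)) * exp (- d * (norm w)\<^sup>2) * y"
          using b[of w] by (intro mult_right_mono mult_left_mono) (auto simp: y_def)
        also have "\<dots> = x * y" by (simp add: x_def flip: exp_add)
        also have "\<dots> \<le> x\<^sup>2 + y\<^sup>2"
        proof -
          have "2 * (x * y) \<le> x\<^sup>2 + y\<^sup>2" using sum_squares_bound[of x y] by simp
          moreover have "0 \<le> x * y" by (simp add: x_def y_def)
          ultimately show ?thesis by linarith
        qed
        also have "x\<^sup>2 = exp (2 * c * (1 + norm w) - 2 * d * (norm w)\<^sup>2)"
          by (simp add: x_def algebra_simps flip: exp_double)
        also have "y\<^sup>2 = (cmod (f w))\<^sup>2 * fock_weight l w"
          by (simp add: y_def power_mult_distrib fock_weight_split[of l w] power2_eq_square)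
        finally show "norm (exp (c * (1 + norm w)) * cmod (g w))
          \<le> norm (exp (2 * c * (1 + norm w) - 2 * d * (norm w)\<^sup>2) + (cmod (f w))\<^sup>2 * fock_weight l w)"
          by simp
      qed
      show "(\<lambda>w. exp (c * (1 + norm w)) * cmod (g w)) \<in> borel_measurable (fock_mu l)"
        unfolding borel_measurable_fock_mu by measurable
    qed
  qed
  then have "holomorphic_cn (\<lambda>z. H (matrix_inv (block_ul k) *v z + 0))"
    by (rule holomorphic_cn_compose_matrix)
  then have "holomorphic_cn (\<lambda>z. exp (of_real l / 4 * sp z (kerA k *v z)) * H (matrix_inv (block_ul k) *v z))"
    by (intro holomorphic_cn_mult holomorphic_cn_exp holomorphic_cn_const holomorphic_cn_sp_matrix) simp
  also have "(\<lambda>z. exp (of_real l / 4 * sp z (kerA k *v z)) * H (matrix_inv (block_ul k) *v z))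
      = op_of_kernel l (gauss_kernel l k) f"
  proof
    fix z
    have "gauss_kernel l k z w * f w * of_real (fock_weight l w)
        = exp (of_real l / 4 * sp z (kerA k *v z)) * (exp (of_real l / 2 * sp (matrix_inv (block_ul k) *v z) (vcnj w)) * g w)" for w
      by (simp add: gauss_kernel_exp gauss_exp_def g_def distrib_left exp_add mult_ac)
    then show "exp (of_real l / 4 * sp z (kerA k *v z)) * H (matrix_inv (block_ul k) *v z) = op_of_kernel l (gauss_kernel l k) f z"
      by (simp add: op_of_kernel_def H_def)
  qed
  finally show ?thesis .
qed

lemma op_of_gauss_kernel_fock:
  fixes f :: "complex ^ 'n::finite \<Rightarrow> complex"
  assumes l: "0 < l" and k: "k \<in> symp_S" and f: "f \<in> fock_L2 l"
  shows "op_of_kernel l (gauss_kernel l k) f \<in> fock l"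
proof -
  note h = op_of_gauss_kernel_holomorphic[OF assms]
  have [measurable]: "op_of_kernel l (gauss_kernel l k) f \<in> borel_measurable borel"
    by (rule holomorphic_cn_measurable[OF h])
  have "integrable (fock_mu l) (\<lambda>z. (cmod (op_of_kernel l (gauss_kernel l k) f z))\<^sup>2 * fock_weight l z)"
  proof (rule integrableI_bounded)
    show "(\<lambda>z. (cmod (op_of_kernel l (gauss_kernel l k) f z))\<^sup>2 * fock_weight l z) \<in> borel_measurable (fock_mu l)"
      unfolding borel_measurable_fock_mu by measurable
  qed (use op_of_gauss_kernel_L2[OF assms] in simp)
  with h show ?thesis by (simp add: fock_def)
qed

section \<open>Composition of the kernel operators\<close>

lemma symmetric_matrix_transpose:
  fixes A :: "complex ^ 'n::finite ^ 'n"
  assumes "\<And>x y. sp x (A *v y) = sp y (A *v x)"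
  shows "transpose A = A"
  using assms[of "axis _ 1" "axis _ 1"]
  by (simp add: vec_eq_iff transpose_def sp_axis_left matrix_vec_axis)

text \<open>Symmetric matrices satisfy (AB)^t = BA. The Gaussian integral produces one order of the
  factors and the block product of k and k' the other.\<close>

lemma det_one_minus_swap:
  fixes A B :: "complex ^ 'n::finite ^ 'n"
  assumes "\<And>x y. sp x (A *v y) = sp y (A *v x)" "\<And>x y. sp x (B *v y) = sp y (B *v x)"
  shows "det (mat 1 - A ** B) = det (mat 1 - B ** A)"
proof -
  have "transpose (mat 1 - A ** B) = mat 1 - transpose (A ** B)"
    by (simp add: vec_eq_iff transpose_def mat_def)
  also have "\<dots> = mat 1 - B ** A"
    by (simp add: matrix_transpose_mul symmetric_matrix_transpose[OF assms(1)] symmetric_matrix_transpose[OF assms(2)])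
  finally show ?thesis by (metis det_transpose)
qed

text \<open>P P' + Q Qbar' with P taken out on the left and P' on the right; the minus sign comes
  from the one in \<open>kerB\<close>.\<close>

lemma block_ul_mult:
  assumes "k \<in> symp_S" "k' \<in> symp_S"
  shows "block_ul (k ** k') = block_ul k ** (mat 1 - kerB k ** kerA k') ** block_ul k'"
proof -
  note P = invertible_matrix_inv[OF invertible_block_ul[OF assms(1)]]
  note P' = invertible_matrix_inv[OF invertible_block_ul[OF assms(2)]]
  have "block_ul (k ** k') = block_ul k ** block_ul k' + block_ur k ** mcnj (block_ur k')"
    by (rule symp_SE[OF assms(1)], rule symp_SE[OF assms(2)]) (simp add: block_mat_mult)
  also have "block_ur k ** mcnj (block_ur k')
      = (block_ul k ** matrix_inv (block_ul k)) ** block_ur k ** mcnj (block_ur k') ** (matrix_inv (block_ul k') ** block_ul k')"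
    by (simp only: P P' matrix_mul_lid matrix_mul_rid)
  also have "block_ul k ** block_ul k' + \<dots> = block_ul k ** (mat 1 - kerB k ** kerA k') ** block_ul k'"
    by (simp add: kerA_def kerB_def matrix_mul_uminus matrix_mul_diff matrix_add_ldistrib matrix_add_rdistrib matrix_mul_assoc)
  finally show ?thesis .
qed

text \<open>J is the pure quadratic integral, hence independent of z and w. What depends on them is
  the critical value of the exponent, which is the generating function of the product.\<close>

lemma gauss_kernel_compose:
  fixes k k' :: "complex ^ ('n::finite + 'n) ^ ('n + 'n)"
  assumes l: "0 < l" and k: "k \<in> symp_S" and k': "k' \<in> symp_S"
  obtains J where "J\<^sup>2 * det (block_ul (k ** k')) = det (block_ul k) * det (block_ul k')"
    "\<And>z w. (LINT u|fock_mu l. gauss_kernel l k z u * gauss_kernel l k' u w * of_real (fock_weight l u))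
       = J * gauss_kernel l (k ** k') z w"
proof -
  have kk: "k ** k' \<in> symp_S" by (rule mult_symp_S[OF k k'])
  obtain r1 where r1: "0 \<le> r1" "r1 < 1" "\<And>x. norm (kerA k' *v x) \<le> r1 * norm x"
    using kerA_contraction[OF k'] by metis
  obtain r2 where r2: "0 \<le> r2" "r2 < 1" "\<And>x. norm (kerB k *v x) \<le> r2 * norm x"
    using kerB_contraction[OF k] by metis
  interpret G: gauss_pair l "max r1 r2" "kerA k'" "kerB k"
  proof
    show "norm (kerA k' *v x) \<le> max r1 r2 * norm x" for x
      by (rule order_trans[OF r1(3)]) (simp add: mult_right_mono)
    show "norm (kerB k *v x) \<le> max r1 r2 * norm x" for x
      by (rule order_trans[OF r2(3)]) (simp add: mult_right_mono)
  qed (use l r1 r2 kerA_symmetric[OF k'] kerB_symmetric[OF k] in auto)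
  define J where "J = (LINT u|fock_mu l. exp (G.qexp 0 0 1 0 u))"
  have "det (block_ul (k ** k')) = det (block_ul k) * det (mat 1 - kerA k' ** kerB k) * det (block_ul k')"
    unfolding block_ul_mult[OF k k'] det_mul
    using det_one_minus_swap[OF kerA_symmetric[OF k'] kerB_symmetric[OF k]] by simp
  then have "J\<^sup>2 * det (block_ul (k ** k')) = (J\<^sup>2 * det (mat 1 - kerA k' ** kerB k)) * (det (block_ul k) * det (block_ul k'))"
    by (simp only: mult_ac)
  then have 1: "J\<^sup>2 * det (block_ul (k ** k')) = det (block_ul k) * det (block_ul k')"
    unfolding J_def G.gauss_integral_det by simp
  have 2: "(LINT u|fock_mu l. gauss_kernel l k z u * gauss_kernel l k' u w * of_real (fock_weight l u))
       = J * gauss_kernel l (k ** k') z w" for z w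
  proof -
    define \<omega> where "\<omega> = vcnj w"
    \<comment> \<open>The first component of the pair that k k' maps to a pair starting with z. Its
      image under k' is the critical point (u0, v0), the intermediate stage between the two
      maps.\<close>
    define x where "x = matrix_inv (block_ul (k ** k')) *v (z - block_ur (k ** k') *v \<omega>)"
    have z: "act1 (k ** k') x \<omega> = z"
      using invertible_matrix_inv[OF invertible_block_ul[OF kk]] by (simp add: act1_def x_def)
    define u0 where "u0 = act1 k' x \<omega>"
    define v0 where "v0 = act2 k' x \<omega>"
    have zk: "act1 k u0 v0 = z" "act2 (k ** k') x \<omega> = act2 k u0 v0"
      using act_mult[OF k k', of x \<omega>] by (simp_all add: u0_def v0_def z)
    \<comment> \<open>a and b are the coefficients of u and of its conjugate in the sum of the two
      exponents.\<close>
    define a where "a = transpose (matrix_inv (block_ul k')) *v \<omega>"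
    define b where "b = matrix_inv (block_ul k) *v z"
    have a: "sp (matrix_inv (block_ul k') *v v) \<omega> = sp v a" for v
      unfolding a_def by (rule sp_matrix_left)
    have va: "v0 = kerA k' *v u0 + a"
    proof (rule sp_eqI)
      show "sp v v0 = sp v (kerA k' *v u0 + a)" for v
        using kerA_generating[OF k', of v x \<omega>] by (simp add: u0_def v0_def a sp_simps)
    qed
    have ub: "u0 = kerB k *v v0 + b"
      using kerB_generating[OF k, of u0 v0] by (simp add: zk b_def add.commute)
    have e1: "sp z (kerA k *v z) + sp b v0 = sp z (act2 k u0 v0)"
      using kerA_generating[OF k, of z u0 v0] by (simp add: zk b_def)
    have e2: "sp a u0 + sp \<omega> (kerB k' *v \<omega>) = sp \<omega> x"
    proof -
      have "sp \<omega> (matrix_inv (block_ul k') *v u0 + kerB k' *v \<omega>) = sp \<omega> x"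
        unfolding u0_def kerB_generating[OF k'] ..
      then show ?thesis
        by (simp only: sp_add_right sp_commute[of \<omega> "matrix_inv (block_ul k') *v u0"] a sp_commute[of u0 a])
    qed
    define \<kappa> where "\<kappa> = of_real l / 4 * (sp z (kerA k *v z) + sp \<omega> (kerB k' *v \<omega>))"
    have "gauss_exp l k z (vcnj u) + gauss_exp l k' u \<omega> - of_real l / 2 * sp u (vcnj u) = \<kappa> + G.qexp a b 1 1 u" for u
      by (simp add: gauss_exp_def G.qexp_def \<kappa>_def a b_def[symmetric] sp_commute[of u a] field_simps)
    then have "gauss_kernel l k z u * gauss_kernel l k' u w * of_real (fock_weight l u) = exp \<kappa> * exp (G.qexp a b 1 1 u)" for u
      by (simp add: gauss_kernel_exp \<omega>_def[symmetric] fock_weight_exp flip: exp_add)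
    then have "(LINT u|fock_mu l. gauss_kernel l k z u * gauss_kernel l k' u w * of_real (fock_weight l u))
        = exp \<kappa> * (J * exp (of_real l / 4 * (sp a u0 + sp b v0)))"
      using G.gauss_integral_linear[OF va ub] by (simp add: J_def)
    also have "\<dots> = J * exp (\<kappa> + of_real l / 4 * (sp a u0 + sp b v0))"
      by (simp add: exp_add)
    \<comment> \<open>By \<open>e1\<close> and \<open>e2\<close> the intermediate terms vanish: only
      the pairing at z and the one at \<omega> survive, which is the value of the generating
      function of k k'.\<close>
    also have "\<kappa> + of_real l / 4 * (sp a u0 + sp b v0) = of_real l / 4 * (sp z (act2 k u0 v0) + sp \<omega> x)"
      unfolding \<kappa>_def e1[symmetric] e2[symmetric] by (simp add: algebra_simps)
    also have "\<dots> = gauss_exp l (k ** k') z \<omega>"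
      using gauss_exp_act[OF kk, of l x \<omega>] by (simp add: z zk)
    finally show ?thesis by (simp add: gauss_kernel_exp \<omega>_def)
  qed
  show thesis by (rule that[OF 1 2])
qed

lemma op_of_gauss_kernel_compose:
  fixes f :: "complex ^ 'n::finite \<Rightarrow> complex"
  assumes l: "0 < l" and k: "k \<in> symp_S" and k': "k' \<in> symp_S" and f: "f \<in> fock_L2 l"
    and J: "\<And>z w. (LINT u|fock_mu l. gauss_kernel l k z u * gauss_kernel l k' u w * of_real (fock_weight l u))
       = J * gauss_kernel l (k ** k') z w"
  shows "op_of_kernel l (gauss_kernel l k) (op_of_kernel l (gauss_kernel l k') f) z
    = J * op_of_kernel l (gauss_kernel l (k ** k')) f z"
proof -
  interpret F: sigma_finite_measure "fock_mu l :: (complex ^ 'n) measure"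
    by (rule sigma_finite_fock_mu)
  interpret P: pair_sigma_finite "fock_mu l :: (complex ^ 'n) measure" "fock_mu l :: (complex ^ 'n) measure" ..
  define F where "F u w = (gauss_kernel l k z u * of_real (fock_weight l u)) * (gauss_kernel l k' u w * f w * of_real (fock_weight l w))" for u w
  have int: "integrable (fock_mu l \<Otimes>\<^sub>M fock_mu l) (\<lambda>(u, w). F u w)"
    unfolding F_def by (rule gauss_kernel_bilinear_integrable[OF l k' f gauss_kernel_L2[OF l k]])
  have "op_of_kernel l (gauss_kernel l k) (op_of_kernel l (gauss_kernel l k') f) z
      = (LINT u|fock_mu l. (LINT w|fock_mu l. F u w))"
  proof -
    have "(LINT w|fock_mu l. F u w) = gauss_kernel l k z u * of_real (fock_weight l u) * op_of_kernel l (gauss_kernel l k') f u" for u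
      unfolding F_def op_of_kernel_def by (rule integral_mult_right_zero)
    then show ?thesis
      unfolding op_of_kernel_def[of l "gauss_kernel l k"] by (simp only: mult_ac)
  qed
  also have "\<dots> = (LINT w|fock_mu l. (LINT u|fock_mu l. F u w))"
    by (rule P.Fubini_integral[OF int, symmetric])
  also have "\<dots> = (LINT w|fock_mu l. J * (gauss_kernel l (k ** k') z w * f w * of_real (fock_weight l w)))"
  proof (rule Bochner_Integration.integral_cong[OF refl])
    fix w
    have "(LINT u|fock_mu l. F u w) = (LINT u|fock_mu l. (gauss_kernel l k z u * gauss_kernel l k' u w * of_real (fock_weight l u)) * (f w * of_real (fock_weight l w)))"
      by (intro Bochner_Integration.integral_cong) (auto simp: F_def mult_ac)
    also have "\<dots> = (LINT u|fock_mu l. gauss_kernel l k z u * gauss_kernel l k' u w * of_real (fock_weight l u)) * (f w * of_real (fock_weight l w))"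
      by (rule integral_mult_left_zero)
    finally show "(LINT u|fock_mu l. F u w) = J * (gauss_kernel l (k ** k') z w * f w * of_real (fock_weight l w))"
      unfolding J by (simp only: mult.assoc)
  qed
  finally show ?thesis by (simp add: op_of_kernel_def)
qed

lemma sigma_op_eq: "sigma_op l k f = (\<lambda>z. det_factor k * op_of_kernel l (gauss_kernel l k) f z)"
  by (simp add: fun_eq_iff sigma_op_def op_of_kernel_def mult.assoc)

lemma op_of_kernel_cmult: "op_of_kernel l b (\<lambda>w. c * f w) = (\<lambda>z. c * op_of_kernel l b f z)"
proof -
  have "b z w * (c * f w) * of_real (fock_weight l w) = c * (b z w * f w * of_real (fock_weight l w))" for z w
    by simp
  then show ?thesis unfolding fun_eq_iff op_of_kernel_def by (simp only: integral_mult_right_zero) simp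
qed

lemma fock_cmult: "f \<in> fock l \<Longrightarrow> (\<lambda>z. c * f z) \<in> fock l"
  by (auto simp: fock_def norm_mult power_mult_distrib mult.assoc intro!: holomorphic_cn_mult holomorphic_cn_const)

lemma det_factor_nonzero:
  assumes "k \<in> symp_S"
  shows "det_factor k \<noteq> 0" "(det_factor k)\<^sup>2 = 1 / det (block_ul k)" "det (block_ul k) \<noteq> 0"
  using invertible_block_ul[OF assms] by (auto simp: det_factor_def power_divide invertible_det_nz)

text \<open>The identity for J^2 shows that the two normalising constants have equal squares, hence
  agree up to sign. The sign is chosen before f and z, so it is a sign of operators.\<close>

lemma sigma_op_mult:
  fixes k k' :: "complex ^ ('n::finite + 'n) ^ ('n + 'n)"
  assumes l: "0 < l" and k: "k \<in> symp_S" and k': "k' \<in> symp_S"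
  obtains \<epsilon> :: complex where "\<epsilon> \<in> {1, -1}"
    "\<And>f z. f \<in> fock_L2 l \<Longrightarrow> sigma_op l (k ** k') f z = \<epsilon> * sigma_op l k (sigma_op l k' f) z"
proof -
  obtain J where J: "J\<^sup>2 * det (block_ul (k ** k')) = det (block_ul k) * det (block_ul k')"
    "\<And>z w. (LINT u|fock_mu l. gauss_kernel l k z u * gauss_kernel l k' u w * of_real (fock_weight l u))
       = J * gauss_kernel l (k ** k') z w"
    by (rule gauss_kernel_compose[OF assms]) (rule that)
  have kk: "k ** k' \<in> symp_S" by (rule mult_symp_S[OF k k'])
  note d = det_factor_nonzero[OF k] det_factor_nonzero[OF k'] det_factor_nonzero[OF kk]
  have "(det_factor k * det_factor k' * J)\<^sup>2 = (det_factor (k ** k'))\<^sup>2"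
  proof -
    have "J\<^sup>2 = det (block_ul k) * det (block_ul k') / det (block_ul (k ** k'))"
      using J(1) d(9) by (simp add: eq_divide_eq)
    then show ?thesis
      unfolding power_mult_distrib d(2) d(5) d(8) using d(3) d(6) by simp
  qed
  then have or: "det_factor k * det_factor k' * J = det_factor (k ** k') \<or> det_factor k * det_factor k' * J = - det_factor (k ** k')"
    unfolding power2_eq_iff .
  define \<epsilon> :: complex where "\<epsilon> = (if det_factor k * det_factor k' * J = det_factor (k ** k') then 1 else -1)"
  have \<epsilon>: "\<epsilon> \<in> {1, -1}" "det_factor (k ** k') = \<epsilon> * (det_factor k * det_factor k' * J)"
    using or by (auto simp: \<epsilon>_def)
  have "sigma_op l (k ** k') f z = \<epsilon> * sigma_op l k (sigma_op l k' f) z" if f: "f \<in> fock_L2 l" for f z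
    unfolding sigma_op_eq op_of_kernel_cmult
    by (simp add: op_of_gauss_kernel_compose[OF l k k' f J(2)] \<epsilon>(2))
  then show thesis by (rule that[OF \<epsilon>(1)])
qed

section \<open>Unitarity\<close>

lemma one_in_fock:
  assumes "0 < l"
  shows "(\<lambda>z :: complex ^ 'n::finite. 1) \<in> fock l"
  using has_bochner_integral_fock_weight[OF assms, where 'n = 'n]
  by (auto simp: fock_def holomorphic_cn_const has_bochner_integral_iff)

lemma gauss_kernel_one:
  fixes z w :: "complex ^ 'n::finite"
  shows "gauss_kernel l (mat 1) z w = exp (of_real l / 2 * sp z (vcnj w))"
proof -
  have "matrix_inv (mat 1 :: complex ^ 'n ^ 'n) = mat 1"
    using invertible_matrix_inv(1)[of "mat 1 :: complex ^ 'n ^ 'n"] by (simp add: invertible_def) 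
  then show ?thesis
    by (simp add: gauss_kernel_exp gauss_exp_def kerA_def kerB_def block_mat_one mcnj_simps sp_simps)
qed

lemma op_of_gauss_kernel_one:
  fixes f :: "complex ^ 'n::finite \<Rightarrow> complex"
  assumes l: "0 < l" and f: "f \<in> fock l"
  shows "op_of_kernel l (gauss_kernel l (mat 1)) f = f"
proof
  fix z
  have "integrable (fock_mu l) (\<lambda>w. gauss_kernel l (mat 1) z w * f w * of_real (fock_weight l w))"
    by (rule gauss_kernel_integrable[OF l one_symp_S fock_subset_L2[OF f]])
  then show "op_of_kernel l (gauss_kernel l (mat 1)) f z = f z"
    unfolding op_of_kernel_def gauss_kernel_one
    using f by (intro fock_reproducing[OF l]) (auto simp: fock_def)
qed

lemma sigma_op_one:
  assumes "0 < l" "f \<in> fock l"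
  shows "sigma_op l (mat 1) f = f"
  using op_of_gauss_kernel_one[OF assms]
  by (simp add: sigma_op_eq det_factor_def block_mat_one)

lemma sigma_op_fock:
  assumes "0 < l" "k \<in> symp_S" "f \<in> fock l"
  shows "sigma_op l k f \<in> fock l"
  unfolding sigma_op_eq by (intro fock_cmult op_of_gauss_kernel_fock fock_subset_L2 assms)

text \<open>The invariance of the form makes the upper left block of the inverse the adjoint of P,
  so the two determinants have the same modulus.\<close>

lemma block_ul_inverse:
  assumes "k \<in> symp_S" "k' \<in> symp_S" "k ** k' = mat 1"
  shows "block_ul k' = transpose (mcnj (block_ul k))"
proof -
  have "sp (block_ul k' *v v) y = sp v (mcnj (block_ul k) *v y)" for v y
    using act_form[OF assms(1), of "act1 k' v 0" "act2 k' v 0" 0 y] act_mult[OF assms(1,2), of v 0]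
    by (simp add: assms(3) act_one act1_def[of k'] act2_def[of k _ y] sp_simps)
  then have "sp y (block_ul k' *v v) = sp y (transpose (mcnj (block_ul k)) *v v)" for v y
    using sp_matrix_left[of "mcnj (block_ul k)" y v] by (simp add: sp_commute)
  then have "block_ul k' *v v = transpose (mcnj (block_ul k)) *v v" for v
    by (rule sp_eqI)
  then show ?thesis
    by (simp add: matrix_eq)
qed

lemma det_mcnj: "det (mcnj A) = cnj (det (A :: complex ^ 'n::finite ^ 'n))"
  by (simp add: det_def map_matrix_def cnj_sum cnj_prod)

lemma norm_det_factor_inverse:
  assumes "k \<in> symp_S" "k' \<in> symp_S" "k ** k' = mat 1"
  shows "cmod (det_factor k') = cmod (det_factor k)"
  by (simp add: det_factor_def block_ul_inverse[OF assms] det_transpose det_mcnj norm_divide)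

text \<open>The adjoint of \<open>\<sigma> k\<close> is \<open>\<sigma> (k\<^sup>-\<^sup>1)\<close> up to a unit factor, so \<open>\<sigma> k\<close> preserves the inner product up
  to a unit factor, which is nonnegative by evaluation at a unit vector.\<close>

lemma sigma_op_inner_factor:
  fixes k :: "complex ^ ('n::finite + 'n) ^ ('n + 'n)"
  assumes l: "0 < l" and k: "k \<in> symp_S"
  obtains \<kappa> where "cmod \<kappa> = 1"
    "\<And>f g. f \<in> fock l \<Longrightarrow> g \<in> fock l \<Longrightarrow> fock_inner l (sigma_op l k f) (sigma_op l k g) = \<kappa> * fock_inner l f g"
proof -
  obtain k' where k': "k' \<in> symp_S" "k' ** k = mat 1" "k ** k' = mat 1" using inverse_symp_S[OF k] by metis
  interpret F: sigma_finite_measure "fock_mu l :: (complex ^ 'n) measure"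
    by (rule sigma_finite_fock_mu)
  interpret P: pair_sigma_finite "fock_mu l :: (complex ^ 'n) measure" "fock_mu l :: (complex ^ 'n) measure" ..
  obtain \<epsilon> :: complex where \<epsilon>: "\<epsilon> \<in> {1, -1}"
    "\<And>f z. f \<in> fock_L2 l \<Longrightarrow> sigma_op l (k' ** k) f z = \<epsilon> * sigma_op l k' (sigma_op l k f) z"
    using sigma_op_mult[OF l k'(1) k] by metis
  define c c' where "c = det_factor k" and "c' = det_factor k'"
  have c: "c' \<noteq> 0" "cmod c' = cmod c" "c \<noteq> 0"
    using det_factor_nonzero[OF k'(1)] det_factor_nonzero[OF k] norm_det_factor_inverse[OF k k'(1,3)] by (simp_all add: c_def c'_def)
  have \<epsilon>1: "cmod \<epsilon> = 1" "\<epsilon> * \<epsilon> = 1" using \<epsilon>(1) by auto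
  have "fock_inner l (sigma_op l k f) (sigma_op l k g) = c * cnj (\<epsilon> / c') * fock_inner l f g"
    if f: "f \<in> fock l" and g: "g \<in> fock l" for f g
  proof -
    define G where "G = sigma_op l k g"
    have GF: "G \<in> fock l" unfolding G_def by (rule sigma_op_fock[OF l k g])
    have GL: "(\<lambda>z. cnj (G z)) \<in> fock_L2 l"
      using fock_subset_L2[OF GF]
      by (auto simp: fock_L2_def intro!: borel_measurable_continuous_on[where f = cnj] continuous_intros)
    define K where "K z w = (cnj (G z) * of_real (fock_weight l z)) * (gauss_kernel l k z w * f w * of_real (fock_weight l w))" for z w
    have int: "integrable (fock_mu l \<Otimes>\<^sub>M fock_mu l) (\<lambda>(u, w). K u w)"
      unfolding K_def by (rule gauss_kernel_bilinear_integrable[OF l k fock_subset_L2[OF f] GL])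
    have "fock_inner l (sigma_op l k f) G = (LINT z|fock_mu l. c * (LINT w|fock_mu l. K z w))"
    proof -
      have "(LINT w|fock_mu l. K z w) = cnj (G z) * of_real (fock_weight l z) * op_of_kernel l (gauss_kernel l k) f z" for z
        unfolding K_def op_of_kernel_def by (rule integral_mult_right_zero)
      then show ?thesis
        unfolding fock_inner_def sigma_op_eq c_def by (simp only: mult_ac)
    qed
    also have "\<dots> = c * (LINT z|fock_mu l. (LINT w|fock_mu l. K z w))" by simp
    also have "(LINT z|fock_mu l. (LINT w|fock_mu l. K z w)) = (LINT w|fock_mu l. (LINT z|fock_mu l. K z w))"
      by (rule P.Fubini_integral[OF int, symmetric])
    also have "\<dots> = (LINT w|fock_mu l. cnj (\<epsilon> / c') * (f w * cnj (g w) * of_real (fock_weight l w)))"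
    proof (rule Bochner_Integration.integral_cong[OF refl])
      fix w
      \<comment> \<open>sigma(k') sigma(k) is a sign times the identity, which recovers g from G;
        dividing by c' strips the determinant factor from sigma(k').\<close>
      have "g w = \<epsilon> * sigma_op l k' G w"
        using \<epsilon>(2)[OF fock_subset_L2[OF g], of w] sigma_op_one[OF l g] by (simp add: k'(2) G_def)
      then have "\<epsilon> * g w = c' * op_of_kernel l (gauss_kernel l k') G w"
        using \<epsilon>1(2) by (simp add: sigma_op_eq c'_def mult.assoc[symmetric])
      then have Tg: "op_of_kernel l (gauss_kernel l k') G w = \<epsilon> / c' * g w"
        using c(1) by (simp add: field_simps)
      have "K z w = cnj (gauss_kernel l k' w z * G z * of_real (fock_weight l z)) * (f w * of_real (fock_weight l w))" for z
        using gauss_kernel_inverse[OF k k'(1,2), of l z w, symmetric] by (simp add: K_def mult_ac)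
      then have "(LINT z|fock_mu l. K z w) = (LINT z|fock_mu l. cnj (gauss_kernel l k' w z * G z * of_real (fock_weight l z))) * (f w * of_real (fock_weight l w))"
        by (simp del: complex_cnj_mult)
      also have "(LINT z|fock_mu l. cnj (gauss_kernel l k' w z * G z * of_real (fock_weight l z))) = cnj (op_of_kernel l (gauss_kernel l k') G w)"
        unfolding op_of_kernel_def by (rule Bochner_Integration.integral_cnj)
      finally show "(LINT z|fock_mu l. K z w) = cnj (\<epsilon> / c') * (f w * cnj (g w) * of_real (fock_weight l w))"
        by (simp add: Tg mult_ac)
    qed
    also have "c * \<dots> = c * cnj (\<epsilon> / c') * fock_inner l f g"
      by (simp add: fock_inner_def)
    finally show ?thesis by (simp add: G_def)
  qed
  moreover have "cmod (c * cnj (\<epsilon> / c')) = 1"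
    using c \<epsilon>1 by (simp add: norm_mult norm_divide)
  ultimately show thesis by (intro that) auto
qed

lemma fock_inner_self: "fock_inner l f f = of_real (LINT z|fock_mu l. (cmod (f z))\<^sup>2 * fock_weight l z)"
proof -
  have "f z * cnj (f z) * of_real (fock_weight l z) = of_real ((cmod (f z))\<^sup>2 * fock_weight l z)" for z
    by (simp flip: complex_norm_square)
  then show ?thesis unfolding fock_inner_def by (simp only: integral_complex_of_real)
qed

lemma fock_inner_one:
  assumes "0 < l"
  shows "fock_inner l (\<lambda>z :: complex ^ 'n::finite. 1) (\<lambda>z. 1) = 1"
  using has_bochner_integral_fock_weight[OF assms, where 'n = 'n]
  by (simp add: fock_inner_self has_bochner_integral_iff)

lemma sigma_op_inner:
  fixes f g :: "complex ^ 'n::finite \<Rightarrow> complex"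
  assumes l: "0 < l" and k: "k \<in> symp_S" and "f \<in> fock l" "g \<in> fock l"
  shows "fock_inner l (sigma_op l k f) (sigma_op l k g) = fock_inner l f g"
proof -
  obtain \<kappa> where \<kappa>: "cmod \<kappa> = 1"
    "\<And>f g. f \<in> fock l \<Longrightarrow> g \<in> fock l \<Longrightarrow> fock_inner l (sigma_op l k f) (sigma_op l k g) = \<kappa> * fock_inner l f g"
    using sigma_op_inner_factor[OF l k] by metis
  define x where "x = (LINT z|fock_mu l. (cmod (sigma_op l k (\<lambda>z. 1) z))\<^sup>2 * fock_weight l z)"
  have "\<kappa> = of_real x"
    using \<kappa>(2)[OF one_in_fock[OF l] one_in_fock[OF l]]
    unfolding fock_inner_one[OF l] by (simp add: x_def fock_inner_self)
  moreover have "x \<ge> 0"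
    unfolding x_def by (intro Bochner_Integration.integral_nonneg) simp
  ultimately have "\<kappa> = 1" using \<kappa>(1) by simp
  then show ?thesis using \<kappa>(2)[OF assms(3,4)] by simp
qed

lemma sigma_op_unitary:
  fixes k :: "complex ^ ('n::finite + 'n) ^ ('n + 'n)"
  assumes l: "0 < l" and k: "k \<in> symp_S"
  shows "fock_unitary l (sigma_op l k)"
  unfolding fock_unitary_def
proof (intro conjI ballI allI)
  fix f g :: "complex ^ 'n \<Rightarrow> complex" assume f: "f \<in> fock l" and g: "g \<in> fock l"
  have i: "integrable (fock_mu l) (\<lambda>w. gauss_kernel l k z w * h w * of_real (fock_weight l w))" if "h \<in> fock l" for z h
    by (rule gauss_kernel_integrable[OF l k fock_subset_L2[OF that]])
  show "sigma_op l k (\<lambda>z. f z + g z) = (\<lambda>z. sigma_op l k f z + sigma_op l k g z)"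
    using i[OF f] i[OF g]
    by (simp add: sigma_op_eq op_of_kernel_def distrib_left distrib_right)
  show "fock_inner l (sigma_op l k f) (sigma_op l k g) = fock_inner l f g"
    by (rule sigma_op_inner[OF l k f g])
next
  fix c and f :: "complex ^ 'n \<Rightarrow> complex"
  show "sigma_op l k (\<lambda>z. c * f z) = (\<lambda>z. c * sigma_op l k f z)"
    by (simp add: sigma_op_eq op_of_kernel_cmult mult.left_commute)
next
  show "sigma_op l k ` fock l = fock l"
  proof
    show "sigma_op l k ` fock l \<subseteq> fock l"
      using sigma_op_fock[OF l k] by blast
    obtain k' where k': "k' \<in> symp_S" "k' ** k = mat 1" "k ** k' = mat 1" using inverse_symp_S[OF k] by metis
    obtain \<epsilon> :: complex where \<epsilon>: "\<epsilon> \<in> {1, -1}"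
      "\<And>f z. f \<in> fock_L2 l \<Longrightarrow> sigma_op l (k ** k') f z = \<epsilon> * sigma_op l k (sigma_op l k' f) z"
      using sigma_op_mult[OF l k k'(1)] by metis
    show "fock l \<subseteq> sigma_op l k ` fock l"
    proof
      fix f :: "complex ^ 'n \<Rightarrow> complex" assume f: "f \<in> fock l"
      \<comment> \<open>sigma(k) sigma(k') is \<epsilon> times the identity with \<epsilon> a sign,
        so a preimage of f is \<epsilon> sigma(k') f.\<close>
      have "f = sigma_op l k (\<lambda>z. \<epsilon> * sigma_op l k' f z)"
        using \<epsilon>(2)[OF fock_subset_L2[OF f]] sigma_op_one[OF l f]
        by (simp add: k'(3) fun_eq_iff sigma_op_eq[of l k] op_of_kernel_cmult mult_ac)
      moreover have "(\<lambda>z. \<epsilon> * sigma_op l k' f z) \<in> fock l"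
        by (intro fock_cmult sigma_op_fock l k' f)
      ultimately show "f \<in> sigma_op l k ` fock l" by blast
    qed
  qed
qed

text \<open>Since \<open>gauss_kernel l k z\<close> is antiholomorphic, its mean is its value at \<open>0\<close>.\<close>

lemma sigma_op_vacuum:
  fixes k :: "complex ^ ('n::finite + 'n) ^ ('n + 'n)"
  assumes l: "0 < l" and k: "k \<in> symp_S"
  shows "sigma_op l k (\<lambda>z. 1) = (\<lambda>z. det_factor k * gauss_kernel l k z 0)"
proof
  fix z
  obtain k' where k': "k' \<in> symp_S" "k' ** k = mat 1" using inverse_symp_S[OF k] by metis
  have e: "gauss_kernel l k z w = cnj (gauss_kernel l k' w z)" for w
    using gauss_kernel_inverse[OF k k', of l z w] by (metis complex_cnj_cnj)
  have i: "integrable (fock_mu l) (\<lambda>w. gauss_kernel l k z w * 1 * of_real (fock_weight l w))"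
    by (rule gauss_kernel_integrable[OF l k fock_subset_L2[OF one_in_fock[OF l]]])
  have "integrable (fock_mu l) (\<lambda>w. gauss_kernel l k' w z * of_real (fock_weight l w))"
    using integrable_cnj[OF i] by (simp add: e)
  moreover have "holomorphic_cn (\<lambda>w. gauss_kernel l k' w z)"
  proof -
    have "sp (matrix_inv (block_ul k') *v w) (vcnj z) = sp (transpose (matrix_inv (block_ul k')) *v vcnj z) w" for w
      using sp_matrix_left sp_commute by (rule trans)
    note eq = this
    show ?thesis
      unfolding gauss_kernel_exp gauss_exp_def eq
      by (intro holomorphic_cn_exp holomorphic_cn_mult holomorphic_cn_add holomorphic_cn_const
          holomorphic_cn_sp_matrix holomorphic_cn_sp)
  qed
  ultimately have "(LINT w|fock_mu l. gauss_kernel l k' w z * of_real (fock_weight l w)) = gauss_kernel l k' 0 z"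
    by (intro fock_mean_value[OF l])
  then have "cnj (LINT w|fock_mu l. gauss_kernel l k' w z * of_real (fock_weight l w)) = gauss_kernel l k z 0"
    by (simp add: e)
  then have "(LINT w|fock_mu l. cnj (gauss_kernel l k' w z * of_real (fock_weight l w))) = gauss_kernel l k z 0"
    by (simp only: Bochner_Integration.integral_cnj)
  then show "sigma_op l k (\<lambda>z. 1) z = det_factor k * gauss_kernel l k z 0"
    by (simp add: sigma_op_eq op_of_kernel_def e)
qed

text \<open>The coherent vector at 0 is the function 1, so the kernel at w = 0 determines A 1 = c g.
  Since sigma(k) 1 is \<open>det_factor k\<close> times the same g, unitarity of both operators
  compares the constants without computing the norm of g.\<close>

lemma fock_unitary_kernel_constant:
  fixes k :: "complex ^ ('n::finite + 'n) ^ ('n + 'n)"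
  assumes l: "0 < l" and k: "k \<in> symp_S" and A: "fock_unitary l A"
    and c: "\<And>z w. op_kernel l A z w = c * gauss_kernel l k z w"
  shows "\<exists>u. cmod u = 1 \<and> c = u * det_factor k"
proof -
  let ?one = "\<lambda>z :: complex ^ 'n. 1 :: complex"
  define g where "g = (\<lambda>z. gauss_kernel l k z 0)"
  define N where "N = (LINT z|fock_mu l. (cmod (g z))\<^sup>2 * fock_weight l z)"
  note one = one_in_fock[OF l, where 'n = 'n]
  have A1: "A ?one \<in> fock l" and iA: "fock_inner l (A ?one) (A ?one) = fock_inner l ?one ?one"
    using A one unfolding fock_unitary_def by blast+
  have coh0: "coherent l 0 = ?one"
    by (simp add: coherent_def fun_eq_iff vcnj_simps sp_simps)
  have "A ?one z = c * g z" for z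
  proof -
    \<comment> \<open>The conjugated coherent vectors form the kernel of the identity, so the
      pairing with \<open>coherent l z\<close> evaluates A 1 at z.\<close>
    have "cnj (coherent l z w) = gauss_kernel l (mat 1) z w" for w
      by (simp add: coherent_def gauss_kernel_one exp_cnj cnj_sp vcnj_simps)
    then have "op_kernel l A z 0 = op_of_kernel l (gauss_kernel l (mat 1)) (A ?one) z"
      by (simp add: op_kernel_def fock_inner_def coh0 op_of_kernel_def mult.commute)
    then show ?thesis
      using op_of_gauss_kernel_one[OF l A1] c[of z 0] by (simp add: g_def)
  qed
  then have "A ?one = (\<lambda>z. c * g z)" by (rule ext)
  then have nA: "fock_inner l (\<lambda>z. c * g z) (\<lambda>z. c * g z) = 1"
    using iA fock_inner_one[OF l, where 'n = 'n] by (simp only:)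
  have nS: "fock_inner l (\<lambda>z. det_factor k * g z) (\<lambda>z. det_factor k * g z) = 1"
    using sigma_op_inner[OF l k one one] fock_inner_one[OF l, where 'n = 'n]
    unfolding sigma_op_vacuum[OF l k] g_def by simp
  have n: "fock_inner l (\<lambda>z. b * g z) (\<lambda>z. b * g z) = of_real ((cmod b)\<^sup>2 * N)" for b
    by (simp add: fock_inner_self N_def norm_mult power_mult_distrib mult.assoc)
  have "(cmod c)\<^sup>2 * N = 1" "(cmod (det_factor k))\<^sup>2 * N = 1"
    using nA nS unfolding n by (simp_all only: of_real_eq_1_iff)
  then have "(cmod c)\<^sup>2 = (cmod (det_factor k))\<^sup>2"
    by (metis mult_cancel_right mult_zero_right zero_neq_one)
  then have "cmod c = cmod (det_factor k)" by (simp add: power2_eq_iff_nonneg)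
  then show ?thesis
    using det_factor_nonzero(1)[OF k] by (intro exI[of _ "c / det_factor k"]) (simp add: norm_divide)
qed

theorem proposition4p3:
  fixes l :: real
  assumes "l > 0"
  shows
    "(\<forall>k \<in> (symp_S :: (complex ^ ('n::finite + 'n) ^ ('n + 'n)) set).
       \<forall>(A :: 'n fun_op) (c :: complex).
         fock_unitary l A \<longrightarrow>
         (\<forall>h\<in>heisenberg. \<forall>f\<in>fock l.
            fock_rep l (symp_act k h) (A f) = A (fock_rep l h f)) \<longrightarrow>
         (\<forall>z w. op_kernel l A z w = c * gauss_kernel l k z w) \<longrightarrow>
         (\<exists>u. cmod u = 1 \<and> c = u * det_factor k))
     \<and>
     (\<forall>k \<in> (symp_S :: (complex ^ ('n + 'n) ^ ('n + 'n)) set). fock_unitary l (sigma_op l k))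
     \<and>
     (\<forall>k \<in> (symp_S :: (complex ^ ('n + 'n) ^ ('n + 'n)) set). \<forall>k' \<in> symp_S.
        \<exists>\<epsilon> \<in> {1, -1 :: complex}. \<forall>f\<in>fock l.
          sigma_op l (k ** k') f = (\<lambda>z. \<epsilon> * sigma_op l k (sigma_op l k' f) z))"
proof (intro conjI ballI allI impI)
  fix k :: "complex ^ ('n + 'n) ^ ('n + 'n)" and A :: "'n fun_op" and c
  assume "k \<in> symp_S" "fock_unitary l A" "\<forall>z w. op_kernel l A z w = c * gauss_kernel l k z w"
  then show "\<exists>u. cmod u = 1 \<and> c = u * det_factor k"
    using fock_unitary_kernel_constant[OF assms] by blast
next
  fix k :: "complex ^ ('n + 'n) ^ ('n + 'n)" assume "k \<in> symp_S"
  then show "fock_unitary l (sigma_op l k)" by (rule sigma_op_unitary[OF assms])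
next
  fix k k' :: "complex ^ ('n + 'n) ^ ('n + 'n)" assume "k \<in> symp_S" "k' \<in> symp_S"
  then obtain \<epsilon> :: complex where "\<epsilon> \<in> {1, -1}"
    "\<And>f z. f \<in> fock_L2 l \<Longrightarrow> sigma_op l (k ** k') f z = \<epsilon> * sigma_op l k (sigma_op l k' f) z"
    using sigma_op_mult[OF assms] by metis
  then show "\<exists>\<epsilon> \<in> {1, -1 :: complex}. \<forall>f\<in>fock l.
      sigma_op l (k ** k') f = (\<lambda>z. \<epsilon> * sigma_op l k (sigma_op l k' f) z)"
    using fock_subset_L2 by (intro bexI[of _ \<epsilon>]) (auto simp: fun_eq_iff)
qed

end
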